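(* Let $U_{max}>0$ and $r=\frac{1}{\sqrt{1+U_{max}^2}}$. If $0<r\le \frac12$, then for every $R_f\in SO(3)$, any optimal path from the configuration $I_3$ to the configuration $R_f$ for the geodesic-curvature-constrained shortest path problem on the unit sphere can only be of one of the types $CGC$, $CCC$, $CG$, $GC$, $CC$, $G$, or $C$.
   Context: Model. A configuration is a matrix $\mathcal R=[\mathbf X,\mathbf T,\mathbf N]\in SO(3)$ whose columns are the position $\mathbf X$ on the unit sphere in $\mathbb R^3$, the unit direction of motion $\mathbf T$, and $\mathbf N=\mathbf X\times\mathbf T$. A path of length $L$ is a solution on $[0,L]$ ($s$ is arc length) of $\frac{d\mathbf X}{ds}=\mathbf T$, $\frac{d\mathbf T}{ds}=-\mathbf X+u_g(s)\mathbf N$, $\frac{d\mathbf N}{ds}=-u_g(s)\mathbf T$, where the control $u_g$ (the geodesic curvature) is a measurable function with $|u_g(s)|\le U_{max}$. Shortest path problem. Given $R_f\in SO(3)$, minimize $L$ over all such paths with $\mathcal R(0)=I_3$ and $\mathcal R(L)=R_f$. A path is optimal if it is a minimizer. Arcs. With $r=1/\sqrt{1+U_{max}^2}$, $C$ denotes a circular arc of radius $r$ (the control is constant, equal to $U_{max}$ or to $-U_{max}$), and $G$ denotes an arc of a great circle (control $u_g\equiv 0$). A sequence of letters denotes the concatenation of arcs in the given order; the configuration at the end of each arc equals the configuration at the beginning of the next one. Consecutive $C$'s in a sequence have controls of opposite sign. *)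

theory Defs
  imports "HOL-Analysis.Analysis"
begin

text \<open>
  A configuration is a matrix in \<open>SO(3)\<close>, rendered by \<^const>\<open>rotation_matrix\<close> on
  \<open>real^3^3\<close>. Its columns are the position \<open>X\<close>, the direction of motion \<open>T\<close> and the
  normal \<open>N\<close>; that \<open>N\<close> is the cross product of \<open>X\<close> and \<open>T\<close> is part of being
  orthogonal with determinant 1.
\<close>

abbreviation position :: "real^3^3 \<Rightarrow> real^3" where "position M \<equiv> column 1 M"
abbreviation heading :: "real^3^3 \<Rightarrow> real^3" where "heading M \<equiv> column 2 M"
abbreviation normal_vec :: "real^3^3 \<Rightarrow> real^3" where "normal_vec M \<equiv> column 3 M"

text \<open>
  The control is only measurable, so the differential equations are understood in the sense of
  Caratheodory, written here in the equivalent integrated form (for bounded measurable \<open>u\<close>: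
  an absolutely continuous curve satisfying the equations almost everywhere).
\<close>

definition solves_on :: "(real \<Rightarrow> real) \<Rightarrow> real \<Rightarrow> real \<Rightarrow> (real \<Rightarrow> real^3^3) \<Rightarrow> bool" where
  "solves_on u a b R \<longleftrightarrow>
     (\<forall>s\<in>{a..b}.
        rotation_matrix (R s) \<and>
        ((\<lambda>t. heading (R t)) has_integral (position (R s) - position (R a))) {a..s} \<and>
        ((\<lambda>t. - position (R t) + u t *\<^sub>R normal_vec (R t))
           has_integral (heading (R s) - heading (R a))) {a..s} \<and>
        ((\<lambda>t. - (u t *\<^sub>R heading (R t)))
           has_integral (normal_vec (R s) - normal_vec (R a))) {a..s})"

definition is_path :: "real \<Rightarrow> real \<Rightarrow> (real \<Rightarrow> real^3^3) \<Rightarrow> bool" where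
  "is_path U L R \<longleftrightarrow>
     0 \<le> L \<and>
     (\<exists>u. u \<in> borel_measurable (lebesgue_on {0..L}) \<and>
          (\<forall>s\<in>{0..L}. \<bar>u s\<bar> \<le> U) \<and>
          solves_on u 0 L R)"

definition connects :: "real^3^3 \<Rightarrow> real \<Rightarrow> (real \<Rightarrow> real^3^3) \<Rightarrow> bool" where
  "connects Rf L R \<longleftrightarrow> R 0 = mat 1 \<and> R L = Rf"

definition optimal_path :: "real \<Rightarrow> real^3^3 \<Rightarrow> real \<Rightarrow> (real \<Rightarrow> real^3^3) \<Rightarrow> bool" where
  "optimal_path U Rf L R \<longleftrightarrow>
     is_path U L R \<and> connects Rf L R \<and>
     (\<forall>L' R'. is_path U L' R' \<and> connects Rf L' R' \<longrightarrow> L \<le> L')"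

datatype arc = C | G

text \<open>
  Below, \<open>ts\<close> lists the endpoints of the arcs and \<open>cs\<close> their constant controls. Arcs in a
  sequence of two or more letters have positive length. A one-letter sequence may have length 0;
  this only covers the trivial path, which is the minimizer when \<open>Rf\<close> is the identity.
\<close>

definition has_type :: "real \<Rightarrow> real \<Rightarrow> (real \<Rightarrow> real^3^3) \<Rightarrow> arc list \<Rightarrow> bool" where
  "has_type U L R w \<longleftrightarrow>
     (\<exists>ts cs. length cs = length w \<and> length ts = Suc (length w) \<and>
        ts ! 0 = 0 \<and> ts ! length w = L \<and>
        (\<forall>i<length w.
           ts ! i \<le> ts ! Suc i \<and>
           (1 < length w \<longrightarrow> ts ! i < ts ! Suc i) \<and>
           (w ! i = C \<longrightarrow> cs ! i = U \<or> cs ! i = - U) \<and>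
           (w ! i = G \<longrightarrow> cs ! i = 0) \<and>
           solves_on (\<lambda>_. cs ! i) (ts ! i) (ts ! Suc i) R) \<and>
        (\<forall>i. Suc i < length w \<and> w ! i = C \<and> w ! Suc i = C \<longrightarrow> cs ! Suc i = - (cs ! i)))"

end

theory Submission
  imports Defs
begin

text \<open>
  Write \<open>\<omega> = N + u X\<close> for the angular velocity in space of a path with columns \<open>X, T, N\<close>. If the
  average of \<open>\<omega>\<close> over an optimal path were an interior point of the convex hull of \<open>0\<close> and the
  vectors \<open>N(s) \<plusminus> U X(s)\<close>, then short pieces of the path could be traded for a shorter total
  length of inserted arcs with the same endpoint (the exact endpoint is hit by Brouwer's theorem).
  A supporting hyperplane gives \<open>P \<noteq> 0\<close> and \<open>\<mu> \<ge> 0\<close> with \<open>P \<bullet> N + U \<bar>P \<bullet> X\<bar> = \<mu>\<close>, and \<open>u = U sgn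
  (P \<bullet> X)\<close> almost everywhere off the zeros of \<open>f = P \<bullet> X\<close>.

  Hence \<open>f\<close> is sinusoidal between its zeros. Normalise \<open>\<bar>P\<bar> = 1\<close>. If \<open>\<mu> = 1\<close>, the zeros are
  tangential and form an interval, because an arc between two consecutive zeros would be a full
  circle, which can be cut out; this gives \<open>CGC\<close> and its degenerations. If \<open>\<mu> < 1\<close>, the zeros are
  transversal and all arcs between them have the same angle \<open>\<beta>\<close> with \<open>\<pi> \<le> \<beta> < 2 \<pi>\<close>. Four arcs \<open>C\<^sub>\<alpha>
  C\<^sub>\<beta> C\<^sub>\<beta> C\<^sub>\<gamma>\<close> are then excluded: for \<open>\<beta> > \<pi>\<close> the middle arcs can be made unequal, keeping the
  endpoint and decreasing the length, and for \<open>\<beta> = \<pi>\<close> a short great circle arc is inserted between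
  them. Both comparisons are explicit in unit quaternions, and both use \<open>r \<le> 1/2\<close>.
\<close>

subsection \<open>Rotations and quaternions\<close>

text \<open>Since the control is only measurable, deleting a short piece at a prescribed time has no
  pointwise rate. The perturbation is therefore finite: the path is cut into \<open>n\<close> slots,
  and one of \<open>m\<close> equal pieces is removed from each slot. A greedy choice makes the
  removed pieces represent the average up to an error of order \<open>1 / sqrt n\<close>. With
  \<open>n\<close> fixed, \<open>m\<close> grows until all second order errors are smaller than
  that; the hyperplane appears only in the limit of growing \<open>n\<close>.

  The covector is normalised by its own norm and not by \<open>\<mu>\<close>, so abnormal extremals
  (\<open>\<mu> = 0\<close>) need no separate treatment: they are the case
  \<open>\<beta> = pi\<close>. At a zero of \<open>f\<close> the squared derivative is
  \<open>1 - \<mu>\<^sup>2\<close>, so \<open>\<mu> > 1\<close> means that \<open>f\<close> has no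
  zero and the path is a single arc.

  The bound on \<open>r\<close> enters as \<open>4 * r\<^sup>2 \<le> 1\<close>. It fixes the sign
  that allows unequal middle arcs to balance a smaller total angle, and the sign that allows a great
  circle arc to balance two shortened half circles.\<close>

lemma rotation_matrix_mult:
  "rotation_matrix A \<Longrightarrow> rotation_matrix B \<Longrightarrow> rotation_matrix (A ** B)"
  for A B :: "real^3^3"
  by (simp add: rotation_matrix_def orthogonal_matrix_mul det_mul)

lemma rotation_matrix_transpose:
  "rotation_matrix A \<Longrightarrow> rotation_matrix (transpose A)" for A :: "real^3^3"
  by (simp add: rotation_matrix_def orthogonal_matrix_transpose det_transpose)

lemma rotation_matrix_one: "rotation_matrix (mat 1 :: real^3^3)"
  by (simp add: rotation_matrix_def orthogonal_matrix_id)

lemma rotation_transpose_mult: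
  assumes "rotation_matrix A"
  shows "transpose A ** A = mat 1" "A ** transpose A = mat 1"
  using assms by (auto simp: rotation_matrix_def orthogonal_matrix_def)

lemma rotation_frame:
  assumes "rotation_matrix A"
  shows "position A \<bullet> position A = 1" "heading A \<bullet> heading A = 1" "normal_vec A \<bullet> normal_vec A = 1"
    "position A \<bullet> heading A = 0" "heading A \<bullet> normal_vec A = 0" "position A \<bullet> normal_vec A = 0"
    "cross3 (position A) (heading A) = normal_vec A"
    "cross3 (heading A) (normal_vec A) = position A"
    "cross3 (normal_vec A) (position A) = heading A"
proof -
  have col: "column k A = A *v axis k 1" for k
    by (simp add: matrix_vector_mult_basis)
  have "(transpose A ** A) $ i $ j = column i A \<bullet> column j A" for i j
    by (simp add: matrix_mult_transpose_dot_column)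
  then have d: "column i A \<bullet> column j A = (if i = j then 1 else 0)" for i j
    using rotation_transpose_mult(1)[OF assms] by (simp add: mat_def)
  show "position A \<bullet> position A = 1" "heading A \<bullet> heading A = 1" "normal_vec A \<bullet> normal_vec A = 1"
    "position A \<bullet> heading A = 0" "heading A \<bullet> normal_vec A = 0" "position A \<bullet> normal_vec A = 0"
    by (auto simp: d)
  show "cross3 (position A) (heading A) = normal_vec A"
    "cross3 (heading A) (normal_vec A) = position A"
    "cross3 (normal_vec A) (position A) = heading A"
    unfolding col by (simp_all add: cross_rotation_matrix[OF assms] cross_basis)
qed

lemma rotation_frame_norm:
  fixes A :: "real^3^3"
  assumes "rotation_matrix A"
  shows "norm (column j A) = 1"
  using rotation_frame(1,2,3)[OF assms] exhaust_3[of j] by (auto simp: norm_eq_1)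

lemma rotation_frame_expand:
  fixes A :: "real^3^3"
  assumes "rotation_matrix A"
  shows "(\<Sum>j\<in>UNIV. (column j A \<bullet> v) *\<^sub>R column j A) = v"
proof -
  have "(\<Sum>j\<in>UNIV. (column j A \<bullet> v) *\<^sub>R column j A) = A *v (transpose A *v v)"
    unfolding vec_eq_iff forall_3
    by (simp add: matrix_vector_mult_def column_def transpose_def inner_vec_def sum_3 algebra_simps)
  then show ?thesis
    by (simp add: matrix_vector_mul_assoc rotation_transpose_mult(2)[OF assms] del: transpose_matrix_vector)
qed

lemma rotation_frame_parseval:
  fixes A :: "real^3^3"
  assumes "rotation_matrix A"
  shows "v \<bullet> v = (v \<bullet> position A)\<^sup>2 + (v \<bullet> heading A)\<^sup>2 + (v \<bullet> normal_vec A)\<^sup>2"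
proof -
  have "v \<bullet> v = v \<bullet> (\<Sum>j\<in>UNIV. (column j A \<bullet> v) *\<^sub>R column j A)"
    by (simp only: rotation_frame_expand[OF assms])
  also have "\<dots> = (\<Sum>j\<in>UNIV. (v \<bullet> column j A)\<^sup>2)"
    by (simp add: inner_sum_right power2_eq_square inner_commute)
  finally show ?thesis by (simp add: sum_3)
qed

lemma matrix_column_eqI:
  assumes "position A = position B" "heading A = heading B" "normal_vec A = normal_vec B"
  shows "A = B"
  using assms by (simp add: vec_eq_iff column_def forall_3)

lemma column_matrix_mult: "column j (A ** B) = A *v column j B" for A B :: "real^3^3"
  by (simp add: vec_eq_iff column_def matrix_matrix_mult_def matrix_vector_mult_def)

section \<open>Quaternions and the rotation matrices they represent\<close>

type_synonym quat = "real \<times> real \<times> real \<times> real"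

fun qmult :: "quat \<Rightarrow> quat \<Rightarrow> quat" (infixl "\<star>" 70) where
  "qmult (a, b, c, d) (w, x, y, z) =
     (a * w - b * x - c * y - d * z, a * x + b * w + c * z - d * y,
      a * y - b * z + c * w + d * x, a * z + b * y - c * x + d * w)"

text \<open>Conjugation by a quaternion, without division by its squared norm. The entries are thus
  quadratic polynomials, and multiplicativity is a polynomial identity for all quaternions, not only
  for unit ones.\<close>

fun qrot :: "quat \<Rightarrow> real^3^3" where
  "qrot (w, x, y, z) = vector
     [vector [w\<^sup>2 + x\<^sup>2 - y\<^sup>2 - z\<^sup>2, 2 * (x * y - w * z), 2 * (x * z + w * y)],
      vector [2 * (x * y + w * z), w\<^sup>2 - x\<^sup>2 + y\<^sup>2 - z\<^sup>2, 2 * (y * z - w * x)],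
      vector [2 * (x * z - w * y), 2 * (y * z + w * x), w\<^sup>2 - x\<^sup>2 - y\<^sup>2 + z\<^sup>2]]"

fun qnorm2 :: "quat \<Rightarrow> real" where
  "qnorm2 (w, x, y, z) = w\<^sup>2 + x\<^sup>2 + y\<^sup>2 + z\<^sup>2"

lemma qrot_mult: "qrot (p \<star> q) = qrot p ** qrot q"
proof (cases p; cases q)
  fix a b c d w x y z :: real
  assume pq: "p = (a, b, c, d)" "q = (w, x, y, z)"
  show ?thesis
    unfolding pq
    by (simp add: vec_eq_iff forall_3 matrix_matrix_mult_def sum_3) (intro conjI; algebra)
qed

lemma qrot_one: "qrot (1, 0, 0, 0) = mat 1"
  by (simp add: vec_eq_iff forall_3 mat_def vector_3)

lemma rotation_matrix_qrot:
  assumes "qnorm2 q = 1"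
  shows "rotation_matrix (qrot q)"
proof (cases q)
  fix w x y z assume q: "q = (w, x, y, z)"
  have n: "w\<^sup>2 + x\<^sup>2 + y\<^sup>2 + z\<^sup>2 = 1" using assms q by simp
  have "transpose (qrot q) ** qrot q = mat ((w\<^sup>2 + x\<^sup>2 + y\<^sup>2 + z\<^sup>2)\<^sup>2)"
    unfolding q vec_eq_iff forall_3
    by (simp add: matrix_matrix_mult_def transpose_def sum_3 mat_def power2_eq_square algebra_simps)
  moreover have "det (qrot q) = (w\<^sup>2 + x\<^sup>2 + y\<^sup>2 + z\<^sup>2) ^ 3"
    unfolding q by (simp add: det_3 power2_eq_square power3_eq_cube algebra_simps)
  ultimately show ?thesis
    using n by (simp add: rotation_matrix_def orthogonal_matrix)
qed

text \<open>A unit quaternion for the rotation by \<open>sqrt (1 + v\<^sup>2) * t\<close> about the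
  axis \<open>(v, 0, 1)\<close>. These are the coordinates, in the moving frame, of the angular
  velocity under constant control \<open>v\<close>, so \<open>turn v\<close> is the path with this
  control from the identity.\<close>

definition turn_quat :: "real \<Rightarrow> real \<Rightarrow> quat" where
  "turn_quat v t = (cos (sqrt (1 + v\<^sup>2) * t / 2), v / sqrt (1 + v\<^sup>2) * sin (sqrt (1 + v\<^sup>2) * t / 2),
     0, sin (sqrt (1 + v\<^sup>2) * t / 2) / sqrt (1 + v\<^sup>2))"

definition turn :: "real \<Rightarrow> real \<Rightarrow> real^3^3" where
  "turn v t = qrot (turn_quat v t)"

lemma rotation_matrix_turn: "rotation_matrix (turn v t)"
proof -
  define m where "m = sqrt (1 + v\<^sup>2)"
  have m: "m > 0" "m\<^sup>2 = 1 + v\<^sup>2" "1 + v\<^sup>2 \<noteq> 0"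
    by (auto simp: m_def add_pos_nonneg power2_eq_square sum_power2_eq_zero_iff)
      (metis add_pos_nonneg less_irrefl zero_le_square zero_less_one)
  define s c where "s = sin (m * t / 2)" and "c = cos (m * t / 2)"
  have "c\<^sup>2 + (v / m * s)\<^sup>2 + (s / m)\<^sup>2 = c\<^sup>2 + s\<^sup>2 * ((1 + v\<^sup>2) / m\<^sup>2)"
    by (simp add: power_divide power_mult_distrib add_divide_distrib algebra_simps)
  also have "\<dots> = 1" using m by (simp add: s_def c_def)
  finally show ?thesis
    unfolding turn_def turn_quat_def m_def[symmetric] s_def[symmetric] c_def[symmetric]
    by (intro rotation_matrix_qrot) simp
qed

lemma turn_0: "turn v 0 = mat 1"
  by (simp add: turn_def turn_quat_def qrot_one del: qrot.simps)

lemma turn_columns: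
  fixes v t :: real
  defines "m \<equiv> sqrt (1 + v\<^sup>2)"
  shows "position (turn v t) = vector [1 - (1 - cos (m * t)) / m\<^sup>2, sin (m * t) / m, v * (1 - cos (m * t)) / m\<^sup>2]"
    and "heading (turn v t) = vector [- sin (m * t) / m, cos (m * t), v * sin (m * t) / m]"
    and "normal_vec (turn v t) = vector [v * (1 - cos (m * t)) / m\<^sup>2, - v * sin (m * t) / m, 1 - v\<^sup>2 * (1 - cos
        (m * t)) / m\<^sup>2]"
proof -
  have m: "m > 0" "m\<^sup>2 = 1 + v\<^sup>2" "1 + v\<^sup>2 \<noteq> 0"
    by (auto simp: m_def add_pos_nonneg power2_eq_square sum_power2_eq_zero_iff)
      (metis add_pos_nonneg less_irrefl zero_le_square zero_less_one)
  define s c p where "s = sin (m * t / 2)" and "c = cos (m * t / 2)" and "p = 1 / m"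
  have S: "sin (m * t) = 2 * s * c" and C: "cos (m * t) = 1 - 2 * s\<^sup>2" and cs: "c\<^sup>2 = 1 - s\<^sup>2"
    using sin_double[of "m * t / 2"] cos_double_sin[of "m * t / 2"]
    by (simp_all add: s_def c_def cos_squared_eq)
  have q: "turn v t = qrot (c, v * p * s, 0, s * p)"
    by (simp add: turn_def turn_quat_def m_def[symmetric] s_def[symmetric] c_def[symmetric] p_def)
  have pp: "p\<^sup>2 * (1 + v\<^sup>2) = 1" "x / m = x * p" "x / m\<^sup>2 = x * p\<^sup>2" for x
    using m by (auto simp: p_def power_divide)
  have e: "s\<^sup>2 = s\<^sup>2 * p\<^sup>2 + v\<^sup>2 * s\<^sup>2 * p\<^sup>2"
    using pp(1) by algebra
  have ent: "c\<^sup>2 + (v * p * s)\<^sup>2 - 0\<^sup>2 - (s * p)\<^sup>2 = 1 - (1 - (1 - 2 * s\<^sup>2)) * p\<^sup>2"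
      "c\<^sup>2 - (v * p * s)\<^sup>2 + 0\<^sup>2 - (s * p)\<^sup>2 = 1 - 2 * s\<^sup>2"
      "c\<^sup>2 - (v * p * s)\<^sup>2 - 0\<^sup>2 + (s * p)\<^sup>2 = 1 - v\<^sup>2 * (1 - (1 - 2 * s\<^sup>2)) * p\<^sup>2"
    using e cs by (simp_all add: power_mult_distrib algebra_simps)
  show "position (turn v t) = vector [1 - (1 - cos (m * t)) / m\<^sup>2, sin (m * t) / m, v * (1 - cos (m * t)) / m\<^sup>2]"
    "heading (turn v t) = vector [- sin (m * t) / m, cos (m * t), v * sin (m * t) / m]"
    "normal_vec (turn v t) = vector [v * (1 - cos (m * t)) / m\<^sup>2, - v * sin (m * t) / m, 1 - v\<^sup>2 * (1 - cos (m *
        t)) / m\<^sup>2]"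
    unfolding q S C pp(2,3) vec_eq_iff forall_3 column_def qrot.simps ent
    by (simp_all add: power2_eq_square algebra_simps)
qed

subsection \<open>Solutions of the path equations\<close>

lemma has_integral_between:
  fixes f :: "real \<Rightarrow> 'a::banach"
  assumes "\<And>s. s \<in> {a..b} \<Longrightarrow> (f has_integral (F s - F a)) {a..s}"
    and "a \<le> s" "s \<le> t" "t \<le> b"
  shows "(f has_integral (F t - F s)) {s..t}"
proof -
  have 1: "(f has_integral (F s - F a)) {a..s}" and 2: "(f has_integral (F t - F a)) {a..t}"
    using assms by auto
  have "f integrable_on {s..t}"
    using 2 assms by (meson atLeastatMost_subset_iff has_integral_integrable integrable_on_subinterval order_refl)
  then obtain i where i: "(f has_integral i) {s..t}" by blast
  have "(f has_integral (F s - F a + i)) {a..t}"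
    by (rule has_integral_combine[OF _ _ 1 i]) (use assms in auto)
  then have "i = F t - F s"
    using has_integral_unique[OF 2] by (metis add_diff_cancel_left' diff_diff_eq2 add.commute diff_add_cancel)
  then show ?thesis using i by simp
qed

lemma solves_on_rotation: "solves_on u a b R \<Longrightarrow> s \<in> {a..b} \<Longrightarrow> rotation_matrix (R s)"
  by (simp add: solves_on_def)

lemma solves_on_has_integral:
  assumes "solves_on u a b R" "a \<le> s" "s \<le> t" "t \<le> b"
  shows "((\<lambda>t. heading (R t)) has_integral (position (R t) - position (R s))) {s..t}"
    and "((\<lambda>t. - position (R t) + u t *\<^sub>R normal_vec (R t)) has_integral (heading (R t) - heading (R s))) {s..t}"
    and "((\<lambda>t. - (u t *\<^sub>R heading (R t))) has_integral (normal_vec (R t) - normal_vec (R s))) {s..t}"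
  using assms has_integral_between[of a b _ "\<lambda>s. position (R s)" s t]
    has_integral_between[of a b _ "\<lambda>s. heading (R s)" s t]
    has_integral_between[of a b _ "\<lambda>s. normal_vec (R s)" s t]
  unfolding solves_on_def by auto

lemma solves_on_subset:
  assumes "solves_on u a b R" "a \<le> a'" "b' \<le> b"
  shows "solves_on u a' b' R"
  using solves_on_has_integral[OF assms(1), of a'] solves_on_rotation[OF assms(1)] assms(2,3)
  unfolding solves_on_def[of u a' b'] by auto

lemma solves_on_combine:
  assumes 1: "solves_on u a b R" and 2: "solves_on u b c R" and "a \<le> b" "b \<le> c"
  shows "solves_on u a c R"
proof -
  have I: "(f has_integral F s - F a) {a..s}"
    if "(f has_integral F b - F a) {a..b}" "(f has_integral F s - F b) {b..s}" "b \<le> s"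
    for f F :: "real \<Rightarrow> real^3" and s
    using has_integral_combine[OF _ _ that(1,2)] that(3) assms(3) by simp
  show ?thesis
    unfolding solves_on_def
  proof
    fix s assume s: "s \<in> {a..c}"
    show "rotation_matrix (R s) \<and>
        ((\<lambda>t. heading (R t)) has_integral (position (R s) - position (R a))) {a..s} \<and>
        ((\<lambda>t. - position (R t) + u t *\<^sub>R normal_vec (R t))
           has_integral (heading (R s) - heading (R a))) {a..s} \<and>
        ((\<lambda>t. - (u t *\<^sub>R heading (R t)))
           has_integral (normal_vec (R s) - normal_vec (R a))) {a..s}"
    proof (cases "s \<le> b")
      case True
      then show ?thesis using 1 s by (auto simp: solves_on_def)
    next
      case False
      then have sb: "b \<le> s" by simp
      note h1 = solves_on_has_integral[OF 1 order_refl assms(3) order_refl]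
      note h2 = solves_on_has_integral[OF 2 order_refl sb]
      show ?thesis
        using I[OF h1(1) h2(1) sb] I[OF h1(2) h2(2) sb] I[OF h1(3) h2(3) sb] s sb
          solves_on_rotation[OF 2, of s] by auto
    qed
  qed
qed

text \<open>The left endpoint is exempt because one point does not affect the integrals.
  Concatenation relies on this: at the junction the glued control has the value of the earlier
  piece.\<close>

lemma solves_on_cong:
  assumes "solves_on u a b R" "\<And>s. s \<in> {a<..b} \<Longrightarrow> u s = u' s" "\<And>s. s \<in> {a..b}
      \<Longrightarrow> R s = R' s"
  shows "solves_on u' a b R'"
  unfolding solves_on_def
proof
  fix s assume s: "s \<in> {a..b}"
  have a: "a \<in> {a..b}" using s by auto
  have *: "(g has_integral I) {a..s}"
    if "(f has_integral I) {a..s}" "\<And>x. x \<in> {a<..b} \<Longrightarrow> g x = f x" for f g :: "real \<Rightarrow>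
        real^3" and I
    by (rule has_integral_spike_finite[of "{a}", OF _ _ that(1)]) (use s that(2) in auto)
  note h = solves_on_has_integral[OF assms(1), of a s]
  have le: "a \<le> a" "a \<le> s" "s \<le> b" using s by auto
  note h = h[OF le, unfolded assms(3)[OF s] assms(3)[OF a]]
  show "rotation_matrix (R' s) \<and>
        ((\<lambda>t. heading (R' t)) has_integral (position (R' s) - position (R' a))) {a..s} \<and>
        ((\<lambda>t. - position (R' t) + u' t *\<^sub>R normal_vec (R' t))
           has_integral (heading (R' s) - heading (R' a))) {a..s} \<and>
        ((\<lambda>t. - (u' t *\<^sub>R heading (R' t)))
           has_integral (normal_vec (R' s) - normal_vec (R' a))) {a..s}"
    using solves_on_rotation[OF assms(1) s] assms(2,3)
    by (intro conjI *[OF h(1)] *[OF h(2)] *[OF h(3)]) (auto simp: assms(3)[OF s])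
qed

text \<open>Left invariance: the equations combine columns with scalar coefficients, and
  \<open>Q\<close> acts linearly on each column. Hence any piece of a path can be moved so that it
  starts at the identity.\<close>

lemma solves_on_left_mult:
  assumes "solves_on u a b R" "rotation_matrix Q"
  shows "solves_on u a b (\<lambda>s. Q ** R s)"
proof -
  have *: "((\<lambda>x. Q *v f x) has_integral Q *v I) S" if "(f has_integral I) S"
    for f :: "real \<Rightarrow> real^3" and I S
    using has_integral_linear[OF that matrix_vector_mul_bounded_linear[of Q]] by (simp add: o_def)
  show ?thesis
    unfolding solves_on_def column_matrix_mult
  proof (intro ballI conjI)
    fix s assume s: "s \<in> {a..b}"
    then show "rotation_matrix (Q ** R s)"
      using assms by (simp add: rotation_matrix_mult solves_on_rotation)
    note h = solves_on_has_integral[OF assms(1), of a s]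
    have le: "a \<le> a" "a \<le> s" "s \<le> b" using s by auto
    show "((\<lambda>t. Q *v heading (R t)) has_integral Q *v position (R s) - Q *v position (R a)) {a..s}"
      using *[OF h(1)[OF le]] by (simp add: matrix_vector_mult_diff_distrib)
    show "((\<lambda>t. - (Q *v position (R t)) + u t *\<^sub>R (Q *v normal_vec (R t)))
       has_integral Q *v heading (R s) - Q *v heading (R a)) {a..s}"
      using *[OF h(2)[OF le]]
      by (simp add: matrix_vector_mult_diff_distrib matrix_vector_mult_scaleR algebra_simps)
    show "((\<lambda>t. - (u t *\<^sub>R (Q *v heading (R t))))
       has_integral Q *v normal_vec (R s) - Q *v normal_vec (R a)) {a..s}"
      using *[OF h(3)[OF le]]
      by (simp add: matrix_vector_mult_diff_distrib matrix_vector_mult_scaleR flip: scaleR_minus_left)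
  qed
qed

lemma solves_on_shift:
  assumes "solves_on u a b R"
  shows "solves_on (\<lambda>s. u (s + d)) (a - d) (b - d) (\<lambda>s. R (s + d))"
  unfolding solves_on_def
proof
  fix s assume s: "s \<in> {a - d..b - d}"
  then have le: "a \<le> a" "a \<le> s + d" "s + d \<le> b" by auto
  note h = solves_on_has_integral[OF assms le]
  show "rotation_matrix (R (s + d)) \<and>
        ((\<lambda>t. heading (R (t + d))) has_integral (position (R (s + d)) - position (R (a - d + d)))) {a - d..s} \<and>
        ((\<lambda>t. - position (R (t + d)) + u (t + d) *\<^sub>R normal_vec (R (t + d)))
           has_integral (heading (R (s + d)) - heading (R (a - d + d)))) {a - d..s} \<and>
        ((\<lambda>t. - (u (t + d) *\<^sub>R heading (R (t + d))))
           has_integral (normal_vec (R (s + d)) - normal_vec (R (a - d + d)))) {a - d..s}"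
    using h[THEN has_integral_shift_real_ivl, of d] solves_on_rotation[OF assms, of "s + d"] s
    by auto
qed

lemma matrix_vector_mult_columns:
  "M *v vector [x, y, z] = x *\<^sub>R position M + y *\<^sub>R heading M + z *\<^sub>R normal_vec M" for M :: "real^3^3"
  by (simp add: vec_eq_iff matrix_vector_mult_def column_def sum_3 algebra_simps)

lemma solves_on_turn:
  assumes "rotation_matrix M"
  shows "solves_on (\<lambda>_. v) a b (\<lambda>s. M ** turn v (s - a))"
proof -
  define m where "m = sqrt (1 + v\<^sup>2)"
  have m: "m > 0" "m\<^sup>2 = 1 + v\<^sup>2" by (auto simp: m_def add_pos_nonneg)
  note cols = column_matrix_mult turn_columns[of v, folded m_def] matrix_vector_mult_columns
  define R where "R = (\<lambda>s. M ** turn v (s - a))"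
  have p: "1 / m * (1 + v\<^sup>2) = m" "(1 + v\<^sup>2) / m\<^sup>2 = 1"
    using m by (auto simp: power2_eq_square field_simps)
  have d1: "((\<lambda>s. position (R s)) has_vector_derivative heading (R s)) (at s within S)" for s S
    unfolding R_def cols using m(1)
    by (auto intro!: derivative_eq_intros has_vector_derivative_real_field simp: power2_eq_square algebra_simps
        has_real_derivative_iff_has_vector_derivative[symmetric])
  have d2: "((\<lambda>s. heading (R s)) has_vector_derivative - position (R s) + v *\<^sub>R normal_vec (R s)) (at s within
      S)" for s S
  proof -
    \<comment> \<open>Coordinates of the right-hand side in the fixed frame \<open>M\<close>. The
      relation \<open>m\<^sup>2 = 1 + v\<^sup>2\<close> merges the \<open>1 - cos\<close> terms and
      turns the sine coefficient into a multiple of \<open>m\<close>.\<close>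
    have e: "- position (R s) + v *\<^sub>R normal_vec (R s) =
        (- cos (m * (s - a))) *\<^sub>R position M + (- sin (m * (s - a)) * m) *\<^sub>R heading M
        + (v * cos (m * (s - a))) *\<^sub>R normal_vec M"
    proof -
      define C where "C = cos (m * (s - a))"
      define D where "D = (1 - C) / m\<^sup>2"
      have D: "D + v\<^sup>2 * D = 1 - C"
      proof -
        have "D + v\<^sup>2 * D = (1 + v\<^sup>2) * D" by (simp add: algebra_simps)
        also have "\<dots> = 1 - C" using m by (simp add: D_def flip: m(2))
        finally show ?thesis .
      qed
      have S: "sin (m * (s - a)) / m + v * v * sin (m * (s - a)) / m = sin (m * (s - a)) * m"
      proof -
        have "sin (m * (s - a)) / m + v * v * sin (m * (s - a)) / m = sin (m * (s - a)) * (1 / m * (1 + v\<^sup>2))"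
          by (simp add: algebra_simps power2_eq_square add_divide_distrib)
        then show ?thesis by (simp only: p(1))
      qed
      have "- position (R s) + v *\<^sub>R normal_vec (R s) =
         (- 1 + (D + v\<^sup>2 * D)) *\<^sub>R position M
         + (- (sin (m * (s - a)) / m + v * v * sin (m * (s - a)) / m)) *\<^sub>R heading M
         + (v - v * (D + v\<^sup>2 * D)) *\<^sub>R normal_vec M"
        unfolding R_def cols C_def[symmetric]
        by (simp add: D_def algebra_simps power2_eq_square diff_divide_distrib)
      then show ?thesis unfolding D S C_def by (simp add: algebra_simps)
    qed
    show ?thesis
      unfolding e unfolding R_def cols using m(1)
      by (auto intro!: derivative_eq_intros simp: algebra_simps has_real_derivative_iff_has_vector_derivative[symmetric])
  qed
  have d3: "((\<lambda>s. normal_vec (R s)) has_vector_derivative - (v *\<^sub>R heading (R s))) (at s within S)" for s S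
    unfolding R_def cols using m(1)
    by (auto intro!: derivative_eq_intros simp: power2_eq_square algebra_simps
        has_real_derivative_iff_has_vector_derivative[symmetric])
  have rot: "rotation_matrix (R s)" for s
    by (simp add: R_def rotation_matrix_mult rotation_matrix_turn assms)
  have "solves_on (\<lambda>_. v) a b R"
    unfolding solves_on_def
    by (intro ballI conjI rot fundamental_theorem_of_calculus d1 d2 d3) auto
  then show ?thesis by (simp add: R_def)
qed

lemma solves_on_continuous_column:
  assumes "solves_on u a b R"
  shows "continuous_on {a..b} (\<lambda>s. column j (R s))"
proof -
  have *: "continuous_on {a..b} F"
    if F: "\<And>s. s \<in> {a..b} \<Longrightarrow> (f has_integral (F s - F a)) {a..s}" for f F :: "real \<Rightarrow> real^3"
  proof (cases "a \<le> b")
    case True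
    then have "f integrable_on {a..b}" using F[of b] by auto
    then have "continuous_on {a..b} (\<lambda>s. F a + integral {a..s} f)"
      by (intro continuous_intros indefinite_integral_continuous_1)
    moreover have "F a + integral {a..s} f = F s" if "s \<in> {a..b}" for s
      using integral_unique[OF F[OF that]] by simp
    ultimately show ?thesis by (rule continuous_on_eq)
  qed auto
  show ?thesis
    using assms exhaust_3[of j] unfolding solves_on_def by (auto intro: *)
qed

lemma continuous_on_column_matrix:
  fixes R :: "'a::topological_space \<Rightarrow> real^3^3"
  assumes "\<And>j. continuous_on S (\<lambda>s. column j (R s))"
  shows "continuous_on S R"
proof -
  have "continuous_on S (\<lambda>s. R s $ i $ j)" for i j
    using continuous_on_vec_lambda assms continuous_on_component[OF assms[of j], of i] by (simp add: column_def)
  then have "continuous_on S (\<lambda>s. \<chi> i j. R s $ i $ j)"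
    by (intro continuous_on_vec_lambda)
  then show ?thesis by simp
qed

text \<open>A constant control makes all integrands continuous, so the integral form yields
  derivatives at every point.\<close>

lemma solves_on_derivative:
  assumes "solves_on (\<lambda>_. v) a b R" "s \<in> {a..b}"
  shows "((\<lambda>s. position (R s)) has_vector_derivative heading (R s)) (at s within {a..b})"
    and "((\<lambda>s. heading (R s)) has_vector_derivative - position (R s) + v *\<^sub>R normal_vec (R s)) (at s within {a..b})"
    and "((\<lambda>s. normal_vec (R s)) has_vector_derivative - (v *\<^sub>R heading (R s))) (at s within {a..b})"
proof -
  have *: "(F has_vector_derivative f s) (at s within {a..b})"
    if F: "\<And>s. s \<in> {a..b} \<Longrightarrow> (f has_integral (F s - F a)) {a..s}" and c: "continuous_on {a..b} f"
    for f F :: "real \<Rightarrow> real^3"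
  proof -
    have "((\<lambda>x. F a + integral {a..x} f) has_vector_derivative 0 + f s) (at s within {a..b})"
      by (intro derivative_intros integral_has_vector_derivative[OF c assms(2)])
    moreover have "F a + integral {a..s} f = F s" if "s \<in> {a..b}" for s
      using integral_unique[OF F[OF that]] by simp
    ultimately show ?thesis
      using assms(2) by (auto elim!: has_vector_derivative_transform[rotated 2])
  qed
  note c = solves_on_continuous_column[OF assms(1)]
  show "((\<lambda>s. position (R s)) has_vector_derivative heading (R s)) (at s within {a..b})"
    by (rule *) (use assms in \<open>auto simp: solves_on_def intro: c\<close>)
  show "((\<lambda>s. heading (R s)) has_vector_derivative - position (R s) + v *\<^sub>R normal_vec (R s)) (at s within {a..b})"
    by (rule *) (use assms in \<open>auto simp: solves_on_def intro!: continuous_intros c\<close>)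
  show "((\<lambda>s. normal_vec (R s)) has_vector_derivative - (v *\<^sub>R heading (R s))) (at s within {a..b})"
    by (rule *) (use assms in \<open>auto simp: solves_on_def intro!: continuous_intros c\<close>)
qed

text \<open>The equations are antisymmetric in the frame vectors, so two solutions stay at constant
  distance.\<close>

lemma solves_on_unique:
  assumes 1: "solves_on (\<lambda>_. v) a b R" and 2: "solves_on (\<lambda>_. v) a b Q" and eq: "R a = Q a" and s: "s \<in> {a..b}"
  shows "R s = Q s"
proof -
  define d where "d = (\<lambda>j s. column j (R s) - column j (Q s))"
  define E where "E = (\<lambda>s. d 1 s \<bullet> d 1 s + d 2 s \<bullet> d 2 s + d 3 s \<bullet> d 3 s)"
  have "(E has_field_derivative 0) (at s within {a..b})" if s: "s \<in> {a..b}" for s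
  proof -
    have d1: "(d 1 has_vector_derivative d 2 s) (at s within {a..b})"
      unfolding d_def by (intro has_vector_derivative_diff solves_on_derivative[OF 1 s] solves_on_derivative[OF 2 s])
    have "(d 2 has_vector_derivative (- position (R s) + v *\<^sub>R normal_vec (R s)) - (- position (Q s) + v *\<^sub>R
        normal_vec (Q s))) (at s within {a..b})"
      unfolding d_def by (intro has_vector_derivative_diff solves_on_derivative[OF 1 s] solves_on_derivative[OF 2 s])
    then have d2: "(d 2 has_vector_derivative - d 1 s + v *\<^sub>R d 3 s) (at s within {a..b})"
      by (simp add: d_def algebra_simps)
    have "(d 3 has_vector_derivative (- (v *\<^sub>R heading (R s))) - (- (v *\<^sub>R heading (Q s)))) (at s within {a..b})"
      unfolding d_def by (intro has_vector_derivative_diff solves_on_derivative[OF 1 s] solves_on_derivative[OF 2 s])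
    then have d3: "(d 3 has_vector_derivative - (v *\<^sub>R d 2 s)) (at s within {a..b})"
      by (simp add: d_def algebra_simps)
    note D = bounded_bilinear.has_vector_derivative[OF bounded_bilinear_inner]
    have "(E has_vector_derivative (d 1 s \<bullet> d 2 s + d 2 s \<bullet> d 1 s) +
       (d 2 s \<bullet> (- d 1 s + v *\<^sub>R d 3 s) + (- d 1 s + v *\<^sub>R d 3 s) \<bullet> d 2 s) +
       (d 3 s \<bullet> (- (v *\<^sub>R d 2 s)) + (- (v *\<^sub>R d 2 s)) \<bullet> d 3 s)) (at s within {a..b})"
      unfolding E_def by (intro has_vector_derivative_add D d1 d2 d3)
    then show ?thesis
      by (simp add: has_real_derivative_iff_has_vector_derivative inner_commute algebra_simps)
  qed
  then obtain c where c: "\<And>x. x \<in> {a..b} \<Longrightarrow> E x = c"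
    using has_field_derivative_zero_constant[of "{a..b}" E] by auto
  have "E s = E a" using c[of s] c[of a] s by auto
  also have "E a = 0" by (simp add: E_def d_def eq)
  finally have "d 1 s = 0 \<and> d 2 s = 0 \<and> d 3 s = 0"
    unfolding E_def by (smt (verit) inner_ge_zero inner_eq_zero_iff)
  then show ?thesis by (intro matrix_column_eqI) (auto simp: d_def)
qed

lemma solves_on_const_eq_turn:
  assumes "solves_on (\<lambda>_. v) a b R" "s \<in> {a..b}"
  shows "R s = R a ** turn v (s - a)"
proof (rule solves_on_unique[OF assms(1) _ _ assms(2)])
  show "solves_on (\<lambda>_. v) a b (\<lambda>s. R a ** turn v (s - a))"
    using assms by (intro solves_on_turn solves_on_rotation[OF assms(1)]) auto
qed (simp add: turn_0)

subsection \<open>Reachable configurations\<close>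

text \<open>Some path has length \<open>l\<close>, not necessarily a shortest one. Optimality is
  used only as the bound \<open>L \<le> l\<close> for every such \<open>l\<close>.\<close>

definition reach :: "real \<Rightarrow> real^3^3 \<Rightarrow> real \<Rightarrow> bool" where
  "reach U g l \<longleftrightarrow> (\<exists>R. is_path U l R \<and> R 0 = mat 1 \<and> R l = g)"

lemma reach_turn:
  assumes "\<bar>v\<bar> \<le> U" "0 \<le> t"
  shows "reach U (turn v t) t"
proof -
  have "solves_on (\<lambda>_. v) 0 t (\<lambda>s. mat 1 ** turn v (s - 0))"
    by (intro solves_on_turn rotation_matrix_one)
  then have "is_path U t (turn v)"
    unfolding is_path_def using assms by (intro conjI exI[of _ "\<lambda>_. v"]) simp_all
  then show ?thesis unfolding reach_def using turn_0 by blast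
qed

lemma reach_segment:
  assumes R: "solves_on u 0 L R" "u \<in> borel_measurable (lebesgue_on {0..L})" "\<And>s. s \<in> {0..L} \<Longrightarrow>
      \<bar>u s\<bar> \<le> U"
    and ab: "0 \<le> a" "a \<le> b" "b \<le> L"
  shows "reach U (transpose (R a) ** R b) (b - a)"
proof -
  \<comment> \<open>Extension by zero: measurability becomes a statement on the whole line, where
    translation by \<open>a\<close> preserves it.\<close>
  define w where "w = (\<lambda>x. if x \<in> {0..L} then u x else 0)"
  have w: "w \<in> borel_measurable lebesgue"
    unfolding w_def using R(2) by (subst borel_measurable_if) auto
  have "(\<lambda>x. a + 1 * x) \<in> lebesgue \<rightarrow>\<^sub>M lebesgue"
    using lebesgue_affine_measurable[where c = "\<lambda>x::real. 1" and t = a] by simp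
  then have "(\<lambda>x. w (x + a)) \<in> borel_measurable lebesgue"
    using measurable_compose[OF _ w] by (simp add: add.commute)
  then have "(\<lambda>x. w (x + a)) \<in> borel_measurable (lebesgue_on {0..b - a})"
    by (rule measurable_restrict_space1)
  moreover have "solves_on (\<lambda>s. w (s + a)) 0 (b - a) (\<lambda>s. transpose (R a) ** R (s + a))"
  proof (rule solves_on_left_mult)
    have "solves_on (\<lambda>s. u (s + a)) 0 (b - a) (\<lambda>s. R (s + a))"
      using solves_on_shift[OF solves_on_subset[OF R(1) ab(1,3)], of a] by simp
    then show "solves_on (\<lambda>s. w (s + a)) 0 (b - a) (\<lambda>s. R (s + a))"
      by (rule solves_on_cong) (use ab in \<open>auto simp: w_def\<close>)
    show "rotation_matrix (transpose (R a))"
      using ab by (intro rotation_matrix_transpose solves_on_rotation[OF R(1)]) auto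
  qed
  moreover have "\<bar>w x\<bar> \<le> U" for x
    using R(3)[of x] R(3)[of a] ab by (auto simp: w_def)
  ultimately have "is_path U (b - a) (\<lambda>s. transpose (R a) ** R (s + a))"
    unfolding is_path_def using ab by auto
  moreover have "transpose (R a) ** R (0 + a) = mat 1"
    using ab by (simp add: rotation_transpose_mult solves_on_rotation[OF R(1)])
  ultimately show ?thesis
    unfolding reach_def by (intro exI[of _ "\<lambda>s. transpose (R a) ** R (s + a)"]) simp
qed

text \<open>Left invariance moves the second path to the endpoint \<open>g\<close> of the first
  one.\<close>

lemma reach_mult:
  assumes "reach U g k" "reach U h l"
  shows "reach U (g ** h) (k + l)"
proof -
  obtain R u where R: "R 0 = mat 1" "R k = g" and u: "0 \<le> k" "u \<in> borel_measurable (lebesgue_on {0..k})"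
      "\<And>s. s \<in> {0..k} \<Longrightarrow> \<bar>u s\<bar> \<le> U" "solves_on u 0 k R"
    using assms(1) unfolding reach_def is_path_def by auto
  obtain Q v where Q: "Q 0 = mat 1" "Q l = h" and v: "0 \<le> l" "v \<in> borel_measurable (lebesgue_on {0..l})"
      "\<And>s. s \<in> {0..l} \<Longrightarrow> \<bar>v s\<bar> \<le> U" "solves_on v 0 l Q"
    using assms(2) unfolding reach_def is_path_def by auto
  define u' where "u' = (\<lambda>x. if x \<in> {0..k} then u x else 0)"
  define v' where "v' = (\<lambda>x. if x \<in> {0..l} then v x else 0)"
  have U: "0 \<le> U" using u(3)[of 0] u(1) by force
  define w where "w = (\<lambda>x. if x \<in> {0..k} then u' x else v' (x - k))"
  define P where "P = (\<lambda>s. if s \<le> k then R s else g ** Q (s - k))"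
  have "u' \<in> borel_measurable lebesgue"
    unfolding u'_def using u(2) by (subst borel_measurable_if) auto
  moreover have v': "v' \<in> borel_measurable lebesgue"
    unfolding v'_def using v(2) by (subst borel_measurable_if) auto
  have "(\<lambda>x. - k + 1 * x) \<in> lebesgue \<rightarrow>\<^sub>M lebesgue"
    using lebesgue_affine_measurable[where c = "\<lambda>x::real. 1" and t = "- k"] by simp
  then have "(\<lambda>x. v' (x - k)) \<in> borel_measurable lebesgue"
    using measurable_compose[OF _ v'] by (simp add: add.commute)
  moreover have "{0..k} \<inter> space lebesgue \<in> sets lebesgue" by simp
  ultimately have "w \<in> borel_measurable lebesgue"
    unfolding w_def by (intro measurable_If_set)
  then have "w \<in> borel_measurable (lebesgue_on {0..k + l})"
    by (rule measurable_restrict_space1)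
  moreover have "\<bar>w s\<bar> \<le> U" for s
    using u(3) v(3) U by (auto simp: w_def u'_def v'_def)
  moreover have "solves_on w 0 (k + l) P"
  proof (rule solves_on_combine[OF _ _ u(1)])
    show "solves_on w 0 k P"
      using u(4) by (rule solves_on_cong) (auto simp: w_def u'_def P_def)
    have "solves_on (\<lambda>s. v (s + - k)) (0 - - k) (l - - k) (\<lambda>s. g ** Q (s + - k))"
      using u(1) R(2) solves_on_rotation[OF u(4), of k]
      by (intro solves_on_left_mult solves_on_shift v(4)) auto
    then have "solves_on (\<lambda>s. v (s - k)) k (k + l) (\<lambda>s. g ** Q (s - k))"
      by (simp add: add.commute)
    then show "solves_on w k (k + l) P"
      by (rule solves_on_cong) (use Q R u(1) in \<open>auto simp: w_def v'_def P_def\<close>)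
  qed (use v in auto)
  ultimately have "is_path U (k + l) P"
    unfolding is_path_def using u(1) v(1) by auto
  moreover have "P 0 = mat 1" "P (k + l) = g ** h"
    using R Q u(1) v(1) by (auto simp: P_def)
  ultimately show ?thesis unfolding reach_def by blast
qed

lemma optimal_path_le_reach:
  assumes "optimal_path U Rf L R" "reach U Rf l"
  shows "L \<le> l"
  using assms unfolding optimal_path_def reach_def connects_def by blast

subsection \<open>First order expansion of rotations\<close>

text \<open>The axial vector of the antisymmetric part. For a rotation by angle \<open>t\<close>
  about a unit axis \<open>a\<close> it is \<open>sin t\<close> times \<open>a\<close>, hence a
  first order coordinate near the identity; it also vanishes at half turns.\<close>

definition vee :: "real^3^3 \<Rightarrow> real^3" where
  "vee M = vector [(M $ 3 $ 2 - M $ 2 $ 3) / 2, (M $ 1 $ 3 - M $ 3 $ 1) / 2, (M $ 2 $ 1 - M $ 1 $ 2) / 2]"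

lemma vee_add: "vee (A + B) = vee A + vee B"
  and vee_diff: "vee (A - B) = vee A - vee B"
  and vee_one: "vee (mat 1) = 0"
  by (simp_all add: vee_def vec_eq_iff forall_3 mat_def field_simps)

lemma vee_transpose: "vee (transpose A) = - vee A"
  by (simp add: vee_def vec_eq_iff forall_3 transpose_def field_simps)

lemma norm_vee_le: "norm (vee M) \<le> 3 * norm M"
proof -
  have c: "\<bar>M $ i $ j\<bar> \<le> norm M" for i j
    using order_trans[OF component_le_norm_cart[of "M $ i" j] Finite_Cartesian_Product.norm_nth_le[of M i]] by simp
  have "\<bar>vee M $ i\<bar> \<le> norm M" for i
    using exhaust_3[of i] c[of 3 2] c[of 2 3] c[of 1 3] c[of 3 1] c[of 2 1] c[of 1 2]
    by (auto simp: vee_def)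
  then have "(\<Sum>i\<in>UNIV. \<bar>vee M $ i\<bar>) \<le> (\<Sum>i\<in>(UNIV::3 set). norm M)"
    by (intro sum_mono)
  then show ?thesis using norm_le_l1_cart[of "vee M"] by simp
qed

text \<open>Reads a displacement off the columns: if each column of \<open>A\<close> is that of the
  orthonormal frame \<open>B\<close> moved by the velocity \<open>cross3 w\<close>, the sum is
  \<open>2 w\<close>, whence the factor \<open>1 / 2\<close>.\<close>

lemma vee_mult_transpose:
  "vee (A ** transpose B) = (1 / 2) *\<^sub>R (\<Sum>j\<in>UNIV. cross3 (column j B) (column j A))"
  for A B :: "real^3^3"
  by (simp add: vee_def vec_eq_iff forall_3 matrix_matrix_mult_def transpose_def column_def
      cross3_def sum_3 algebra_simps) (simp add: field_simps)

lemma matrix_diff_ldistrib: "(A - B) ** C = A ** C - B ** C"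
  and matrix_diff_rdistrib: "C ** (A - B) = C ** A - C ** B" for A B C :: "real^3^3"
  by (simp_all add: vec_eq_iff matrix_matrix_mult_def sum_subtractf algebra_simps)

text \<open>The norm of \<open>real^3^3\<close> is the Frobenius norm, so Cauchy-Schwarz for each
  entry (row times column) gives submultiplicativity.\<close>

lemma norm_matrix_mult_le: "norm (A ** B) \<le> norm A * norm B" for A B :: "real^3^3"
proof -
  have n: "(norm M)\<^sup>2 = (\<Sum>i\<in>UNIV. \<Sum>j\<in>UNIV. (M $ i $ j)\<^sup>2)" for M :: "real^3^3"
    by (simp add: norm_vec_def L2_set_def sum_nonneg)
  have v: "(norm v)\<^sup>2 = (\<Sum>i\<in>UNIV. (v $ i)\<^sup>2)" for v :: "real^3"
    by (simp add: norm_vec_def L2_set_def sum_nonneg)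
  have "(norm (A ** B))\<^sup>2 = (\<Sum>i\<in>UNIV. \<Sum>j\<in>UNIV. (A $ i \<bullet> column j B)\<^sup>2)"
    unfolding n by (simp add: matrix_matrix_mult_def column_def inner_vec_def)
  also have "\<dots> \<le> (\<Sum>i\<in>UNIV. \<Sum>j\<in>UNIV. (norm (A $ i))\<^sup>2 * (norm (column j B))\<^sup>2)"
  proof (intro sum_mono)
    fix i j
    show "(A $ i \<bullet> column j B)\<^sup>2 \<le> (norm (A $ i))\<^sup>2 * (norm (column j B))\<^sup>2"
      using Cauchy_Schwarz_ineq[of "A $ i" "column j B"] by (simp add: power2_norm_eq_inner)
  qed
  also have "\<dots> = (\<Sum>i\<in>UNIV. (norm (A $ i))\<^sup>2) * (\<Sum>j\<in>UNIV. (norm (column j B))\<^sup>2)"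
    by (rule sum_product[symmetric])
  also have "(\<Sum>i\<in>UNIV. (norm (A $ i))\<^sup>2) = (norm A)\<^sup>2"
    unfolding v n ..
  also have "(\<Sum>j\<in>UNIV. (norm (column j B))\<^sup>2) = (norm B)\<^sup>2"
    unfolding v n column_def by (subst sum.swap) simp
  also have "(norm A)\<^sup>2 * (norm B)\<^sup>2 = (norm A * norm B)\<^sup>2"
    by (rule power_mult_distrib[symmetric])
  finally show ?thesis by (rule power2_le_imp_le) simp
qed

lemma norm_matrix_le_columns:
  "norm M \<le> norm (position M) + norm (heading M) + norm (normal_vec M)" for M :: "real^3^3"
proof (rule power2_le_imp_le)
  have "(norm M)\<^sup>2 = (norm (position M))\<^sup>2 + (norm (heading M))\<^sup>2 + (norm (normal_vec M))\<^sup>2"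
    by (simp add: norm_vec_def L2_set_def sum_nonneg column_def sum_3)
  also have "\<dots> \<le> (norm (position M) + norm (heading M) + norm (normal_vec M))\<^sup>2"
    by (simp add: power2_sum)
  finally show "(norm M)\<^sup>2 \<le> (norm (position M) + norm (heading M) + norm (normal_vec M))\<^sup>2" .
qed simp

lemma norm_transpose: "norm (transpose M) = norm M" for M :: "real^3^3"
  by (simp add: norm_vec_def L2_set_def sum_nonneg transpose_def sum_3 add_ac)

lemma norm_rotation_le: "rotation_matrix M \<Longrightarrow> norm M \<le> 3" for M :: "real^3^3"
  using norm_matrix_le_columns[of M] by (simp add: rotation_frame_norm)

text \<open>A symmetric rotation \<open>M\<close> is an involution, so \<open>D = M - 1\<close> satisfies \<open>D\<^sup>2 = - 2 D\<close>, which
  forces \<open>D = 0\<close> once \<open>D\<close> is small.\<close>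

lemma rotation_eq_one_if_vee_zero:
  assumes M: "rotation_matrix M" "vee M = 0" and small: "norm (M - mat 1) < 2"
  shows "M = mat 1"
proof -
  have "transpose M = M"
    using M(2) by (simp add: vee_def vec_eq_iff forall_3 transpose_def)
  then have inv: "M ** M = mat 1"
    using rotation_transpose_mult(1)[OF M(1)] by simp
  define D where "D = M - mat 1"
  have "D ** D = - (2 *\<^sub>R D)"
    by (simp add: D_def matrix_diff_ldistrib matrix_diff_rdistrib inv scaleR_2)
  then have "2 * norm D = norm (D ** D)" by simp
  also have "\<dots> \<le> norm D * norm D" by (rule norm_matrix_mult_le)
  finally have "norm D = 0"
    using small unfolding D_def[symmetric] by (metis mult_right_le_imp_le norm_ge_zero not_less order_le_less)
  then show ?thesis by (simp add: D_def)
qed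

definition ang :: "(real \<Rightarrow> real) \<Rightarrow> (real \<Rightarrow> real^3^3) \<Rightarrow> real \<Rightarrow>
    real^3" where
  "ang u R s = normal_vec (R s) + u s *\<^sub>R position (R s)"

lemma norm_ang_le:
  assumes "rotation_matrix (R s)" "\<bar>u s\<bar> \<le> U"
  shows "norm (ang u R s) \<le> 1 + U"
proof -
  have "norm (ang u R s) \<le> norm (normal_vec (R s)) + norm (u s *\<^sub>R position (R s))"
    unfolding ang_def by (rule norm_triangle_ineq)
  then show ?thesis using assms by (simp add: rotation_frame_norm)
qed

lemma ang_integrable:
  assumes R: "solves_on u 0 L R" "u \<in> borel_measurable (lebesgue_on {0..L})" "\<And>s. s \<in> {0..L} \<Longrightarrow>
      \<bar>u s\<bar> \<le> U"
    and ab: "0 \<le> a" "b \<le> L"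
  shows "ang u R integrable_on {a..b}"
proof -
  have c: "(\<lambda>s. column j (R s)) \<in> borel_measurable (lebesgue_on {0..L})" for j
    by (intro continuous_imp_measurable_on_sets_lebesgue solves_on_continuous_column[OF R(1)]) auto
  have "(\<lambda>s. normal_vec (R s) + u s *\<^sub>R position (R s)) \<in> borel_measurable (lebesgue_on {0..L})"
    by (intro borel_measurable_add borel_measurable_scaleR c R(2))
  then have "ang u R \<in> borel_measurable (lebesgue_on {0..L})"
    unfolding ang_def[abs_def] .
  then have "ang u R integrable_on {0..L}"
    by (rule measurable_bounded_by_integrable_imp_integrable[where g = "\<lambda>_. 1 + U"])
      (use norm_ang_le solves_on_rotation[OF R(1)] R(3) in \<open>auto intro!: integrable_const_ivl\<close>)
  then show ?thesis
    using ab by (auto elim!: integrable_on_subinterval)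
qed

lemma norm_cross3_le: "norm (cross3 x y) \<le> norm x * norm y"
proof (rule power2_le_imp_le)
  show "(norm (cross3 x y))\<^sup>2 \<le> (norm x * norm y)\<^sup>2"
    using norm_cross_dot[of x y] by (metis le_add_same_cancel1 zero_le_power2)
qed simp

lemma bounded_linear_cross3_left: "bounded_linear (\<lambda>x. cross3 x y)"
  and bounded_linear_cross3_right: "bounded_linear (cross3 y)"
  using bilinear_cross unfolding bilinear_def by (auto simp: linear_conv_bounded_linear)

text \<open>The three equations in one: every column is moved by the same angular velocity. This
  shape lets one estimate serve all columns.\<close>

lemma solves_on_column_has_integral:
  assumes "solves_on u a b R" "a \<le> s" "s \<le> t" "t \<le> b"
  shows "((\<lambda>\<tau>. cross3 (ang u R \<tau>) (column j (R \<tau>))) has_integral (column j (R t) - column j (R s))) {s..t}"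
proof -
  have e: "cross3 (ang u R \<tau>) (position (R \<tau>)) = heading (R \<tau>)"
    "cross3 (ang u R \<tau>) (heading (R \<tau>)) = - position (R \<tau>) + u \<tau> *\<^sub>R normal_vec (R \<tau>)"
    "cross3 (ang u R \<tau>) (normal_vec (R \<tau>)) = - (u \<tau> *\<^sub>R heading (R \<tau>))" if "\<tau> \<in> {s..t}"
        for \<tau>
  proof -
    have r: "rotation_matrix (R \<tau>)" using that assms by (intro solves_on_rotation[OF assms(1)]) auto
    have "cross3 (normal_vec (R \<tau>)) (heading (R \<tau>)) = - position (R \<tau>)"
      "cross3 (position (R \<tau>)) (normal_vec (R \<tau>)) = - heading (R \<tau>)"
      using rotation_frame(8,9)[OF r] cross_skew by metis+
    then show "cross3 (ang u R \<tau>) (position (R \<tau>)) = heading (R \<tau>)"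
      "cross3 (ang u R \<tau>) (heading (R \<tau>)) = - position (R \<tau>) + u \<tau> *\<^sub>R normal_vec (R \<tau>)"
      "cross3 (ang u R \<tau>) (normal_vec (R \<tau>)) = - (u \<tau> *\<^sub>R heading (R \<tau>))"
      using rotation_frame(7-9)[OF r] by (simp_all add: ang_def cross_add_left cross_mult_left)
  qed
  note h = solves_on_has_integral[OF assms]
  show ?thesis
    using exhaust_3[of j] has_integral_eq[OF e(1)[symmetric] h(1)] has_integral_eq[OF e(2)[symmetric] h(2)]
      has_integral_eq[OF e(3)[symmetric] h(3)] by auto
qed

lemma has_integral_norm_le:
  fixes f :: "real \<Rightarrow> 'a::real_normed_vector"
  assumes "(f has_integral i) {a..b}" "a \<le> b" "\<And>x. x \<in> {a..b} \<Longrightarrow> norm (f x) \<le> B"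
  shows "norm i \<le> B * (b - a)"
proof -
  have "0 \<le> B" using assms(2) order_trans[OF norm_ge_zero assms(3)[of a]] by simp
  from has_integral_bound_real[OF this finite.emptyI assms(1)] show ?thesis
    using assms(2,3) by simp
qed

lemma solves_on_lipschitz:
  assumes "solves_on u a b R" "\<And>s. s \<in> {a..b} \<Longrightarrow> \<bar>u s\<bar> \<le> U" "a \<le> s" "s \<le> t" "t
      \<le> b"
  shows "norm (column j (R t) - column j (R s)) \<le> (1 + U) * (t - s)"
proof -
  have r: "rotation_matrix (R \<tau>)" if "\<tau> \<in> {s..t}" for \<tau>
    using that assms by (intro solves_on_rotation[OF assms(1)]) auto
  have "norm (cross3 (ang u R \<tau>) (column j (R \<tau>))) \<le> 1 + U" if t: "\<tau> \<in> {s..t}" for \<tau>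
  proof -
    have "\<bar>u \<tau>\<bar> \<le> U" using assms t by auto
    then show ?thesis
      using norm_cross3_le[of "ang u R \<tau>" "column j (R \<tau>)"] norm_ang_le[of R \<tau> u U, OF r[OF t]]
        rotation_frame_norm[OF r[OF t], of j] by simp
  qed
  then show ?thesis
    by (rule has_integral_norm_le[OF solves_on_column_has_integral[OF assms(1,3-5)] assms(4)])
qed

lemma segment_near_one:
  assumes R: "solves_on u a b R" "\<And>s. s \<in> {a..b} \<Longrightarrow> \<bar>u s\<bar> \<le> U" "a \<le> b"
  shows "norm (R b ** transpose (R a) - mat 1) \<le> 9 * (1 + U) * (b - a)"
proof -
  have r: "rotation_matrix (R a)" using R by (intro solves_on_rotation[OF R(1)]) auto
  have "R b ** transpose (R a) - mat 1 = (R b - R a) ** transpose (R a)"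
    by (simp add: matrix_diff_ldistrib rotation_transpose_mult[OF r])
  then have "norm (R b ** transpose (R a) - mat 1) \<le> norm (R b - R a) * norm (transpose (R a))"
    by (simp add: norm_matrix_mult_le)
  also have "\<dots> \<le> (3 * ((1 + U) * (b - a))) * 3"
  proof (intro mult_mono)
    have "column j (R b - R a) = column j (R b) - column j (R a)" for j
      by (simp add: column_def vec_eq_iff)
    then show "norm (R b - R a) \<le> 3 * ((1 + U) * (b - a))"
      using norm_matrix_le_columns[of "R b - R a"] solves_on_lipschitz[OF R(1,2) order_refl R(3) order_refl]
      by (smt (verit))
    show "norm (transpose (R a)) \<le> 3" using norm_rotation_le[OF r] by (simp add: norm_transpose)
    show "0 \<le> 3 * ((1 + U) * (b - a))" using R(2)[of a] R(3) by auto
  qed simp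
  finally show ?thesis by (simp add: algebra_simps)
qed

text \<open>Freezing each column at its initial value changes the integrand only by a Lipschitz
  error, so the displacement differs from the integrated angular velocity in second order.\<close>

lemma segment_vee:
  assumes R: "solves_on u a b R" "\<And>s. s \<in> {a..b} \<Longrightarrow> \<bar>u s\<bar> \<le> U" "a \<le> b"
    and int: "ang u R integrable_on {a..b}"
  shows "norm (vee (R b ** transpose (R a)) - integral {a..b} (ang u R)) \<le> 2 * ((1 + U) * (b - a))\<^sup>2"
proof -
  define w where "w = integral {a..b} (ang u R)"
  define c where "c = (\<lambda>j. column j (R a))"
  have r: "rotation_matrix (R \<tau>)" if "\<tau> \<in> {a..b}" for \<tau>
    using that R by (intro solves_on_rotation[OF R(1)]) auto
  have ra: "rotation_matrix (R a)" using r R(3) by auto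
  have U: "0 \<le> U" using R(2)[of a] R(3) by force
  define e where "e = (\<lambda>j. column j (R b) - c j - cross3 w (c j))"
  have e: "norm (e j) \<le> ((1 + U) * (b - a))\<^sup>2" for j
  proof -
    have 1: "((\<lambda>\<tau>. cross3 (ang u R \<tau>) (c j)) has_integral cross3 w (c j)) {a..b}"
      using has_integral_linear[OF integrable_integral[OF int] bounded_linear_cross3_left[of "c j"]]
      by (simp add: o_def w_def)
    have "((\<lambda>\<tau>. cross3 (ang u R \<tau>) (column j (R \<tau>)) - cross3 (ang u R \<tau>) (c j)) has_integral e j)
        {a..b}"
      unfolding e_def using has_integral_diff[OF solves_on_column_has_integral[OF R(1) order_refl R(3) order_refl, of j] 1]
      by (simp add: c_def)
    then have 2: "((\<lambda>\<tau>. cross3 (ang u R \<tau>) (column j (R \<tau>) - c j)) has_integral e j) {a..b}"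
      by (simp add: Cross3.right_diff_distrib)
    have "norm (cross3 (ang u R \<tau>) (column j (R \<tau>) - c j)) \<le> (1 + U) * ((1 + U) * (b - a))" if t: "\<tau> \<in>
        {a..b}" for \<tau>
    proof -
      have "norm (column j (R \<tau>) - c j) \<le> (1 + U) * (\<tau> - a)"
        using solves_on_lipschitz[OF R(1,2) order_refl, of \<tau> j] t by (auto simp: c_def)
      also have "\<dots> \<le> (1 + U) * (b - a)" using t U by (intro mult_left_mono) auto
      finally show ?thesis
        using norm_ang_le[of R \<tau> u U, OF r[OF t]] R(2)[OF t] U
        by (intro order_trans[OF norm_cross3_le] mult_mono) auto
    qed
    then have "norm (e j) \<le> ((1 + U) * ((1 + U) * (b - a))) * (b - a)"
      by (rule has_integral_norm_le[OF 2 R(3)])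
    then show ?thesis by (simp add: power2_eq_square mult_ac)
  qed
  \<comment> \<open>Lagrange's formula turns each summand into \<open>w\<close> minus its component
    along \<open>c j\<close>; over an orthonormal frame these components add up to
    \<open>w\<close>.\<close>
  have s: "(\<Sum>j\<in>UNIV. cross3 (c j) (cross3 w (c j))) = 2 *\<^sub>R w"
  proof -
    have "cross3 (c j) (cross3 w (c j)) = w - (c j \<bullet> w) *\<^sub>R c j" for j
      using Lagrange[of "c j" w "c j"] rotation_frame_norm[OF ra, of j] by (simp add: c_def norm_eq_1)
    then have "(\<Sum>j\<in>UNIV. cross3 (c j) (cross3 w (c j))) = 3 *\<^sub>R w - (\<Sum>j\<in>UNIV. (c j \<bullet> w)
        *\<^sub>R c j)"
      by (simp add: sum_3 vec_eq_iff)
    also have "\<dots> = 3 *\<^sub>R w - w"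
      using rotation_frame_expand[OF ra, of w] by (simp add: c_def)
    also have "\<dots> = 2 *\<^sub>R w" by (simp add: vec_eq_iff)
    finally show ?thesis .
  qed
  have "vee (R b ** transpose (R a)) = (1 / 2) *\<^sub>R (\<Sum>j\<in>UNIV. cross3 (c j) (c j + cross3 w (c j) + e j))"
    unfolding vee_mult_transpose e_def by (simp add: c_def)
  also have "\<dots> = (1 / 2) *\<^sub>R ((\<Sum>j\<in>UNIV. cross3 (c j) (cross3 w (c j))) + (\<Sum>j\<in>UNIV. cross3 (c j)
      (e j)))"
    by (simp add: cross_add_right sum.distrib)
  finally have "vee (R b ** transpose (R a)) - w = (1 / 2) *\<^sub>R (\<Sum>j\<in>UNIV. cross3 (c j) (e j))"
    unfolding s by (simp add: scaleR_add_right)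
  also have "norm \<dots> \<le> (1 / 2) * (\<Sum>j\<in>(UNIV::3 set). ((1 + U) * (b - a))\<^sup>2)"
  proof -
    have "norm (cross3 (c j) (e j)) \<le> ((1 + U) * (b - a))\<^sup>2" for j
      using norm_cross3_le[of "c j" "e j"] e[of j] rotation_frame_norm[OF ra, of j] by (simp add: c_def)
    then have "norm (\<Sum>j\<in>UNIV. cross3 (c j) (e j)) \<le> (\<Sum>j\<in>(UNIV::3 set). ((1 + U) * (b - a))\<^sup>2)"
      by (intro sum_norm_le) auto
    then show ?thesis by simp
  qed
  also have "\<dots> \<le> 2 * ((1 + U) * (b - a))\<^sup>2" by simp
  finally show ?thesis by (simp add: w_def)
qed

subsection \<open>Products of matrices close to the identity\<close>

primrec mprod :: "(nat \<Rightarrow> real^3^3) \<Rightarrow> nat \<Rightarrow> real^3^3" where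
  "mprod M 0 = mat 1"
| "mprod M (Suc n) = mprod M n ** M n"

text \<open>Each factor has norm at most 3, and one more unit comes from its own deviation, hence
  base 4. The exponential constant is harmless because the number of factors is fixed before
  \<open>B\<close> becomes small.\<close>

lemma mprod_near_one:
  assumes "\<And>i. i < n \<Longrightarrow> rotation_matrix (M i)" "\<And>i. i < n \<Longrightarrow> norm (M i - mat 1) \<le>
      B" "0 \<le> B"
  shows "norm (mprod M n - mat 1) \<le> 4 ^ n * B"
  using assms(1,2)
proof (induction n)
  case (Suc n)
  have "mprod M (Suc n) - mat 1 = (mprod M n - mat 1) ** M n + (M n - mat 1)"
    by (simp add: matrix_diff_ldistrib)
  then have "norm (mprod M (Suc n) - mat 1) \<le> norm (mprod M n - mat 1) * norm (M n) + norm (M n - mat 1)"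
    unfolding \<open>mprod M (Suc n) - mat 1 = _\<close> using norm_triangle_ineq[of "(mprod M n - mat 1) ** M n" "M n - mat 1"]
      norm_matrix_mult_le[of "mprod M n - mat 1" "M n"] by simp
  also have "\<dots> \<le> (4 ^ n * B) * 3 + B"
    using Suc norm_rotation_le[of "M n"] assms(3) by (intro add_mono mult_mono) auto
  also have "\<dots> \<le> 4 ^ Suc n * B"
    using assms(3) mult_right_mono[of 1 "4 ^ n" B] by (simp add: algebra_simps)
  finally show ?case .
qed (use assms in simp)

text \<open>To first order \<open>vee\<close> turns products into sums: in
  \<open>A B = (A - 1) (B - 1) + A + (B - 1)\<close> the first summand is a product of two small
  matrices.\<close>

lemma vee_mprod:
  assumes "\<And>i. i < n \<Longrightarrow> rotation_matrix (M i)" "\<And>i. i < n \<Longrightarrow> norm (M i - mat 1) \<le>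
      B" "0 \<le> B"
  shows "norm (vee (mprod M n) - (\<Sum>i<n. vee (M i))) \<le> real n * (3 * 4 ^ n * B\<^sup>2)"
  using assms(1,2)
proof (induction n)
  case (Suc n)
  define E where "E = vee ((mprod M n - mat 1) ** (M n - mat 1))"
  have "mprod M (Suc n) = (mprod M n - mat 1) ** (M n - mat 1) + mprod M n + (M n - mat 1)"
    by (simp add: matrix_diff_ldistrib matrix_diff_rdistrib)
  then have "vee (mprod M (Suc n)) = E + vee (mprod M n) + vee (M n)"
    unfolding E_def by (simp only: vee_add vee_diff vee_one) simp
  then have "norm (vee (mprod M (Suc n)) - (\<Sum>i<Suc n. vee (M i))) =
      norm (E + (vee (mprod M n) - (\<Sum>i<n. vee (M i))))"
    by (simp add: algebra_simps)
  also have "\<dots> \<le> norm E + real n * (3 * 4 ^ n * B\<^sup>2)"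
    using norm_triangle_ineq[of E "vee (mprod M n) - (\<Sum>i<n. vee (M i))"] Suc by simp
  also have "norm E \<le> 3 * ((4 ^ n * B) * B)"
  proof -
    have "norm E \<le> 3 * (norm (mprod M n - mat 1) * norm (M n - mat 1))"
      unfolding E_def using norm_vee_le[of "(mprod M n - mat 1) ** (M n - mat 1)"]
        norm_matrix_mult_le[of "mprod M n - mat 1" "M n - mat 1"] by simp
    also have "\<dots> \<le> 3 * ((4 ^ n * B) * B)"
      using Suc.prems assms(3) by (intro mult_left_mono mult_mono mprod_near_one) auto
    finally show ?thesis .
  qed
  also have "3 * ((4 ^ n * B) * B) + real n * (3 * 4 ^ n * B\<^sup>2) = real (Suc n) * (3 * 4 ^ n * B\<^sup>2)"
    by (simp add: algebra_simps power2_eq_square)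
  also have "\<dots> \<le> real (Suc n) * (3 * 4 ^ Suc n * B\<^sup>2)"
    by (intro mult_left_mono mult_right_mono) auto
  finally show ?case by simp
qed (simp add: vee_one)

lemma rotation_matrix_mprod:
  "(\<And>i. i < n \<Longrightarrow> rotation_matrix (M i)) \<Longrightarrow> rotation_matrix (mprod M n)"
  by (induction n) (auto intro: rotation_matrix_mult rotation_matrix_one)

lemma bounded_bilinear_matrix_mult: "bounded_bilinear ((**) :: real^3^3 \<Rightarrow> real^3^3 \<Rightarrow> real^3^3)"
proof
  show "\<exists>K. \<forall>(a :: real^3^3) (b :: real^3^3). norm (a ** b) \<le> norm a * norm b * K"
    by (intro exI[of _ 1]) (simp add: norm_matrix_mult_le)
qed (simp_all add: vec_eq_iff matrix_matrix_mult_def sum.distrib sum_distrib_left algebra_simps)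

lemmas continuous_on_matrix_mult = bounded_bilinear.continuous_on[OF bounded_bilinear_matrix_mult]

lemma continuous_on_mprod:
  assumes "\<And>i. i < n \<Longrightarrow> continuous_on S (\<lambda>x. M x i)"
  shows "continuous_on S (\<lambda>x. mprod (M x) n)"
  using assms by (induction n) (auto intro!: continuous_on_matrix_mult continuous_on_const)

lemma continuous_on_turn:
  fixes f :: "'a::t2_space \<Rightarrow> real"
  assumes "continuous_on S f"
  shows "continuous_on S (\<lambda>x. turn v (f x))"
proof (rule continuous_on_column_matrix)
  fix j :: 3
  define m where "m = sqrt (1 + v\<^sup>2)"
  have m: "m \<noteq> 0" using add_pos_nonneg[of 1 "v\<^sup>2"] by (auto simp: m_def)
  have v: "vector [x, y, z] = x *\<^sub>R position (mat 1) + y *\<^sub>R heading (mat 1) + z *\<^sub>R normal_vec (mat 1)"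
    for x y z :: real
    using matrix_vector_mult_columns[of "mat 1" x y z] by simp
  have trig: "continuous_on S (\<lambda>x. cos (m * f x))" "continuous_on S (\<lambda>x. sin (m * f x))"
    by (intro continuous_on_cos continuous_on_sin continuous_on_mult continuous_on_const assms)+
  consider "j = 1" | "j = 2" | "j = 3" using exhaust_3[of j] by blast
  then show "continuous_on S (\<lambda>x. column j (turn v (f x)))"
  proof cases
    case 1
    show ?thesis
      unfolding 1 turn_columns[of v, folded m_def] v
      by (intro continuous_intros trig) (use m in auto)
  next
    case 2
    show ?thesis
      unfolding 2 turn_columns[of v, folded m_def] v
      by (intro continuous_intros trig) (use m in auto)
  next
    case 3
    show ?thesis
      unfolding 3 turn_columns[of v, folded m_def] v
      by (intro continuous_intros trig) (use m in auto)
  qed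
qed

subsection \<open>Perturbing a path\<close>

text \<open>Zero mean guarantees a vector in each row whose inner product with the current partial
  sum is nonpositive. Then squared norms at most add, and the sum grows like \<open>sqrt n\<close>
  instead of \<open>n\<close>.\<close>

lemma greedy_choice:
  fixes x :: "nat \<Rightarrow> nat \<Rightarrow> 'a::real_inner"
  assumes "m > 0" "\<And>i. i < n \<Longrightarrow> (\<Sum>j<m. x i j) = 0" "\<And>i j. i < n \<Longrightarrow> j < m
      \<Longrightarrow> norm (x i j) \<le> B"
  shows "\<exists>J. (\<forall>i<n. J i < m) \<and> (norm (\<Sum>i<n. x i (J i)))\<^sup>2 \<le> real n * B\<^sup>2"
  using assms(2,3)
proof (induction n)
  case (Suc n)
  then obtain J where J: "\<forall>i<n. J i < m" "(norm (\<Sum>i<n. x i (J i)))\<^sup>2 \<le> real n * B\<^sup>2"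
    by (meson less_Suc_eq)
  define S where "S = (\<Sum>i<n. x i (J i))"
  have "\<exists>k<m. S \<bullet> x n k \<le> 0"
  proof (rule ccontr)
    assume "\<not> ?thesis"
    then have "(\<Sum>k<m. S \<bullet> x n k) > 0" using assms(1) by (intro sum_pos) (auto simp: not_le)
    then show False using Suc.prems(1)[of n] by (simp flip: inner_sum_right)
  qed
  then obtain k where k: "k < m" "S \<bullet> x n k \<le> 0" by blast
  define J' where "J' = J(n := k)"
  have "(\<Sum>i<n. x i (J' i)) = S"
    unfolding S_def J'_def by (intro sum.cong) auto
  then have "(\<Sum>i<Suc n. x i (J' i)) = S + x n k"
    by (simp add: J'_def)
  then have "(norm (\<Sum>i<Suc n. x i (J' i)))\<^sup>2 = (norm S)\<^sup>2 + 2 * (S \<bullet> x n k) + (norm (x n k))\<^sup>2"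
    by (simp add: power2_norm_eq_inner inner_add_left inner_add_right inner_commute)
  also have "\<dots> \<le> real n * B\<^sup>2 + B\<^sup>2"
    using J(2) k Suc.prems(2)[of n k] power_mono[of "norm (x n k)" B 2] by (simp add: S_def)
  finally have "(norm (\<Sum>i<Suc n. x i (J' i)))\<^sup>2 \<le> real (Suc n) * B\<^sup>2"
    by (simp add: algebra_simps)
  moreover have "\<forall>i<Suc n. J' i < m" using J(1) k(1) by (auto simp: J'_def less_Suc_eq)
  ultimately show ?case by blast
qed auto

text \<open>The convex hull of \<open>0\<close> and the \<open>z j\<close>. The coefficients become
  lengths of inserted arcs per unit of deleted length; \<open>sum k J \<le> 1\<close> says that
  nothing is lost, and the generator \<open>0\<close> later gives
  \<open>\<mu> \<ge> 0\<close>.\<close>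

definition pointed_hull :: "'i set \<Rightarrow> ('i \<Rightarrow> 'a::real_vector) \<Rightarrow> 'a set" where
  "pointed_hull J z = {\<Sum>j\<in>J. k j *\<^sub>R z j | k. (\<forall>j\<in>J. 0 \<le> k j) \<and> sum k J \<le> 1}"

lemma convex_pointed_hull: "convex (pointed_hull J z)"
proof (rule convexI)
  fix x y and a b :: real
  assume ab: "0 \<le> a" "0 \<le> b" "a + b = 1" and x: "x \<in> pointed_hull J z" and y: "y \<in> pointed_hull J z"
  obtain k where k: "x = (\<Sum>j\<in>J. k j *\<^sub>R z j)" "\<forall>j\<in>J. 0 \<le> k j" "sum k J \<le> 1"
    using x by (auto simp: pointed_hull_def)
  obtain l where l: "y = (\<Sum>j\<in>J. l j *\<^sub>R z j)" "\<forall>j\<in>J. 0 \<le> l j" "sum l J \<le> 1"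
    using y by (auto simp: pointed_hull_def)
  have "a *\<^sub>R x + b *\<^sub>R y = (\<Sum>j\<in>J. (a * k j + b * l j) *\<^sub>R z j)"
    by (simp add: k l scaleR_sum_right sum.distrib scaleR_left_distrib)
  moreover have "(\<Sum>j\<in>J. a * k j + b * l j) \<le> a * 1 + b * 1"
    using ab k(3) l(3) by (simp only: sum.distrib sum_distrib_left[symmetric]) (intro add_mono mult_left_mono)
  ultimately show "a *\<^sub>R x + b *\<^sub>R y \<in> pointed_hull J z"
    unfolding pointed_hull_def using ab k(2) l(2)
    by (intro CollectI exI[of _ "\<lambda>j. a * k j + b * l j"]) auto
qed

lemma pointed_hull_zero: "0 \<in> pointed_hull J z"
  unfolding pointed_hull_def by (intro CollectI exI[of _ "\<lambda>_. 0"]) auto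

lemma pointed_hull_generator:
  assumes "finite J" "j \<in> J"
  shows "z j \<in> pointed_hull J z"
proof -
  have "(\<Sum>i\<in>J. (if i = j then 1 else 0) *\<^sub>R z i) = (\<Sum>i\<in>J. if i = j then z i else 0)"
    by (intro sum.cong) auto
  also have "\<dots> = z j" using assms by (simp add: sum.delta)
  finally have "z j = (\<Sum>i\<in>J. (if i = j then 1 else 0) *\<^sub>R z i)" ..
  then show ?thesis
    unfolding pointed_hull_def using assms
    by (intro CollectI exI[of _ "\<lambda>i. if i = j then 1 else 0"]) (simp add: sum.delta)
qed

text \<open>The coefficients are interpolated between those of the centre \<open>w\<close> and of the vertices \<open>w \<plusminus> \<beta>
  b\<close> of an octahedron around it.\<close>

lemma pointed_hull_selection:
  fixes z :: "'i \<Rightarrow> 'a::euclidean_space"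
  assumes "finite J" "\<rho> > 0" and ball: "cball w \<rho> \<subseteq> pointed_hull J z"
  obtains \<theta> k where "\<theta> < 1" "\<And>j. continuous_on UNIV (\<lambda>y. k y j)"
    "\<And>y. norm y \<le> \<rho> / (2 * DIM('a)) \<Longrightarrow>
       (\<forall>j\<in>J. 0 \<le> k y j) \<and> sum (k y) J \<le> \<theta> \<and> (\<Sum>j\<in>J. k y j *\<^sub>R z j) = w + y"
proof -
  define \<beta> where "\<beta> = \<rho> / 2"
  \<comment> \<open>The solution of
    \<open>\<beta> + (1 - \<theta>) * norm w = \<theta> * \<rho>\<close>. Then \<open>w + y\<close>
    divided by \<open>\<theta>\<close> still lies in the ball, and scaling its coefficients by
    \<open>\<theta> < 1\<close> leaves a strict saving.\<close>
  define \<theta> where "\<theta> = (norm w + \<beta>) / (norm w + \<rho>)"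
  have pos: "norm w + \<rho> > 0" using assms(2) by (simp add: add_nonneg_pos)
  have \<theta>: "0 < \<theta>" "\<theta> < 1"
    using assms(2) pos by (auto simp: \<theta>_def \<beta>_def add_nonneg_pos)
  have "\<exists>k. (\<forall>j\<in>J. 0 \<le> k j) \<and> sum k J \<le> \<theta> \<and> (\<Sum>j\<in>J. k j *\<^sub>R z j) =
      w + y" if y: "norm y \<le> \<beta>" for y
  proof -
    have "norm ((1 / \<theta>) *\<^sub>R (w + y) - w) \<le> \<rho>"
    proof -
      have "(1 / \<theta>) *\<^sub>R (w + y) - w = (1 / \<theta>) *\<^sub>R (y + (1 - \<theta>) *\<^sub>R w)"
        using \<theta> by (simp add: algebra_simps)
      then have "norm ((1 / \<theta>) *\<^sub>R (w + y) - w) = (1 / \<theta>) * norm (y + (1 - \<theta>) *\<^sub>R w)"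
        using \<theta> by simp
      also have "\<dots> \<le> (1 / \<theta>) * (\<beta> + (1 - \<theta>) * norm w)"
        using \<theta> y norm_triangle_ineq[of y "(1 - \<theta>) *\<^sub>R w"] by (intro mult_left_mono) auto
      also have "\<beta> + (1 - \<theta>) * norm w = \<theta> * \<rho>"
        using pos by (simp add: \<theta>_def field_simps)
      finally show ?thesis using \<theta> by simp
    qed
    then have "(1 / \<theta>) *\<^sub>R (w + y) \<in> pointed_hull J z"
      using ball by (auto simp: dist_norm norm_minus_commute)
    then obtain k where k: "(1 / \<theta>) *\<^sub>R (w + y) = (\<Sum>j\<in>J. k j *\<^sub>R z j)" "\<forall>j\<in>J. 0 \<le>
        k j" "sum k J \<le> 1"
      by (auto simp: pointed_hull_def)
    have "w + y = \<theta> *\<^sub>R ((1 / \<theta>) *\<^sub>R (w + y))" using \<theta> by simp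
    also have "\<dots> = (\<Sum>j\<in>J. (\<theta> * k j) *\<^sub>R z j)" unfolding k(1) by (simp add: scaleR_sum_right)
    finally show ?thesis
      using k(2,3) \<theta> by (intro exI[of _ "\<lambda>j. \<theta> * k j"]) (auto simp: sum_distrib_left[symmetric])
  qed
  then obtain c where c: "\<And>y. norm y \<le> \<beta> \<Longrightarrow> (\<forall>j\<in>J. 0 \<le> c y j) \<and> sum (c y)
      J \<le> \<theta> \<and> (\<Sum>j\<in>J. c y j *\<^sub>R z j) = w + y"
    by metis
  have \<beta>: "\<beta> > 0" using assms(2) by (simp add: \<beta>_def)
  \<comment> \<open>The chosen coefficients \<open>c\<close> need not be continuous, so they are
    used only at finitely many points, with weights continuous in \<open>y\<close>. The weights are
    nonnegative when the l1 norm of \<open>y\<close> is at most \<open>\<beta>\<close>, which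
    explains the radius \<open>\<rho> / (2 * DIM('a))\<close>.\<close>
  define k where "k = (\<lambda>y j. (1 - (\<Sum>b\<in>Basis. \<bar>y \<bullet> b\<bar>) / \<beta>) * c 0 j +
    (\<Sum>b\<in>Basis. max 0 (y \<bullet> b) / \<beta> * c (\<beta> *\<^sub>R b) j + max 0 (- (y \<bullet> b)) / \<beta> * c
        (- \<beta> *\<^sub>R b) j))"
  have lin: "(\<Sum>j\<in>J. k y j *\<^sub>R f j) = (1 - (\<Sum>b\<in>Basis. \<bar>y \<bullet> b\<bar>) / \<beta>) *\<^sub>R
      (\<Sum>j\<in>J. c 0 j *\<^sub>R f j) +
     (\<Sum>b\<in>Basis. (max 0 (y \<bullet> b) / \<beta>) *\<^sub>R (\<Sum>j\<in>J. c (\<beta> *\<^sub>R b) j *\<^sub>R f j)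
        + (max 0 (- (y \<bullet> b)) / \<beta>) *\<^sub>R (\<Sum>j\<in>J. c (- \<beta> *\<^sub>R b) j *\<^sub>R f j))"
    for y and f :: "'i \<Rightarrow> 'b::real_vector"
    unfolding k_def scaleR_left_distrib sum.distrib scaleR_sum_left scaleR_sum_right scaleR_scaleR[symmetric]
    by (simp add: sum.swap[of _ Basis J])
  show thesis
  proof (rule that[OF \<theta>(2)])
    show "continuous_on UNIV (\<lambda>y. k y j)" for j
      unfolding k_def by (intro continuous_intros) (use \<beta> in auto)
    fix y :: 'a assume y: "norm y \<le> \<rho> / (2 * DIM('a))"
    define s where "s = (\<Sum>b\<in>Basis. \<bar>y \<bullet> b\<bar>)"
    have "s \<le> (\<Sum>b\<in>(Basis::'a set). norm y)"
      unfolding s_def by (intro sum_mono Basis_le_norm)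
    also have "\<dots> = real DIM('a) * norm y" by simp
    also have "\<dots> \<le> real DIM('a) * (\<rho> / (2 * DIM('a)))" by (intro mult_left_mono y) auto
    also have "\<dots> = \<beta>" by (simp add: \<beta>_def)
    finally have s: "0 \<le> 1 - s / \<beta>" using \<beta> by simp
    have split: "\<bar>t\<bar> = max 0 t + max 0 (- t)" "t = max 0 t - max 0 (- t)" for t :: real by auto
    have c0: "(\<forall>j\<in>J. 0 \<le> c 0 j) \<and> sum (c 0) J \<le> \<theta> \<and> (\<Sum>j\<in>J. c 0 j *\<^sub>R z j) = w"
      using c[of 0] \<beta> by auto
    have cp: "(\<forall>j\<in>J. 0 \<le> c (\<beta> *\<^sub>R b) j) \<and> sum (c (\<beta> *\<^sub>R b)) J \<le> \<theta>
        \<and> (\<Sum>j\<in>J. c (\<beta> *\<^sub>R b) j *\<^sub>R z j) = w + \<beta> *\<^sub>R b"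
      and cm: "(\<forall>j\<in>J. 0 \<le> c (- \<beta> *\<^sub>R b) j) \<and> sum (c (- \<beta> *\<^sub>R b)) J \<le>
          \<theta> \<and> (\<Sum>j\<in>J. c (- \<beta> *\<^sub>R b) j *\<^sub>R z j) = w + - \<beta> *\<^sub>R b"
      if "b \<in> Basis" for b
      using c[of "\<beta> *\<^sub>R b"] c[of "- \<beta> *\<^sub>R b"] \<beta> that by auto
    have "\<forall>j\<in>J. 0 \<le> k y j"
    proof
      fix j assume "j \<in> J"
      then show "0 \<le> k y j"
        unfolding k_def s_def[symmetric] using s c0 cp cm \<beta>
        by (intro add_nonneg_nonneg mult_nonneg_nonneg sum_nonneg) auto
    qed
    moreover have "sum (k y) J \<le> \<theta>"
    proof -
      have "sum (k y) J = (1 - s / \<beta>) * sum (c 0) J +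
        (\<Sum>b\<in>Basis. max 0 (y \<bullet> b) / \<beta> * sum (c (\<beta> *\<^sub>R b)) J + max 0 (- (y \<bullet> b)) /
            \<beta> * sum (c (- \<beta> *\<^sub>R b)) J)"
        using lin[of y "\<lambda>_. 1::real"] by (simp add: s_def)
      also have "\<dots> \<le> (1 - s / \<beta>) * \<theta> + (\<Sum>b\<in>Basis. max 0 (y \<bullet> b) / \<beta> * \<theta>
          + max 0 (- (y \<bullet> b)) / \<beta> * \<theta>)"
        using s c0 cp cm \<beta> by (intro add_mono sum_mono mult_left_mono) auto
      also have "(\<Sum>b\<in>Basis. max 0 (y \<bullet> b) / \<beta> * \<theta> + max 0 (- (y \<bullet> b)) / \<beta> *
          \<theta>) = s / \<beta> * \<theta>"
        unfolding s_def sum_divide_distrib sum_distrib_right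
        by (intro sum.cong refl) (simp only: split(1) add_divide_distrib distrib_right)
      finally show ?thesis by (simp add: algebra_simps)
    qed
    moreover have "(\<Sum>j\<in>J. k y j *\<^sub>R z j) = w + y"
    proof -
      have "(\<Sum>j\<in>J. k y j *\<^sub>R z j) = (1 - s / \<beta>) *\<^sub>R w +
        (\<Sum>b\<in>Basis. (max 0 (y \<bullet> b) / \<beta>) *\<^sub>R (w + \<beta> *\<^sub>R b) + (max 0 (- (y \<bullet>
            b)) / \<beta>) *\<^sub>R (w + - \<beta> *\<^sub>R b))"
        unfolding lin s_def[symmetric] using c0 cp cm by simp
      also have "(\<Sum>b\<in>Basis. (max 0 (y \<bullet> b) / \<beta>) *\<^sub>R (w + \<beta> *\<^sub>R b) + (max 0 (- (y
          \<bullet> b)) / \<beta>) *\<^sub>R (w + - \<beta> *\<^sub>R b))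
        = (\<Sum>b\<in>Basis. (\<bar>y \<bullet> b\<bar> / \<beta>) *\<^sub>R w + (y \<bullet> b) *\<^sub>R b)"
      proof (rule sum.cong[OF refl])
        fix b
        have "(max 0 t / \<beta>) *\<^sub>R (w + \<beta> *\<^sub>R b) + (max 0 (- t) / \<beta>) *\<^sub>R (w + - \<beta>
            *\<^sub>R b)
          = ((max 0 t + max 0 (- t)) / \<beta>) *\<^sub>R w + (max 0 t - max 0 (- t)) *\<^sub>R b" for t
          using \<beta> by (simp add: algebra_simps add_divide_distrib)
        then show "(max 0 (y \<bullet> b) / \<beta>) *\<^sub>R (w + \<beta> *\<^sub>R b) + (max 0 (- (y \<bullet> b)) /
            \<beta>) *\<^sub>R (w + - \<beta> *\<^sub>R b)
           = (\<bar>y \<bullet> b\<bar> / \<beta>) *\<^sub>R w + (y \<bullet> b) *\<^sub>R b"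
          by (simp only: split[symmetric])
      qed
      also have "\<dots> = (s / \<beta>) *\<^sub>R w + y"
        by (simp add: sum.distrib s_def sum_divide_distrib euclidean_representation flip: scaleR_sum_left)
      finally show ?thesis by (simp add: algebra_simps)
    qed
    ultimately show "(\<forall>j\<in>J. 0 \<le> k y j) \<and> sum (k y) J \<le> \<theta> \<and> (\<Sum>j\<in>J. k y j
        *\<^sub>R z j) = w + y"
      by blast
  qed
qed

lemma brouwer_zero:
  fixes F :: "'a::euclidean_space \<Rightarrow> 'a"
  assumes "0 \<le> c" "continuous_on (cball 0 c) F" "\<And>y. y \<in> cball 0 c \<Longrightarrow> norm (y - F y) \<le> c"
  obtains y where "y \<in> cball 0 c" "F y = 0"
proof -
  have "continuous_on (cball 0 c) (\<lambda>y. y - F y)" by (intro continuous_intros assms)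
  then obtain y where "y \<in> cball 0 c" "y - F y = y"
    using brouwer[of "cball 0 c" "\<lambda>y. y - F y"] assms by (auto simp: Pi_iff)
  then show thesis by (auto intro: that)
qed

section \<open>First order effect of inserting an arc and of deleting a piece\<close>

lemma ang_turn:
  assumes "rotation_matrix M"
  shows "ang (\<lambda>_. v) (\<lambda>s. M ** turn v (s - a)) t = normal_vec M + v *\<^sub>R position M"
proof -
  have "normal_vec (turn v (t - a)) + v *\<^sub>R position (turn v (t - a)) = vector [v, 0, 1]"
    unfolding turn_columns by (simp add: vec_eq_iff forall_3 power2_eq_square algebra_simps)
  then have "M *v (normal_vec (turn v (t - a)) + v *\<^sub>R position (turn v (t - a))) = M *v vector [v, 0, 1]"
    by simp
  then show ?thesis
    unfolding ang_def column_matrix_mult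
    by (simp add: matrix_vector_mult_columns matrix_vector_right_distrib matrix_vector_mult_scaleR add.commute)
qed

lemma insertion_near_one:
  assumes "rotation_matrix M" "\<bar>v\<bar> \<le> U" "0 \<le> a"
  shows "norm (M ** turn v a ** transpose M - mat 1) \<le> 9 * (1 + U) * a"
    and "norm (vee (M ** turn v a ** transpose M) - a *\<^sub>R (normal_vec M + v *\<^sub>R position M)) \<le> 2 * ((1 + U) *
        a)\<^sup>2"
proof -
  note s = solves_on_turn[OF assms(1), of v 0 a]
  have a: "ang (\<lambda>_. v) (\<lambda>s. M ** turn v (s - 0)) = (\<lambda>_. normal_vec M + v *\<^sub>R position M)"
    using ang_turn[OF assms(1), of v 0] by (intro ext) simp
  have i: "ang (\<lambda>_. v) (\<lambda>s. M ** turn v (s - 0)) integrable_on {0..a}"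
    unfolding a by (rule integrable_const_ivl)
  show "norm (M ** turn v a ** transpose M - mat 1) \<le> 9 * (1 + U) * a"
    and "norm (vee (M ** turn v a ** transpose M) - a *\<^sub>R (normal_vec M + v *\<^sub>R position M)) \<le> 2 * ((1 + U) *
        a)\<^sup>2"
    using segment_near_one[OF s assms(2,3)] segment_vee[OF s assms(2,3) i] assms(3) unfolding a
    by (simp_all add: turn_0)
qed

lemma deletion_near_one:
  assumes R: "solves_on u a b R" "\<And>s. s \<in> {a..b} \<Longrightarrow> \<bar>u s\<bar> \<le> U" "a \<le> b"
    and int: "ang u R integrable_on {a..b}"
  shows "norm (R a ** transpose (R b) - mat 1) \<le> 9 * (1 + U) * (b - a)"
    and "norm (vee (R a ** transpose (R b)) + integral {a..b} (ang u R)) \<le> 2 * ((1 + U) * (b - a))\<^sup>2"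
proof -
  have t: "R a ** transpose (R b) = transpose (R b ** transpose (R a))"
    by (simp add: matrix_transpose_mul)
  have "R a ** transpose (R b) - mat 1 = transpose (R b ** transpose (R a) - mat 1)"
    unfolding t by (simp add: transpose_def vec_eq_iff mat_def)
  then show "norm (R a ** transpose (R b) - mat 1) \<le> 9 * (1 + U) * (b - a)"
    using segment_near_one[OF R] by (simp add: norm_transpose)
  have "vee (R a ** transpose (R b)) + integral {a..b} (ang u R) = - (vee (R b ** transpose (R a)) - integral {a..b} (ang u R))"
    unfolding t vee_transpose by simp
  then show "norm (vee (R a ** transpose (R b)) + integral {a..b} (ang u R)) \<le> 2 * ((1 + U) * (b - a))\<^sup>2"
    using segment_vee[OF R int] by (metis norm_minus_cancel)
qed

text \<open>The effect of one slot of the perturbed path: two inserted arcs and one deleted piece.\<close>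

lemma slot_expansion:
  assumes R: "solves_on u 0 L R" "\<And>s. s \<in> {0..L} \<Longrightarrow> \<bar>u s\<bar> \<le> U" "ang u R integrable_on {0..L}"
    and M: "rotation_matrix M" and U: "0 \<le> U"
    and s: "0 \<le> s" "0 \<le> e" "s + e \<le> L" and p: "0 \<le> p" "0 \<le> q" and d: "p \<le> d" "q \<le> d" "e \<le> d"
    and D: "D = (M ** turn U p ** transpose M) ** (M ** turn (- U) q ** transpose M) ** (R s ** transpose (R (s + e)))"
  shows "rotation_matrix D" and "norm (D - mat 1) \<le> 576 * (1 + U) * d"
    and "norm (vee D - (p *\<^sub>R (normal_vec M + U *\<^sub>R position M) + q *\<^sub>R (normal_vec M + (- U) *\<^sub>R
        position M)
      - integral {s..s + e} (ang u R))) \<le> 50000 * ((1 + U) * d)\<^sup>2"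
proof -
  \<comment> \<open>Inserting an arc at the configuration \<open>M\<close> multiplies everything
    after it from the left by this conjugate. Deleting a piece has the same form, with the factor
    \<open>E\<close>.\<close>
  define A where "A = M ** turn U p ** transpose M"
  define B where "B = M ** turn (- U) q ** transpose M"
  define E where "E = R s ** transpose (R (s + e))"
  define F where "F = (\<lambda>i::nat. if i = 0 then A else if i = 1 then B else E)"
  have r: "rotation_matrix (R s)" "rotation_matrix (R (s + e))"
    using s by (auto intro!: solves_on_rotation[OF R(1)])
  have rot: "rotation_matrix (F i)" for i
    by (auto simp: F_def A_def B_def E_def intro!: rotation_matrix_mult rotation_matrix_transpose rotation_matrix_turn M r)
  have sub: "solves_on u s (s + e) R" by (rule solves_on_subset[OF R(1)]) (use s in auto)
  have int: "ang u R integrable_on {s..s + e}"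
    using R(3) s by (auto elim!: integrable_on_subinterval)
  have bd: "9 * (1 + U) * x \<le> 9 * (1 + U) * d" if "x \<le> d" for x
    using that U by (intro mult_left_mono) auto
  have bd2: "2 * ((1 + U) * x)\<^sup>2 \<le> 2 * ((1 + U) * d)\<^sup>2" if "0 \<le> x" "x \<le> d" for x
    using that U by (intro mult_left_mono power_mono) auto
  have "\<bar>U\<bar> \<le> U" "\<bar>- U\<bar> \<le> U" using U by auto
  note iA = insertion_near_one[OF M this(1) p(1), folded A_def]
    and iB = insertion_near_one[OF M this(2) p(2), folded B_def]
  have iE: "norm (E - mat 1) \<le> 9 * (1 + U) * e"
    "norm (vee E + integral {s..s + e} (ang u R)) \<le> 2 * ((1 + U) * e)\<^sup>2"
    using deletion_near_one[OF sub _ _ int, of U] R(2) s by (auto simp: E_def)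
  have near: "norm (F i - mat 1) \<le> 9 * (1 + U) * d" for i
    unfolding F_def using iA(1) iB(1) iE(1) bd[OF d(1)] bd[OF d(2)] bd[OF d(3)] by auto
  have n0: "0 \<le> 9 * (1 + U) * d" using U s d by auto
  have Dm: "D = mprod F 3"
    by (simp add: D eval_nat_numeral F_def A_def B_def E_def)
  show "rotation_matrix D" unfolding Dm by (intro rotation_matrix_mprod rot)
  have "norm (D - mat 1) \<le> 4 ^ 3 * (9 * (1 + U) * d)"
    unfolding Dm by (intro mprod_near_one rot near n0)
  then show "norm (D - mat 1) \<le> 576 * (1 + U) * d" by (simp add: algebra_simps)
  have "norm (vee D - (\<Sum>i<3. vee (F i))) \<le> real 3 * (3 * 4 ^ 3 * (9 * (1 + U) * d)\<^sup>2)"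
    unfolding Dm by (intro vee_mprod rot near n0)
  also have "\<dots> = 46656 * ((1 + U) * d)\<^sup>2" by (simp only: mult.assoc power_mult_distrib[of 9]) simp
  also have "(\<Sum>i<3. vee (F i)) = vee A + vee B + vee E"
    by (simp add: eval_nat_numeral F_def)
  finally have 1: "norm (vee D - (vee A + vee B + vee E)) \<le> 46656 * ((1 + U) * d)\<^sup>2" .
  define a where "a = p *\<^sub>R (normal_vec M + U *\<^sub>R position M)"
  define b where "b = q *\<^sub>R (normal_vec M + (- U) *\<^sub>R position M)"
  define w where "w = integral {s..s + e} (ang u R)"
  define x where "x = vee D - (vee A + vee B + vee E)"
  have e: "vee D - (a + b - w) = x + (vee A - a) + (vee B - b) + (vee E + w)"
    by (simp add: x_def)
  have "norm (vee D - (a + b - w)) \<le> norm x + norm (vee A - a) + norm (vee B - b) + norm (vee E + w)"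
    unfolding e using norm_triangle_ineq[of "x + (vee A - a) + (vee B - b)" "vee E + w"]
      norm_triangle_ineq[of "x + (vee A - a)" "vee B - b"] norm_triangle_ineq[of x "vee A - a"] by linarith
  also have "\<dots> \<le> 46656 * ((1 + U) * d)\<^sup>2 + 2 * ((1 + U) * d)\<^sup>2 + 2 * ((1 + U) * d)\<^sup>2 + 2 * ((1 +
      U) * d)\<^sup>2"
  proof (intro add_mono)
    show "norm x \<le> 46656 * ((1 + U) * d)\<^sup>2" using 1 by (simp add: x_def)
    show "norm (vee A - a) \<le> 2 * ((1 + U) * d)\<^sup>2"
      using order_trans[OF iA(2) bd2[OF p(1) d(1)]] by (simp only: a_def)
    show "norm (vee B - b) \<le> 2 * ((1 + U) * d)\<^sup>2"
      using order_trans[OF iB(2) bd2[OF p(2) d(2)]] by (simp only: b_def)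
    show "norm (vee E + w) \<le> 2 * ((1 + U) * d)\<^sup>2"
      using order_trans[OF iE(2) bd2[OF s(2) d(3)]] by (simp only: w_def)
  qed
  \<comment> \<open>The large term is \<open>3 * (3 * 4 ^ 3) * 9 ^ 2 = 46656\<close>, from the
    product of three factors; the sum is rounded up.\<close>
  also have "\<dots> \<le> 50000 * ((1 + U) * d)\<^sup>2" by simp
  finally show "norm (vee D - (p *\<^sub>R (normal_vec M + U *\<^sub>R position M) + q *\<^sub>R (normal_vec M + (- U)
      *\<^sub>R position M)
      - integral {s..s + e} (ang u R))) \<le> 50000 * ((1 + U) * d)\<^sup>2"
    by (simp add: a_def b_def w_def)
qed

lemma integral_sum_pieces:
  fixes f :: "real \<Rightarrow> 'a::banach"
  assumes "f integrable_on {a..a + real m * e}" "0 \<le> e"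
  shows "(\<Sum>j<m. integral {a + real j * e..a + real j * e + e} f) = integral {a..a + real m * e} f"
  using assms(1)
proof (induction m)
  case (Suc m)
  have e: "a + real (Suc m) * e = a + real m * e + e" by (simp add: algebra_simps)
  have le: "a \<le> a + real m * e" "a + real m * e \<le> a + real (Suc m) * e"
    using assms(2) by (auto simp: algebra_simps)
  then have "f integrable_on {a..a + real m * e}"
    using integrable_on_subinterval[OF Suc.prems] by auto
  then show ?case
    using Suc.IH Henstock_Kurzweil_Integration.integral_combine[OF le Suc.prems]
    by (simp add: e del: of_nat_Suc)
qed simp

lemma reach_one: "0 \<le> U \<Longrightarrow> reach U (mat 1) 0"
  using reach_turn[of 0 U 0] by (simp add: turn_0)

text \<open>If the average angular velocity were well inside this hull, then deleting pieces of the path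
  of total length \<open>\<delta>\<close> and inserting arcs of total length at most \<open>\<theta> * \<delta>\<close> would reach the same
  endpoint. The deleted pieces are chosen greedily, so that they represent the average.\<close>

lemma average_not_interior:
  fixes n :: nat
  assumes R: "solves_on u 0 L R" "u \<in> borel_measurable (lebesgue_on {0..L})" "\<And>s. s \<in> {0..L} \<Longrightarrow>
      \<bar>u s\<bar> \<le> U"
    and R0: "R 0 = mat 1" and L: "L > 0" and opt: "\<And>l. reach U (R L) l \<Longrightarrow> L \<le> l" and n: "n > 0"
  defines "h \<equiv> L / real n"
  defines "z \<equiv> (\<lambda>(i, b). normal_vec (R (real i * h)) + (if b then U else - U) *\<^sub>R position (R (real i * h)))"
  shows "\<not> cball ((1 / L) *\<^sub>R integral {0..L} (ang u R)) (24 * (1 + U) / sqrt n) \<subseteq> pointed_hull ({..<n}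
      \<times> UNIV) z"
proof
  define w where "w = (1 / L) *\<^sub>R integral {0..L} (ang u R)"
  assume "cball ((1 / L) *\<^sub>R integral {0..L} (ang u R)) (24 * (1 + U) / sqrt n) \<subseteq> pointed_hull ({..<n}
      \<times> UNIV) z"
  then have ball: "cball w (24 * (1 + U) / sqrt n) \<subseteq> pointed_hull ({..<n} \<times> UNIV) z" by (simp add: w_def)
  have U: "0 \<le> U" using R(3)[of 0] L by force
  define B where "B = 1 + U"
  have B: "B > 0" using U by (simp add: B_def)
  have sn: "sqrt n > 0" using n by simp
  have nh: "real n * h = L" using n by (simp add: h_def)
  have h: "h > 0" using L n by (simp add: h_def)
  \<comment> \<open>The radius 24 divided by \<open>2 * DIM(real^3) = 6\<close>. Half of
    \<open>c\<close> will pay for the greedy error and half for the second order errors.\<close>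
  define c where "c = 4 * B / sqrt n"
  have c: "c \<ge> 0" using B sn by (simp add: c_def)
  obtain \<theta> k where \<theta>: "\<theta> < 1" and kc: "\<And>j. continuous_on UNIV (\<lambda>y. k y j)"
    and k: "\<And>y. norm y \<le> 24 * (1 + U) / sqrt n / (2 * DIM(real^3)) \<Longrightarrow>
       (\<forall>j\<in>{..<n} \<times> UNIV. 0 \<le> k y j) \<and> sum (k y) ({..<n} \<times> UNIV) \<le> \<theta> \<and>
           (\<Sum>j\<in>{..<n} \<times> UNIV. k y j *\<^sub>R z j) = w + y"
    by (rule pointed_hull_selection[OF _ _ ball]) (use U sn in \<open>auto intro!: divide_pos_pos\<close>)
  have k: "(\<forall>j\<in>{..<n} \<times> UNIV. 0 \<le> k y j)" "sum (k y) ({..<n} \<times> UNIV) \<le> \<theta>"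
      "(\<Sum>j\<in>{..<n} \<times> UNIV. k y j *\<^sub>R z j) = w + y" if "y \<in> cball 0 c" for y
  proof -
    have "norm y \<le> 24 * (1 + U) / sqrt n / (2 * DIM(real^3))"
    proof -
      have "24 * (1 + U) / sqrt n / 6 = c" using sn by (simp add: c_def B_def field_simps)
      then show ?thesis using that by simp
    qed
    from k[OF this] show "(\<forall>j\<in>{..<n} \<times> UNIV. 0 \<le> k y j)" "sum (k y) ({..<n} \<times> UNIV) \<le> \<theta>"
      "(\<Sum>j\<in>{..<n} \<times> UNIV. k y j *\<^sub>R z j) = w + y" by auto
  qed
  \<comment> \<open>The second order errors of all \<open>n\<close> slots and of their product are
    together \<open>C\<close> times the square of the deleted length; after rescaling one factor of
    that length remains.\<close>
  define C where "C = real n * (50000 * B\<^sup>2) + real n * (3 * 4 ^ n * (576 * B)\<^sup>2)"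
  have C: "C \<ge> 0" by (simp add: C_def)
  \<comment> \<open>Here \<open>L / m\<close> is the total deleted length. The last condition keeps
    the product close enough to the identity for \<open>rotation_eq_one_if_vee_zero\<close>.\<close>
  obtain m :: nat where m: "m > 0" "L / m * C \<le> 2 * B / sqrt n" "L / m * (4 ^ n * (576 * B)) < 2"
  proof -
    have "((\<lambda>m. L / real m * C) \<longlongrightarrow> 0) sequentially" "((\<lambda>m. L / real m * (4 ^ n * (576 *
        B))) \<longlongrightarrow> 0) sequentially"
      by (auto intro!: tendsto_mult_left_zero lim_const_over_n)
    then have "\<forall>\<^sub>F m in sequentially. L / real m * C < 2 * B / sqrt n"
       "\<forall>\<^sub>F m in sequentially. L / real m * (4 ^ n * (576 * B)) < 2"
      using B sn by (auto intro!: order_tendstoD(2) divide_pos_pos)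
    then have "\<forall>\<^sub>F m in sequentially. m > 0 \<and> L / real m * C < 2 * B / sqrt n \<and> L / real m * (4 ^ n *
        (576 * B)) < 2"
      using eventually_gt_at_top[of 0] by eventually_elim auto
    then show thesis using that by (force simp: eventually_sequentially)
  qed
  define \<eta> where "\<eta> = h / real m"
  define \<delta> where "\<delta> = L / real m"
  have \<delta>: "\<delta> > 0" using L m by (simp add: \<delta>_def)
  have \<eta>: "\<eta> > 0" using h m by (simp add: \<eta>_def)
  have n\<eta>: "real n * \<eta> = \<delta>" using nh by (simp add: \<eta>_def \<delta>_def)
  have m\<eta>: "real m * \<eta> = h" using m by (simp add: \<eta>_def)
  have \<eta>\<delta>: "\<eta> \<le> \<delta>" using n\<eta> n \<eta> by (metis Suc_leI mult_right_mono mult_1 less_imp_le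
      of_nat_1 of_nat_mono One_nat_def)
  have int: "ang u R integrable_on {a..b}" if "0 \<le> a" "b \<le> L" for a b
    using that by (intro ang_integrable[OF R])
  have ib: "norm (integral {a..b} (ang u R)) \<le> B * (b - a)" if "0 \<le> a" "a \<le> b" "b \<le> L" for a b
  proof (rule has_integral_norm_le[OF integrable_integral[OF int]])
    fix s assume "s \<in> {a..b}"
    then have s: "s \<in> {0..L}" using that by auto
    show "norm (ang u R s) \<le> B"
      unfolding B_def by (intro norm_ang_le solves_on_rotation[OF R(1) s] R(3) s)
  qed (use that in auto)
  have slot: "0 \<le> real i * h" "real i * h + h \<le> L" if "i < n" for i
  proof -
    have "real i * h + h = real (Suc i) * h" by (simp add: algebra_simps)
    also have "\<dots> \<le> real n * h" using that h by (intro mult_right_mono) auto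
    finally show "real i * h + h \<le> L" by (simp add: nh)
  qed (use h in simp)
  have sub: "0 \<le> real j * \<eta>" "real j * \<eta> + \<eta> \<le> h" if "j < m" for j
  proof -
    have "real j * \<eta> + \<eta> = real (Suc j) * \<eta>" by (simp add: algebra_simps)
    also have "\<dots> \<le> real m * \<eta>" using that \<eta> by (intro mult_right_mono) auto
    finally show "real j * \<eta> + \<eta> \<le> h" by (simp add: m\<eta>)
  qed (use \<eta> in simp)
  define v where "v = (\<lambda>i. (1 / h) *\<^sub>R integral {real i * h..real i * h + h} (ang u R))"
  define q where "q = (\<lambda>i j. (1 / \<eta>) *\<^sub>R integral {real i * h + real j * \<eta>..real i * h + real j *
      \<eta> + \<eta>} (ang u R))"
  have v: "norm (v i) \<le> B" if "i < n" for i
  proof -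
    have "norm (v i) \<le> (1 / h) * (B * (real i * h + h - real i * h))"
      unfolding v_def norm_scaleR using h slot[OF that] by (intro mult_mono ib) auto
    then show ?thesis using h by simp
  qed
  have q: "norm (q i j) \<le> B" if "i < n" "j < m" for i j
  proof -
    have "norm (q i j) \<le> (1 / \<eta>) * (B * (real i * h + real j * \<eta> + \<eta> - (real i * h + real j * \<eta>)))"
      unfolding q_def norm_scaleR using \<eta> slot[OF that(1)] sub[OF that(2)]
        add_nonneg_nonneg[OF slot(1)[OF that(1)] sub(1)[OF that(2)]] by (intro mult_mono ib) auto
    then show ?thesis using \<eta> by simp
  qed
  have qs: "(\<Sum>j<m. q i j - v i) = 0" if "i < n" for i
  proof -
    have "(\<Sum>j<m. q i j) = (1 / \<eta>) *\<^sub>R integral {real i * h..real i * h + real m * \<eta>} (ang u R)"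
      unfolding q_def scaleR_sum_right[symmetric]
      by (subst integral_sum_pieces) (use slot[OF that] int \<eta> m\<eta> in auto)
    also have "\<dots> = real m *\<^sub>R v i"
      unfolding m\<eta> v_def using h m by (simp add: \<eta>_def)
    finally show ?thesis by (simp add: sum_subtractf sum_constant_scaleR del: sum_constant)
  qed
  have vs: "(\<Sum>i<n. v i) = real n *\<^sub>R w"
  proof -
    have "(\<Sum>i<n. v i) = (1 / h) *\<^sub>R integral {0..0 + real n * h} (ang u R)"
      unfolding v_def scaleR_sum_right[symmetric]
      using integral_sum_pieces[of "ang u R" 0 n h] int[of 0 L] h nh by simp
    also have "\<dots> = real n *\<^sub>R w"
      using L n by (simp add: nh w_def h_def)
    finally show ?thesis .
  qed
  have qb: "norm (q i j - v i) \<le> 2 * B" if "i < n" "j < m" for i j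
    using q[OF that] v[OF that(1)] norm_triangle_ineq4[of "q i j" "v i"] by simp
  \<comment> \<open>Within a slot the deviations of the pieces \<open>q i j\<close> from the slot
    average \<open>v i\<close> sum to zero, as the greedy choice requires.\<close>
  obtain J where J: "\<And>i. i < n \<Longrightarrow> J i < m" and Jn: "(norm (\<Sum>i<n. q i (J i) - v i))\<^sup>2 \<le>
      real n * (2 * B)\<^sup>2"
    using greedy_choice[of m n "\<lambda>i j. q i j - v i" "2 * B", OF m(1) qs qb] by blast
  define A where "A = (1 / real n) *\<^sub>R (\<Sum>i<n. q i (J i))"
  have Aw: "norm (A - w) \<le> 2 * B / sqrt n"
  proof -
    have "A - w = (1 / real n) *\<^sub>R (\<Sum>i<n. q i (J i) - v i)"
      using n by (simp add: A_def sum_subtractf vs scaleR_diff_right)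
    then have "norm (A - w) = (1 / real n) * norm (\<Sum>i<n. q i (J i) - v i)" by simp
    also have "\<dots> \<le> (1 / real n) * (sqrt n * (2 * B))"
    proof (rule mult_left_mono)
      have "(norm (\<Sum>i<n. q i (J i) - v i))\<^sup>2 \<le> (sqrt n * (2 * B))\<^sup>2"
        using Jn unfolding power_mult_distrib[of "sqrt n"] by simp
      then show "norm (\<Sum>i<n. q i (J i) - v i) \<le> sqrt n * (2 * B)"
        by (rule power2_le_imp_le) (use B in simp)
    qed simp
    also have "\<dots> = 2 * B / sqrt n"
    proof -
      have "1 / (t * t) * (t * (2 * B)) = 2 * B / t" if "t > 0" for t :: real
        using that by simp
      from this[OF sn] show ?thesis by simp
    qed
    finally show ?thesis .
  qed
  define M where "M = (\<lambda>i. R (real i * h))"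
  define s where "s = (\<lambda>i. real i * h + real (J i) * \<eta>)"
  have s: "real i * h \<le> s i" "0 \<le> s i" "s i + \<eta> \<le> real i * h + h" "s i + \<eta> \<le> L" if "i < n" for i
    using slot[OF that] sub[OF J[OF that]] by (auto simp: s_def)
  define D where "D = (\<lambda>y i. (M i ** turn U (\<delta> * k y (i, True)) ** transpose (M i)) **
     (M i ** turn (- U) (\<delta> * k y (i, False)) ** transpose (M i)) ** (R (s i) ** transpose (R (s i + \<eta>))))"
  have rotM: "rotation_matrix (M i)" if "i < n" for i
    using slot[OF that] h by (auto simp: M_def intro!: solves_on_rotation[OF R(1)])
  have k1: "0 \<le> k y (i, b)" "k y (i, b) \<le> 1" if "y \<in> cball 0 c" "i < n" for y i b
  proof -
    show 0: "0 \<le> k y (i, b)" using k(1)[OF that(1)] that(2) by auto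
    have "k y (i, b) \<le> sum (k y) ({..<n} \<times> UNIV)"
      using k(1)[OF that(1)] that(2) by (intro member_le_sum) auto
    then show "k y (i, b) \<le> 1" using k(2)[OF that(1)] \<theta> by simp
  qed
  have ksum: "(\<Sum>i<n. k y (i, True) + k y (i, False)) \<le> \<theta>" if "y \<in> cball 0 c" for y
    using k(2)[OF that] sum.cartesian_product[of "\<lambda>i b. k y (i, b)" UNIV "{..<n}"]
    by (simp add: UNIV_bool add.commute case_prod_unfold)
  have kz: "(\<Sum>i<n. k y (i, True) *\<^sub>R z (i, True) + k y (i, False) *\<^sub>R z (i, False)) = w + y" if "y \<in>
      cball 0 c" for y
    using k(3)[OF that] sum.cartesian_product[of "\<lambda>i b. k y (i, b) *\<^sub>R z (i, b)" UNIV "{..<n}"]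
    by (simp add: UNIV_bool add.commute case_prod_unfold)
  have Dexp: "rotation_matrix (D y i)" "norm (D y i - mat 1) \<le> 576 * B * \<delta>"
    "norm (vee (D y i) - ((\<delta> * k y (i, True)) *\<^sub>R z (i, True) + (\<delta> * k y (i, False)) *\<^sub>R z (i, False)
      - \<eta> *\<^sub>R q i (J i))) \<le> 50000 * (B * \<delta>)\<^sup>2" if y: "y \<in> cball 0 c" and i: "i < n" for y i
  proof -
    have p: "0 \<le> \<delta> * k y (i, b)" "\<delta> * k y (i, b) \<le> \<delta>" for b
      using k1[OF y i] \<delta> by (auto intro: mult_left_le)
    note S = slot_expansion[OF R(1) R(3) int[OF order_refl order_refl] rotM[OF i] U s(2)[OF i] less_imp_le[OF \<eta>] s(4)[OF i]
        p(1) p(1) p(2) p(2) \<eta>\<delta> meta_eq_to_obj_eq[OF reflexive], of True False]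
    show "rotation_matrix (D y i)" "norm (D y i - mat 1) \<le> 576 * B * \<delta>"
      using S(1,2) by (simp_all add: D_def B_def)
    have "integral {s i..s i + \<eta>} (ang u R) = \<eta> *\<^sub>R q i (J i)"
      using \<eta> by (simp add: q_def s_def)
    then show "norm (vee (D y i) - ((\<delta> * k y (i, True)) *\<^sub>R z (i, True) + (\<delta> * k y (i, False)) *\<^sub>R
        z (i, False)
      - \<eta> *\<^sub>R q i (J i))) \<le> 50000 * (B * \<delta>)\<^sup>2"
      using S(3) by (simp add: D_def B_def z_def M_def)
  qed
  \<comment> \<open>The endpoint defect per unit of deleted length. In first order it is
    \<open>w + y - A\<close>, so it differs from \<open>y\<close> by at most \<open>c\<close>, and
    Brouwer's theorem supplies a zero.\<close>
  define F where "F = (\<lambda>y. (1 / \<delta>) *\<^sub>R vee (mprod (D y) n))"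
  have blin: "bounded_linear vee"
  proof (rule bounded_linear_intro)
    show "vee (A + A') = vee A + vee A'" for A A' by (rule vee_add)
    show "vee (t *\<^sub>R A) = t *\<^sub>R vee A" for t A
      by (simp add: vee_def vec_eq_iff forall_3 right_diff_distrib)
    show "norm (vee A) \<le> norm A * 3" for A using norm_vee_le[of A] by simp
  qed
  have Fc: "continuous_on (cball 0 c) F"
    unfolding F_def D_def
    by (intro continuous_on_scaleR continuous_on_const bounded_linear.continuous_on[OF blin] continuous_on_mprod
        continuous_on_matrix_mult continuous_on_turn continuous_on_mult continuous_on_subset[OF kc]) auto
  have Fy: "norm (y - F y) \<le> c" if y: "y \<in> cball 0 c" for y
  proof -
    define S where "S = (\<Sum>i<n. vee (D y i))"
    define T where "T = (\<Sum>i<n. (\<delta> * k y (i, True)) *\<^sub>R z (i, True) + (\<delta> * k y (i, False)) *\<^sub>R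
        z (i, False) - \<eta> *\<^sub>R q i (J i))"
    have 1: "norm (vee (mprod (D y) n) - S) \<le> real n * (3 * 4 ^ n * (576 * B * \<delta>)\<^sup>2)"
      unfolding S_def using Dexp[OF y] B \<delta> by (intro vee_mprod) auto
    have 2: "norm (S - T) \<le> real n * (50000 * (B * \<delta>)\<^sup>2)"
    proof -
      have "norm (S - T) \<le> (\<Sum>i<n. 50000 * (B * \<delta>)\<^sup>2)"
        unfolding S_def T_def sum_subtractf[symmetric] using Dexp(3)[OF y] by (intro sum_norm_le) auto
      then show ?thesis by simp
    qed
    have "T = \<delta> *\<^sub>R (\<Sum>i<n. k y (i, True) *\<^sub>R z (i, True) + k y (i, False) *\<^sub>R z (i, False)) -
        \<eta> *\<^sub>R (\<Sum>i<n. q i (J i))"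
      by (simp add: T_def sum_subtractf scaleR_sum_right scaleR_add_right)
    also have "\<eta> *\<^sub>R (\<Sum>i<n. q i (J i)) = \<delta> *\<^sub>R A"
      using n by (simp add: A_def n\<eta>[symmetric])
    finally have T: "T = \<delta> *\<^sub>R (w + y - A)"
      unfolding kz[OF y] by (simp add: algebra_simps)
    have "y - F y = (A - w) - (1 / \<delta>) *\<^sub>R ((vee (mprod (D y) n) - S) + (S - T))"
      using \<delta> by (simp add: F_def T algebra_simps)
    also have "norm \<dots> \<le> norm (A - w) + (1 / \<delta>) * (norm (vee (mprod (D y) n) - S) + norm (S - T))"
    proof -
      have "norm ((vee (mprod (D y) n) - S) + (S - T)) \<le> norm (vee (mprod (D y) n) - S) + norm (S - T)"
        by (rule norm_triangle_ineq)
      then have "norm ((1 / \<delta>) *\<^sub>R ((vee (mprod (D y) n) - S) + (S - T))) \<le> (1 / \<delta>) * (norm (vee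
          (mprod (D y) n) - S) + norm (S - T))"
        using \<delta> by (simp add: divide_right_mono)
      then show ?thesis
        using norm_triangle_ineq4[of "A - w" "(1 / \<delta>) *\<^sub>R ((vee (mprod (D y) n) - S) + (S - T))"] by linarith
    qed
    also have "\<dots> \<le> 2 * B / sqrt n + (1 / \<delta>) * (real n * (3 * 4 ^ n * (576 * B * \<delta>)\<^sup>2) + real n
        * (50000 * (B * \<delta>)\<^sup>2))"
      using Aw 1 2 \<delta> by (intro add_mono mult_left_mono) auto
    also have "(1 / \<delta>) * (real n * (3 * 4 ^ n * (576 * B * \<delta>)\<^sup>2) + real n * (50000 * (B *
        \<delta>)\<^sup>2)) = \<delta> * C"
      using \<delta> by (simp add: C_def power2_eq_square field_simps)
    also have "2 * B / sqrt n + \<delta> * C \<le> c"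
      using m(2) by (simp add: \<delta>_def c_def)
    finally show ?thesis .
  qed
  obtain y where y: "y \<in> cball 0 c" "F y = 0"
    using brouwer_zero[OF c Fc Fy] by blast
  have P: "mprod (D y) n = mat 1"
  proof (rule rotation_eq_one_if_vee_zero)
    show "rotation_matrix (mprod (D y) n)" by (intro rotation_matrix_mprod Dexp y)
    show "vee (mprod (D y) n) = 0" using y(2) \<delta> by (simp add: F_def)
    have "norm (mprod (D y) n - mat 1) \<le> 4 ^ n * (576 * B * \<delta>)"
      using Dexp[OF y(1)] B \<delta> by (intro mprod_near_one) auto
    also have "\<dots> < 2" using m(3) by (simp add: \<delta>_def mult_ac)
    finally show "norm (mprod (D y) n - mat 1) < 2" .
  qed
  \<comment> \<open>The perturbed path up to the \<open>j\<close>-th grid point. Each slot runs two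
    inserted arcs, then the slot without its deleted piece; the original configurations telescope
    and leave only the factors \<open>D y i\<close>.\<close>
  have "reach U (mprod (D y) j ** R (real j * h)) (real j * h - real j * \<eta> + (\<Sum>i<j. \<delta> * (k y (i, True) + k y
      (i, False))))"
    if "j \<le> n" for j
    using that
  proof (induction j)
    case 0
    then show ?case using reach_one[OF U] by (simp add: R0)
  next
    case (Suc j)
    then have j: "j < n" by simp
    define a b where "a = \<delta> * k y (j, True)" and "b = \<delta> * k y (j, False)"
    have ab: "0 \<le> a" "0 \<le> b" using k1(1)[OF y(1) j] \<delta> by (auto simp: a_def b_def)
    have r1: "reach U (mprod (D y) j ** M j) (real j * h - real j * \<eta> + (\<Sum>i<j. \<delta> * (k y (i, True) + k y (i,
        False))))"
      using Suc by (simp add: M_def)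
    have r2: "reach U (turn U a) a" "reach U (turn (- U) b) b"
      using ab U by (auto intro!: reach_turn)
    have r3: "reach U (transpose (M j) ** R (s j)) (s j - real j * h)"
      unfolding M_def by (rule reach_segment[OF R]) (use slot[OF j] s[OF j] \<eta> in auto)
    have r4: "reach U (transpose (R (s j + \<eta>)) ** R (real j * h + h)) (real j * h + h - (s j + \<eta>))"
      by (rule reach_segment[OF R]) (use slot[OF j] s[OF j] \<eta> in auto)
    have "reach U (mprod (D y) j ** M j ** turn U a ** turn (- U) b ** (transpose (M j) ** R (s j)) **
        (transpose (R (s j + \<eta>)) ** R (real j * h + h)))
      (real j * h - real j * \<eta> + (\<Sum>i<j. \<delta> * (k y (i, True) + k y (i, False))) + a + b + (s j - real j * h) +
        (real j * h + h - (s j + \<eta>)))"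
      using reach_mult[OF reach_mult[OF reach_mult[OF reach_mult[OF r1 r2(1)] r2(2)] r3] r4] .
    moreover have "mprod (D y) j ** M j ** turn U a ** turn (- U) b ** (transpose (M j) ** R (s j)) **
        (transpose (R (s j + \<eta>)) ** R (real j * h + h)) = mprod (D y) (Suc j) ** R (real (Suc j) * h)"
    proof -
      have "transpose (M j) ** (M j ** X) = X" for X :: "real^3^3"
        by (simp add: matrix_mul_assoc rotation_transpose_mult[OF rotM[OF j]])
      moreover have "real (Suc j) * h = real j * h + h" by (simp add: algebra_simps)
      ultimately show ?thesis
        by (simp add: D_def a_def b_def matrix_mul_assoc[symmetric])
    qed
    moreover have "real j * h - real j * \<eta> + (\<Sum>i<j. \<delta> * (k y (i, True) + k y (i, False))) + a + b + (s j -
        real j * h) +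
        (real j * h + h - (s j + \<eta>)) =
        real (Suc j) * h - real (Suc j) * \<eta> + (\<Sum>i<Suc j. \<delta> * (k y (i, True) + k y (i, False)))"
      by (simp add: a_def b_def algebra_simps)
    ultimately show ?case by (simp only:)
  qed
  from this[OF order_refl] have "reach U (R L) (L - \<delta> + \<delta> * (\<Sum>i<n. k y (i, True) + k y (i, False)))"
    by (simp add: P nh n\<eta> sum_distrib_left)
  then have "L \<le> L - \<delta> + \<delta> * (\<Sum>i<n. k y (i, True) + k y (i, False))" by (rule opt)
  also have "\<dots> \<le> L - \<delta> + \<delta> * \<theta>" using ksum[OF y(1)] \<delta> by (intro add_left_mono
      mult_left_mono) auto
  also have "\<dots> < L" using \<delta> \<theta> by simp
  finally show False by simp
qed

subsection \<open>The maximum principle\<close>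

lemma grid_point:
  fixes s L :: real
  assumes "n > 0" "0 \<le> s" "s \<le> L" "L > 0"
  obtains i where "i < n" "\<bar>real i * (L / real n) - s\<bar> \<le> L / real n"
proof (cases "s = L")
  case True
  \<comment> \<open>At \<open>s = L\<close> the floor used below would give the index
    \<open>n\<close>, which is out of range; the last admissible grid point is still within one
    step.\<close>
  have "real (n - 1) * (L / real n) = L - L / real n" using assms(1) by (simp add: field_simps of_nat_diff)
  then show ?thesis using that[of "n - 1"] True assms by simp
next
  case False
  define h where "h = L / real n"
  have h: "h > 0" "real n * h = L" using assms by (auto simp: h_def)
  define i where "i = nat \<lfloor>s / h\<rfloor>"
  have i: "real i \<le> s / h" "s / h < real i + 1"
    using assms(2) h(1) by (auto simp: i_def)
  have 1: "real i * h \<le> s" "s < real i * h + h"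
    using i h(1) by (auto simp: field_simps)
  then have "real i * h < real n * h" using h(2) False assms(3) by linarith
  then have "i < n" using h(1) by simp
  then show ?thesis using that[of i] 1 by (simp add: h_def)
qed

text \<open>Unit length keeps the covectors on a compact sphere, so that they cannot degenerate to
  \<open>0\<close> when the grid is refined.\<close>

lemma separating_unit_vector:
  fixes K :: "'a::euclidean_space set"
  assumes "convex K" "K \<noteq> {}" "x \<notin> K"
  obtains p where "norm p = 1" "\<And>y. y \<in> K \<Longrightarrow> p \<bullet> y \<le> p \<bullet> x"
proof -
  obtain a b where a: "a \<noteq> 0" "\<forall>y\<in>K. a \<bullet> y \<le> b" "\<forall>y\<in>{x}. b \<le> a \<bullet> y"
    using separating_hyperplane_sets[of K "{x}"] assms by auto
  show thesis
  proof (rule that[of "(1 / norm a) *\<^sub>R a"])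
    show "((1 / norm a) *\<^sub>R a) \<bullet> y \<le> ((1 / norm a) *\<^sub>R a) \<bullet> x" if "y \<in> K" for y
      using a that by (auto intro!: divide_right_mono elim: order_trans)
  qed (use a in simp)
qed

text \<open>For each grid some point near \<open>w\<close> lies outside the hull and is separated
  from it by a unit vector. Along a convergent subsequence the radii tend to \<open>0\<close> and
  the grid points approach any given \<open>s\<close>, so continuity of the columns gives the
  inequality there.\<close>

lemma extremal_covector:
  assumes R: "solves_on u 0 L R" "u \<in> borel_measurable (lebesgue_on {0..L})" "\<And>s. s \<in> {0..L} \<Longrightarrow>
      \<bar>u s\<bar> \<le> U"
    and R0: "R 0 = mat 1" and L: "L > 0" and opt: "\<And>l. reach U (R L) l \<Longrightarrow> L \<le> l"
  defines "w \<equiv> (1 / L) *\<^sub>R integral {0..L} (ang u R)"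
  obtains P where "norm P = 1" "0 \<le> P \<bullet> w"
    "\<And>s. s \<in> {0..L} \<Longrightarrow> P \<bullet> normal_vec (R s) + U * \<bar>P \<bullet> position (R s)\<bar>
        \<le> P \<bullet> w"
proof -
  define h where "h = (\<lambda>n. L / real (Suc n))"
  define z where "z = (\<lambda>n (i, b). normal_vec (R (real i * h n)) + (if b then U else - U) *\<^sub>R position (R (real
      i * h n)))"
  define \<rho> where "\<rho> = (\<lambda>n. 24 * (1 + U) / sqrt (Suc n))"
  have "\<exists>x p. x \<in> cball w (\<rho> n) \<and> norm p = 1 \<and> (\<forall>y \<in> pointed_hull ({..<Suc n} \<times>
      UNIV) (z n). p \<bullet> y \<le> p \<bullet> x)" for n
  proof -
    have "\<not> cball w (\<rho> n) \<subseteq> pointed_hull ({..<Suc n} \<times> UNIV) (z n)"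
      unfolding w_def \<rho>_def z_def h_def by (rule average_not_interior[OF R R0 L opt]) auto
    then obtain x where x: "x \<in> cball w (\<rho> n)" "x \<notin> pointed_hull ({..<Suc n} \<times> UNIV) (z n)" by blast
    obtain p where "norm p = 1" "\<And>y. y \<in> pointed_hull ({..<Suc n} \<times> UNIV) (z n) \<Longrightarrow> p \<bullet>
        y \<le> p \<bullet> x"
      using separating_unit_vector[OF convex_pointed_hull _ x(2)] pointed_hull_zero by blast
    then show ?thesis using x(1) by blast
  qed
  then obtain x p where x: "\<And>n. x n \<in> cball w (\<rho> n)" and p: "\<And>n. norm (p n :: real^3) = 1"
    and sep: "\<And>n y. y \<in> pointed_hull ({..<Suc n} \<times> UNIV) (z n) \<Longrightarrow> p n \<bullet> y \<le> p n
        \<bullet> x n"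
    by metis
  obtain P r where P: "P \<in> sphere (0::real^3) 1" and r: "strict_mono r" and lim: "(p \<circ> r) \<longlonglongrightarrow> P"
    using compact_sphere[of "0::real^3" 1, unfolded compact_def, rule_format, of p] p by auto
  have \<rho>0: "\<rho> \<longlonglongrightarrow> 0" unfolding \<rho>_def
    by (intro tendsto_divide_0[OF tendsto_const] filterlim_at_top_imp_at_infinity
        filterlim_compose[OF sqrt_at_top] filterlim_compose[OF filterlim_real_sequentially filterlim_Suc])
  have h0: "h \<longlonglongrightarrow> 0" unfolding h_def by (rule LIMSEQ_Suc[OF lim_const_over_n])
  have xw: "x \<longlonglongrightarrow> w"
  proof (rule metric_tendsto_imp_tendsto[OF \<rho>0])
    show "\<forall>\<^sub>F n in sequentially. dist (x n) w \<le> dist (\<rho> n) 0"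
    proof (intro always_eventually allI)
      show "dist (x n) w \<le> dist (\<rho> n) 0" for n
        using x[of n] abs_ge_self[of "\<rho> n"] by (simp add: dist_commute)
    qed
  qed
  have limx: "(\<lambda>n. p (r n) \<bullet> x (r n)) \<longlonglongrightarrow> P \<bullet> w"
    using lim LIMSEQ_subseq_LIMSEQ[OF xw r] by (intro tendsto_inner) (auto simp: o_def)
  show thesis
  proof (rule that[of P])
    show "norm P = 1" using P by simp
    have "p (r n) \<bullet> 0 \<le> p (r n) \<bullet> x (r n)" for n by (rule sep) (rule pointed_hull_zero)
    then show "0 \<le> P \<bullet> w"
      by (intro LIMSEQ_le_const[OF limx]) auto
    fix s assume s: "s \<in> {0..L}"
    have "\<exists>i<Suc n. \<bar>real i * h n - s\<bar> \<le> h n" for n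
      using grid_point[of "Suc n" s L] s L unfolding h_def by (metis atLeastAtMost_iff zero_less_Suc)
    then obtain i where i: "\<And>n. i n < Suc n" "\<And>n. \<bar>real (i n) * h n - s\<bar> \<le> h n" by metis
    define t where "t = (\<lambda>n. real (i n) * h n)"
    have t: "t n \<in> {0..L}" for n
    proof -
      have "real (i n) * h n \<le> real (Suc n) * h n"
        using i(1)[of n] L by (intro mult_right_mono) (auto simp: h_def)
      also have "\<dots> = L" by (simp add: h_def del: of_nat_Suc)
      finally show ?thesis using L by (simp add: t_def h_def)
    qed
    have ts: "t \<longlonglongrightarrow> s"
    proof (rule metric_tendsto_imp_tendsto[OF h0])
      show "\<forall>\<^sub>F n in sequentially. dist (t n) s \<le> dist (h n) 0"
        using order_trans[OF i(2) abs_ge_self] by (intro always_eventually allI) (simp add: dist_real_def t_def)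
    qed
    have tr: "(\<lambda>n. t (r n)) \<longlonglongrightarrow> s" using LIMSEQ_subseq_LIMSEQ[OF ts r] by (simp add: o_def)
    have col: "(\<lambda>n. column j (R (t (r n)))) \<longlonglongrightarrow> column j (R s)" for j
      using solves_on_continuous_column[OF R(1), of j] tr t s
      by (auto simp: continuous_on_sequentially o_def)
    have "P \<bullet> (normal_vec (R s) + (if b then U else - U) *\<^sub>R position (R s)) \<le> P \<bullet> w" for b
    proof (rule LIMSEQ_le[OF _ limx])
      show "(\<lambda>n. p (r n) \<bullet> (normal_vec (R (t (r n))) + (if b then U else - U) *\<^sub>R position (R (t (r n)))))
         \<longlonglongrightarrow> P \<bullet> (normal_vec (R s) + (if b then U else - U) *\<^sub>R position (R s))"
        using lim by (intro tendsto_inner tendsto_add tendsto_scaleR tendsto_const col) (auto simp: o_def)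
      have "p n \<bullet> z n (i n, b) \<le> p n \<bullet> x n" for n
        by (rule sep, rule pointed_hull_generator) (use i(1) in auto)
      then show "\<exists>N. \<forall>n\<ge>N. p (r n) \<bullet> (normal_vec (R (t (r n))) + (if b then U else - U) *\<^sub>R
          position (R (t (r n))))
         \<le> p (r n) \<bullet> x (r n)"
        by (simp add: z_def t_def)
    qed
    from this[of True] this[of False]
    show "P \<bullet> normal_vec (R s) + U * \<bar>P \<bullet> position (R s)\<bar> \<le> P \<bullet> w"
      by (auto simp: inner_add_right inner_diff_right abs_if)
  qed
qed

lemma nonneg_integral_zero_negligible:
  fixes f :: "real \<Rightarrow> real"
  assumes f: "\<And>s. s \<in> {a..b} \<Longrightarrow> 0 \<le> f s"
    and I: "(f has_integral 0) {a..b}"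
  shows "\<exists>N. negligible N \<and> (\<forall>s\<in>{a..b} - N. f s = 0)"
proof -
  have ai: "f absolutely_integrable_on {a..b}"
    using I f by (intro nonnegative_absolutely_integrable_1) auto
  have "(LINT x:{a..b}|lebesgue. f x) = 0"
    using set_lebesgue_integral_eq_integral(2)[OF ai] integral_unique[OF I] by simp
  then have "AE x in lebesgue. indicator {a..b} x *\<^sub>R f x = 0"
    using ai f unfolding set_integrable_def set_lebesgue_integral_def
    by (subst (asm) integral_nonneg_eq_0_iff_AE) (auto simp: indicator_def)
  then obtain N where "negligible N" "{x. indicator {a..b} x *\<^sub>R f x \<noteq> 0} \<subseteq> N"
    by (auto simp: eventually_ae_filter_negligible)
  then show ?thesis by (intro exI[of _ N]) (auto simp: indicator_def)
qed

text \<open>Pointwise \<open>P \<bullet> ang u R s\<close> is at most \<open>P \<bullet> normal_vec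
  (R s) + U * \<bar>P \<bullet> position (R s)\<bar>\<close>, which is at most \<open>\<mu>\<close>,
  while its average is exactly \<open>\<mu>\<close>. Both gaps therefore have integral zero. The gap
  to \<open>\<mu>\<close> is continuous and vanishes everywhere; the one containing \<open>u\<close>
  vanishes only almost everywhere.\<close>

theorem maximum_principle:
  assumes R: "solves_on u 0 L R" "u \<in> borel_measurable (lebesgue_on {0..L})" "\<And>s. s \<in> {0..L} \<Longrightarrow>
      \<bar>u s\<bar> \<le> U"
    and R0: "R 0 = mat 1" and L: "L > 0" and opt: "\<And>l. reach U (R L) l \<Longrightarrow> L \<le> l"
  obtains P \<mu> N where "norm P = 1" "0 \<le> \<mu>" "negligible N"
    "\<And>s. s \<in> {0..L} \<Longrightarrow> P \<bullet> normal_vec (R s) = \<mu> - U * \<bar>P \<bullet> position (R s)\<bar>"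
    "\<And>s. s \<in> {0..L} - N \<Longrightarrow> u s * (P \<bullet> position (R s)) = U * \<bar>P \<bullet> position (R s)\<bar>"
proof -
  define w where "w = (1 / L) *\<^sub>R integral {0..L} (ang u R)"
  obtain P where P: "norm P = 1" "0 \<le> P \<bullet> w"
    "\<And>s. s \<in> {0..L} \<Longrightarrow> P \<bullet> normal_vec (R s) + U * \<bar>P \<bullet> position (R s)\<bar>
        \<le> P \<bullet> w"
    using extremal_covector[OF R R0 L opt, folded w_def] by blast
  define f where "f = (\<lambda>s. P \<bullet> position (R s))"
  define g where "g = (\<lambda>s. P \<bullet> normal_vec (R s))"
  define \<mu> where "\<mu> = P \<bullet> w"
  have cont: "continuous_on {0..L} f" "continuous_on {0..L} g"
    unfolding f_def g_def by (intro continuous_intros solves_on_continuous_column[OF R(1)])+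
  have int: "ang u R integrable_on {0..L}" by (rule ang_integrable[OF R]) auto
  have uf: "u s * f s \<le> U * \<bar>f s\<bar>" if "s \<in> {0..L}" for s
    using mult_right_mono[OF R(3)[OF that], of "\<bar>f s\<bar>"] abs_ge_self[of "u s * f s"] by (simp add: abs_mult)
  have "((\<lambda>s. P \<bullet> ang u R s) has_integral P \<bullet> integral {0..L} (ang u R)) {0..L}"
    using has_integral_linear[OF integrable_integral[OF int] bounded_linear_inner_right[of P]] by (simp add: o_def)
  moreover have "P \<bullet> integral {0..L} (ang u R) = \<mu> * L" using L by (simp add: \<mu>_def w_def)
  moreover have "((\<lambda>_. \<mu>) has_integral \<mu> * L) {0..L}" using has_integral_const_real[of \<mu> 0 L] L by (simp
      add: mult.commute)
  ultimately have "((\<lambda>s. \<mu> - P \<bullet> ang u R s) has_integral 0) {0..L}"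
    using has_integral_diff[of "\<lambda>_. \<mu>" "\<mu> * L" "{0..L}"] by (metis diff_self)
  moreover have "P \<bullet> ang u R s = g s + u s * f s" for s by (simp add: ang_def g_def f_def inner_add_right)
  ultimately have I1: "((\<lambda>s. \<mu> - g s - u s * f s) has_integral 0) {0..L}" by (simp add: algebra_simps)
  have le: "0 \<le> \<mu> - g s - U * \<bar>f s\<bar>" if "s \<in> {0..L}" for s
    using P(3)[OF that] by (simp add: \<mu>_def f_def g_def)
  have c2: "continuous_on {0..L} (\<lambda>s. \<mu> - g s - U * \<bar>f s\<bar>)" by (intro continuous_intros cont)
  then obtain I where I: "((\<lambda>s. \<mu> - g s - U * \<bar>f s\<bar>) has_integral I) {0..L}"
    using integrable_continuous_real by blast
  have "I \<le> 0" using has_integral_le[OF I I1] uf by force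
  moreover have "0 \<le> I" using has_integral_nonneg[OF I] le by blast
  ultimately have I2: "((\<lambda>s. \<mu> - g s - U * \<bar>f s\<bar>) has_integral 0) {0..L}" using I by simp
  have ham: "\<mu> - g s - U * \<bar>f s\<bar> = 0" if "s \<in> {0..L}" for s
    using has_integral_0_cbox_imp_0[of 0 L "\<lambda>s. \<mu> - g s - U * \<bar>f s\<bar>" s] c2 le I2 that L by (simp add:
        box_real)
  have I3: "((\<lambda>s. U * \<bar>f s\<bar> - u s * f s) has_integral 0) {0..L}"
    using has_integral_diff[OF I1 I2] by (simp add: algebra_simps)
  obtain N where N: "negligible N" "\<forall>s\<in>{0..L} - N. U * \<bar>f s\<bar> - u s * f s = 0"
    using nonneg_integral_zero_negligible[OF _ I3] uf by auto
  show thesis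
  proof (rule that[OF P(1) _ N(1)])
    show "0 \<le> \<mu>" using P(2) by (simp add: \<mu>_def)
    show "P \<bullet> normal_vec (R s) = \<mu> - U * \<bar>P \<bullet> position (R s)\<bar>" if "s \<in> {0..L}" for s
      using ham[OF that] by (simp add: f_def g_def)
    show "u s * (P \<bullet> position (R s)) = U * \<bar>P \<bullet> position (R s)\<bar>" if "s \<in> {0..L} - N" for s
      using N(2) that by (auto simp: f_def)
  qed
qed

subsection \<open>Four circular arcs with equal middle arcs are not optimal\<close>

text \<open>\<open>arcq r k t\<close> is a circular arc of angle \<open>t\<close>; its axis is \<open>(k, 0, r)\<close>, and the sign of \<open>k\<close> is
  the sign of the control. The coordinates of \<open>vquat\<close> are adapted to \<open>q \<mapsto> a q c\<close> with \<open>a\<close> an arc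
  for \<open>k\<close> and \<open>c\<close> an arc for \<open>- k\<close>: this map rotates \<open>(p, p')\<close> and \<open>(m, m')\<close> separately.\<close>

definition arcq :: "real \<Rightarrow> real \<Rightarrow> real \<Rightarrow> quat" where
  "arcq r k t = (cos (t / 2), k * sin (t / 2), 0, r * sin (t / 2))"

definition vquat :: "real \<Rightarrow> real \<Rightarrow> real \<Rightarrow> real \<Rightarrow> real \<Rightarrow> real
    \<Rightarrow> quat" where
  "vquat r k p p' m m' = (r * p + k * m, m', k * p - r * m, p')"

lemma arcq_add:
  assumes "r\<^sup>2 + k\<^sup>2 = 1"
  shows "arcq r k (s + t) = arcq r k s \<star> arcq r k t"
proof -
  have e: "cos ((s + t) / 2) = cos (s / 2) * cos (t / 2) - sin (s / 2) * sin (t / 2)"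
    "sin ((s + t) / 2) = sin (s / 2) * cos (t / 2) + cos (s / 2) * sin (t / 2)"
    by (simp_all add: add_divide_distrib cos_add sin_add)
  have "cos (s / 2) * cos (t / 2) - sin (s / 2) * sin (t / 2) =
     cos (s / 2) * cos (t / 2) - (r\<^sup>2 + k\<^sup>2) * (sin (s / 2) * sin (t / 2))"
    using assms by simp
  then show ?thesis
    unfolding arcq_def e by (simp add: algebra_simps power2_eq_square)
qed

text \<open>Multiplication by unit quaternions on both sides is a rotation of four-space with two
  invariant planes. The half angles \<open>(A + B) / 2\<close> and \<open>(A - B) / 2\<close> add in
  one plane and subtract in the other.\<close>

lemma arcq_vquat_arcq:
  assumes "r\<^sup>2 + k\<^sup>2 = 1"
  shows "arcq r k (A + B) \<star> vquat r k p p' m m' \<star> arcq r (- k) (A - B) =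
    vquat r k (p * cos A - p' * sin A) (p * sin A + p' * cos A) (m * cos B - m' * sin B) (m * sin B + m' * cos B)"
proof -
  have "k * k = 1 - r * r" using assms by (simp add: power2_eq_square)
  \<comment> \<open>The second rule reaches \<open>k * k\<close> inside nested products, so that
    simplification arrives at a normal form.\<close>
  then have kk: "k * k = 1 - r * r" "k * (k * z) = z - r * (r * z)" for z
    by (simp_all add: mult.assoc[symmetric] left_diff_distrib)
  define x y x' y' where "x = cos ((A + B) / 2)" and "y = sin ((A + B) / 2)"
    and "x' = cos ((A - B) / 2)" and "y' = sin ((A - B) / 2)"
  have AB: "A = (A + B) / 2 + (A - B) / 2" "B = (A + B) / 2 - (A - B) / 2" by (simp_all add: field_simps)
  have t: "cos A = x * x' - y * y'" "sin A = y * x' + x * y'" "cos B = x * x' + y * y'" "sin B = y * x' - x * y'"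
    unfolding x_def y_def x'_def y'_def
    using cos_add[of "(A + B) / 2" "(A - B) / 2"] sin_add[of "(A + B) / 2" "(A - B) / 2"]
      cos_diff[of "(A + B) / 2" "(A - B) / 2"] sin_diff[of "(A + B) / 2" "(A - B) / 2"]
    by (simp_all flip: AB)
  show ?thesis
    unfolding arcq_def vquat_def t x_def[symmetric] y_def[symmetric] x'_def[symmetric] y'_def[symmetric]
    by (simp add: algebra_simps power2_eq_square kk)
qed

text \<open>Half the sum and half the difference of the two angles serve as parameters: the last
  coordinate is odd in \<open>d\<close> and vanishes for equal arcs, while the others are even in
  \<open>d\<close>.\<close>

lemma arcq_mid:
  assumes "r\<^sup>2 + k\<^sup>2 = 1"
  shows "arcq r (- k) (s + d) \<star> arcq r k (s - d) =
    vquat r k (r * ((2 - 2 * r\<^sup>2) * cos d + (2 * r\<^sup>2 - 1) * cos s)) (r * sin s)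
      (k * (2 * r\<^sup>2 * cos s - (2 * r\<^sup>2 - 1) * cos d)) (- k * sin d)"
proof -
  have "k * k = 1 - r * r" using assms by (simp add: power2_eq_square)
  then have kk: "k * k = 1 - r * r" "k * (k * z) = z - r * (r * z)" for z
    by (simp_all add: mult.assoc[symmetric] left_diff_distrib)
  define x y x' y' where "x = cos ((s + d) / 2)" and "y = sin ((s + d) / 2)"
    and "x' = cos ((s - d) / 2)" and "y' = sin ((s - d) / 2)"
  have AB: "s = (s + d) / 2 + (s - d) / 2" "d = (s + d) / 2 - (s - d) / 2" by (simp_all add: field_simps)
  have t: "cos s = x * x' - y * y'" "sin s = y * x' + x * y'" "cos d = x * x' + y * y'" "sin d = y * x' - x * y'"
    unfolding x_def y_def x'_def y'_def
    using cos_add[of "(s + d) / 2" "(s - d) / 2"] sin_add[of "(s + d) / 2" "(s - d) / 2"]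
      cos_diff[of "(s + d) / 2" "(s - d) / 2"] sin_diff[of "(s + d) / 2" "(s - d) / 2"]
    by (simp_all flip: AB)
  show ?thesis
    unfolding arcq_def vquat_def t x_def[symmetric] y_def[symmetric] x'_def[symmetric] y'_def[symmetric]
    by (simp add: algebra_simps power2_eq_square kk)
qed

text \<open>The inserted quaternion is a great circle arc of length \<open>2 * h\<close>. By
  symmetry the last coordinate stays \<open>0\<close>, so the second plane needs no
  rotation.\<close>

lemma arcq_mid_straight:
  assumes "r\<^sup>2 + k\<^sup>2 = 1"
  shows "arcq r (- k) s \<star> (cos h, 0, 0, sin h) \<star> arcq r k s =
    vquat r k (cos h * (r * ((2 - 2 * r\<^sup>2) + (2 * r\<^sup>2 - 1) * cos s)) + sin h * sin s * (1 - 2 * r\<^sup>2))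
      (cos h * (r * sin s) + sin h * cos s)
      (k * (cos h * (2 * r\<^sup>2 * cos s - (2 * r\<^sup>2 - 1)) - 2 * r * sin h * sin s)) 0"
proof -
  have "k * k = 1 - r * r" using assms by (simp add: power2_eq_square)
  then have kk: "k * k = 1 - r * r" "k * (k * z) = z - r * (r * z)" for z
    by (simp_all add: mult.assoc[symmetric] left_diff_distrib)
  define x y where "x = cos (s / 2)" and "y = sin (s / 2)"
  have t: "cos s = x\<^sup>2 - y\<^sup>2" "sin s = 2 * y * x" and xy: "x\<^sup>2 + y\<^sup>2 = 1"
    using cos_double[of "s / 2"] sin_double[of "s / 2"] by (simp_all add: x_def y_def)
  have "y * y = 1 - x * x" using xy by (simp add: power2_eq_square)
  then have yy: "y * y = 1 - x * x" "y * (y * z) = z - x * (x * z)" for z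
    by (simp_all add: mult.assoc[symmetric] left_diff_distrib)
  define X Y where "X = cos h" and "Y = sin h"
  show ?thesis
    unfolding arcq_def vquat_def t x_def[symmetric] y_def[symmetric] X_def[symmetric] Y_def[symmetric]
    by (simp add: algebra_simps power2_eq_square kk yy)
qed

lemma qnorm2_vquat:
  assumes "r\<^sup>2 + k\<^sup>2 = 1"
  shows "qnorm2 (vquat r k p p' m m') = p\<^sup>2 + p'\<^sup>2 + m\<^sup>2 + m'\<^sup>2"
  unfolding vquat_def using assms by simp algebra

lemma qnorm2_mult: "qnorm2 (p \<star> q) = qnorm2 p * qnorm2 q"
  by (cases p; cases q) (simp add: power2_eq_square algebra_simps)

lemma qnorm2_arcq:
  assumes "r\<^sup>2 + k\<^sup>2 = 1"
  shows "qnorm2 (arcq r k t) = 1"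
proof -
  have "(cos (t / 2))\<^sup>2 + (k * sin (t / 2))\<^sup>2 + 0\<^sup>2 + (r * sin (t / 2))\<^sup>2
    = (cos (t / 2))\<^sup>2 + (r\<^sup>2 + k\<^sup>2) * (sin (t / 2))\<^sup>2"
    by (simp add: power_mult_distrib algebra_simps)
  then show ?thesis using assms by (simp add: arcq_def)
qed

lemma turn_eq_arcq:
  assumes "r = 1 / sqrt (1 + v\<^sup>2)"
  shows "turn v (r * t) = qrot (arcq r (v * r) t)"
proof -
  have "sqrt (1 + v\<^sup>2) > 0" by (simp add: add_pos_nonneg)
  then have "sqrt (1 + v\<^sup>2) * (r * t) = t" using assms by simp
  then show ?thesis
    unfolding turn_def turn_quat_def arcq_def using assms by simp
qed

lemma turn_0_eq: "turn 0 (2 * h) = qrot (cos h, 0, 0, sin h)"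
  by (simp add: turn_def turn_quat_def)

lemma turn_full_circle:
  assumes "r = 1 / sqrt (1 + v\<^sup>2)"
  shows "turn v (r * (2 * pi)) = mat 1"
  unfolding turn_eq_arcq[OF assms] arcq_def
  by (simp add: vec_eq_iff forall_3 mat_def)

text \<open>The derivative \<open>cos t / sqrt (k\<^sup>2 - (sin t)\<^sup>2)\<close> is below 1
  because \<open>k > 1\<close>. This strict inequality is the saved length in
  \<open>four_arcs_shorten\<close>.\<close>

lemma arcsin_sin_div_contract:
  assumes "k > 1" "s < t"
  shows "arcsin (sin t / k) - arcsin (sin s / k) < t - s"
proof -
  have "\<exists>y. ((\<lambda>t. t - arcsin (sin t / k)) has_real_derivative y) (at x) \<and> 0 < y" for x
  proof -
    have "- k < sin x" "sin x < k"
      using assms(1) sin_ge_minus_one[of x] sin_le_one[of x] by linarith+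
    then have ab: "- 1 < sin x / k" "sin x / k < 1"
      using assms(1) by (auto simp: field_simps)
    have "((\<lambda>t. t - arcsin (sin t / k)) has_real_derivative 1 - inverse (sqrt (1 - (sin x / k)\<^sup>2)) * (cos x /
        k)) (at x)"
      using assms(1) ab by (auto intro!: derivative_eq_intros)
    moreover have "inverse (sqrt (1 - (sin x / k)\<^sup>2)) * (cos x / k) < 1"
    proof -
      define w where "w = sqrt (1 - (sin x / k)\<^sup>2)"
      have w: "w > 0" using ab by (simp add: w_def abs_square_less_1 abs_if)
      have "cos x / k < w"
        unfolding w_def
      proof (rule real_less_rsqrt)
        have "(cos x)\<^sup>2 + (sin x)\<^sup>2 < k\<^sup>2"
          using assms(1) by (simp add: one_less_power)
        then show "(cos x / k)\<^sup>2 < 1 - (sin x / k)\<^sup>2"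
          using assms(1) by (simp add: power_divide field_simps)
      qed
      then have "inverse w * (cos x / k) < inverse w * w" using w by (intro mult_strict_left_mono) auto
      then show ?thesis using w by (simp add: w_def)
    qed
    ultimately show ?thesis
      by (intro exI[of _ "1 - inverse (sqrt (1 - (sin x / k)\<^sup>2)) * (cos x / k)"]) simp
  qed
  then have "(\<lambda>t. t - arcsin (sin t / k)) s < (\<lambda>t. t - arcsin (sin t / k)) t"
    by (intro DERIV_pos_imp_increasing[OF assms(2)]) blast
  then show ?thesis by simp
qed

lemma cos_arcsin_scaled:
  assumes "k > 0" "s\<^sup>2 \<le> k\<^sup>2"
  shows "k * sin (arcsin (s / k)) = s" "k * cos (arcsin (s / k)) = sqrt (k\<^sup>2 - s\<^sup>2)"
proof -
  have "\<bar>s\<bar> \<le> k" using assms by (simp add: abs_le_square_iff[symmetric])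
  then have ab: "- 1 \<le> s / k" "s / k \<le> 1" using assms(1) by (auto simp: field_simps)
  then show "k * sin (arcsin (s / k)) = s" using assms(1) by simp
  have "k * cos (arcsin (s / k)) = sqrt (k\<^sup>2) * sqrt (1 - (s / k)\<^sup>2)"
    using ab assms(1) by (simp add: cos_arcsin)
  also have "\<dots> = sqrt (k\<^sup>2 - s\<^sup>2)"
    unfolding real_sqrt_mult[symmetric] using assms(1) by (simp add: power_divide right_diff_distrib)
  finally show "k * cos (arcsin (s / k)) = sqrt (k\<^sup>2 - s\<^sup>2)" .
qed

text \<open>The middle arcs \<open>\<beta>, \<beta>\<close> are replaced by \<open>\<sigma> + d, \<sigma> - d\<close>, where \<open>\<sigma> < \<beta>\<close> is close to \<open>\<beta>\<close> and \<open>d\<close>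
  is determined by preserving the moduli of the two planar components.\<close>

lemma four_arcs_shorten:
  assumes rk: "r\<^sup>2 + k\<^sup>2 = 1" and r: "0 < r" "r \<le> 1 / 2" and \<beta>: "pi < \<beta>" "\<beta> < 2 * pi" and
      \<mu>: "\<mu> > 0"
  obtains \<sigma> d A B where "0 \<le> \<sigma> + d" "0 \<le> \<sigma> - d" "\<bar>A\<bar> + \<bar>B\<bar> \<le> \<mu>" "A +
      \<sigma> < \<beta>"
    "arcq r k (A + B) \<star> (arcq r (- k) (\<sigma> + d) \<star> arcq r k (\<sigma> - d)) \<star> arcq r (- k) (A - B)
      = arcq r (- k) \<beta> \<star> arcq r k \<beta>"
proof -
  \<comment> \<open>With this abbreviation the coefficients in \<open>arcq_mid\<close> are
    \<open>1 - c\<close>, \<open>c\<close> and \<open>1 + c\<close>, and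
    \<open>r \<le> 1 / 2\<close> reads \<open>c \<le> - 1 / 2\<close>.\<close>
  define c where "c = 2 * r\<^sup>2 - 1"
  have r2: "r\<^sup>2 \<le> 1 / 4" using power_mono[OF r(2), of 2] r(1) by (simp add: power2_eq_square)
  have c: "- 1 < c" "c \<le> - 1 / 2" using r(1) r2 by (auto simp: c_def)
  have k0: "k\<^sup>2 > 0" using rk r2 by linarith
  define x0 where "x0 = cos \<beta>"
  have x0: "- 1 < x0" "x0 < 1"
  proof -
    have "cos \<beta> = - cos (\<beta> - pi)" by simp
    moreover have "cos (\<beta> - pi) < 1" "- 1 < cos (\<beta> - pi)"
      using \<beta> cos_monotone_0_pi[of 0 "\<beta> - pi"] cos_monotone_0_pi[of "\<beta> - pi" pi] by auto
    ultimately show "- 1 < x0" "x0 < 1" by (auto simp: x0_def)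
  qed
  have s2: "(sin t)\<^sup>2 = 1 - (cos t)\<^sup>2" for t :: real by (simp add: sin_squared_eq)
  define u0 where "u0 = (1 - c) + c * x0"
  have u0: "u0 > 1"
  proof -
    have "c * x0 > c * 1" using c x0 by (intro mult_strict_left_mono_neg) auto
    then show ?thesis by (simp add: u0_def)
  qed
  define K where "K = u0\<^sup>2 + (sin \<beta>)\<^sup>2"
  have K: "K > 1" using u0 one_less_power[OF u0, of 2] zero_le_power2[of "sin \<beta>"] unfolding K_def by linarith
  define \<kappa> where "\<kappa> = sqrt K"
  have \<kappa>: "\<kappa> > 1" "\<kappa>\<^sup>2 = K" using K by (auto simp: \<kappa>_def)
  \<comment> \<open>For half sum \<open>t\<close>, the pair \<open>(u t, sin t)\<close> has the
    squared modulus \<open>K\<close> of the original middle arcs. Solving \<open>arcq_mid\<close>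
    for \<open>cos d\<close> then gives \<open>y t\<close>, and \<open>D t\<close>,
    \<open>- S t\<close> are the second plane's coordinates divided by \<open>k\<close>.
    \<open>A t\<close> and \<open>B t\<close> are the rotations back to the original pairs.\<close>
  define u where "u = (\<lambda>t. sqrt (K - (sin t)\<^sup>2))"
  define y where "y = (\<lambda>t. (u t - c * cos t) / (1 - c))"
  define D where "D = (\<lambda>t. (1 + c) * cos t - c * y t)"
  define S where "S = (\<lambda>t. sqrt (1 - (y t)\<^sup>2))"
  define D0 where "D0 = (1 + c) * x0 - c"
  have D0: "D0 > 0"
  proof -
    have "(1 + c) * x0 > (1 + c) * (- 1)" using c x0 by (intro mult_strict_left_mono) auto
    then show ?thesis using c by (simp add: D0_def)
  qed
  define A where "A = (\<lambda>t. arcsin (sin \<beta> / \<kappa>) - arcsin (sin t / \<kappa>))"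
  define B where "B = (\<lambda>t. arcsin (S t / D0))"
  have ub: "u \<beta> = u0" using u0 by (simp add: u_def K_def)
  have yb: "y \<beta> = 1" using c by (simp add: y_def ub u0_def x0_def)
  have Db: "D \<beta> = D0" by (simp add: D_def D0_def yb x0_def)
  have Sb: "S \<beta> = 0" by (simp add: S_def yb)
  have sK: "- 1 < sin t / \<kappa>" "sin t / \<kappa> < 1" for t
  proof -
    have "- \<kappa> < sin t" "sin t < \<kappa>"
      using \<kappa>(1) sin_ge_minus_one[of t] sin_le_one[of t] by linarith+
    then show "- 1 < sin t / \<kappa>" "sin t / \<kappa> < 1" using \<kappa>(1) by (auto simp: field_simps)
  qed
  have cy: "isCont y t" and cD: "isCont D t" and cS: "isCont S t" for t
    unfolding D_def S_def y_def u_def using c by (auto intro!: continuous_intros)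
  have cA: "isCont A \<beta>"
    unfolding A_def using sK \<kappa>(1) by (auto intro!: continuous_intros isCont_arcsin continuous_at_compose[of \<beta>
        "\<lambda>t. sin t / \<kappa>" arcsin, unfolded o_def])
  have cB: "isCont B \<beta>"
    unfolding B_def using D0 Sb
    by (auto intro!: continuous_intros isCont_arcsin continuous_at_compose[of \<beta> "\<lambda>t. S t / D0" arcsin, unfolded
        o_def] cS)
  have lim: "(f \<longlongrightarrow> f \<beta>) (at_left \<beta>)" if "isCont f \<beta>" for f :: "real \<Rightarrow> real"
    using that by (simp add: isCont_def filterlim_at_split)
  have "((\<lambda>t. \<bar>A t\<bar> + \<bar>B t\<bar>) \<longlongrightarrow> \<bar>A \<beta>\<bar> + \<bar>B \<beta>\<bar>)
      (at_left \<beta>)"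
    by (intro tendsto_intros lim cA cB)
  moreover have "\<bar>A \<beta>\<bar> + \<bar>B \<beta>\<bar> = 0" by (simp add: A_def B_def Sb)
  ultimately have "\<forall>\<^sub>F t in at_left \<beta>. \<bar>A t\<bar> + \<bar>B t\<bar> < \<mu>"
    using \<mu> by (simp add: order_tendstoD(2))
  moreover have "\<forall>\<^sub>F t in at_left \<beta>. 0 < y t"
    using order_tendstoD(1)[OF lim[OF cy], of 0] yb by simp
  moreover have "\<forall>\<^sub>F t in at_left \<beta>. 0 < D t"
    using order_tendstoD(1)[OF lim[OF cD], of 0] Db D0 by simp
  moreover have "\<forall>\<^sub>F t in at_left \<beta>. t \<in> {pi<..<\<beta>}"
    by (rule eventually_at_left_real[OF \<beta>(1)])
  ultimately have "\<forall>\<^sub>F t in at_left \<beta>. \<bar>A t\<bar> + \<bar>B t\<bar> < \<mu> \<and> 0 < y t \<and> 0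
      < D t \<and> t \<in> {pi<..<\<beta>}"
    by eventually_elim simp
  then obtain \<sigma> where \<sigma>: "\<bar>A \<sigma>\<bar> + \<bar>B \<sigma>\<bar> < \<mu>" "0 < y \<sigma>" "0 < D
      \<sigma>" "pi < \<sigma>" "\<sigma> < \<beta>"
    using eventually_happens[of _ "at_left \<beta>"] by fastforce
  define x where "x = cos \<sigma>"
  have x: "- 1 < x" "x < x0"
  proof -
    have "cos \<sigma> = - cos (\<sigma> - pi)" "cos \<beta> = - cos (\<beta> - pi)" by simp_all
    moreover have "cos (\<beta> - pi) < cos (\<sigma> - pi)" "cos (\<sigma> - pi) < 1"
      using \<beta> \<sigma> cos_monotone_0_pi[of 0 "\<sigma> - pi"] cos_monotone_0_pi[of "\<sigma> - pi" "\<beta> - pi"] by auto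
    ultimately show "- 1 < x" "x < x0" by (auto simp: x_def x0_def)
  qed
  \<comment> \<open>A suitable \<open>d\<close> exists only if the required cosine is at most 1.
    After squaring, the difference factors; as \<open>x0 + x > - 2\<close>, its last factor exceeds
    \<open>- 4 * c - 2\<close>, which is nonnegative because \<open>r \<le> 1 / 2\<close>.\<close>
  have y1: "y \<sigma> < 1"
  proof -
    have "(x0 - x) * ((1 - c) * (- (2 * c) + (1 + c) * (x0 + x))) > 0"
    proof -
      have "(1 + c) * (x0 + x) > (1 + c) * (- 2)" using c x0 x by (intro mult_strict_left_mono) auto
      then show ?thesis using c x by (intro mult_pos_pos) auto
    qed
    moreover have "((1 - c) + c * x)\<^sup>2 - (K - (sin \<sigma>)\<^sup>2) = (x0 - x) * ((1 - c) * (- (2 * c) + (1 + c) *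
        (x0 + x)))"
      unfolding K_def s2 u0_def x_def[symmetric] x0_def[symmetric]
      by (simp add: power2_eq_square algebra_simps)
    ultimately have "K - (sin \<sigma>)\<^sup>2 < ((1 - c) + c * x)\<^sup>2" by linarith
    moreover have "0 < (1 - c) + c * x"
    proof -
      have "c * x \<ge> c * 1" using c x x0 by (intro mult_left_mono_neg) auto
      then show ?thesis by simp
    qed
    ultimately have "u \<sigma> < (1 - c) + c * x"
      unfolding u_def by (intro real_less_lsqrt) auto
    then show ?thesis using c by (simp add: y_def x_def field_simps)
  qed
  define d where "d = arccos (y \<sigma>)"
  have cd: "cos d = y \<sigma>" using \<sigma>(2) y1 by (simp add: d_def)
  have sd: "sin d = S \<sigma>" using \<sigma>(2) y1 by (simp add: d_def S_def sin_arccos)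
  have d: "0 \<le> d" "d \<le> pi / 2"
    using \<sigma>(2) y1 arccos_le_pi2[of "y \<sigma>"] arccos_lbound[of "y \<sigma>"] by (auto simp: d_def)
  have mid: "arcq r (- k) (\<sigma> + d) \<star> arcq r k (\<sigma> - d) = vquat r k (r * u \<sigma>) (r * sin \<sigma>) (k *
      D \<sigma>) (- k * S \<sigma>)"
  proof -
    have "(2 - 2 * r\<^sup>2) * y \<sigma> + (2 * r\<^sup>2 - 1) * cos \<sigma> = u \<sigma>"
    proof -
      have "(1 - c) * y \<sigma> + c * cos \<sigma> = u \<sigma>" using c by (simp add: y_def)
      then show ?thesis by (simp add: c_def)
    qed
    then show ?thesis unfolding arcq_mid[OF rk] cd sd by (simp add: D_def c_def)
  qed
  have mid0: "arcq r (- k) \<beta> \<star> arcq r k \<beta> = vquat r k (r * u0) (r * sin \<beta>) (k * D0) 0"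
    using arcq_mid[OF rk, of \<beta> 0] by (simp add: u0_def D0_def c_def x0_def)
  have rk': "r\<^sup>2 + (- k)\<^sup>2 = 1" using rk by simp
  have usq: "(u t)\<^sup>2 = K - (sin t)\<^sup>2" for t
  proof -
    have "0 \<le> K - (sin t)\<^sup>2" using K s2[of t] zero_le_power2[of "cos t"] by linarith
    then show ?thesis unfolding u_def by (rule real_sqrt_pow2)
  qed
  \<comment> \<open>Both products are unit quaternions, so preserving the modulus in one plane
    preserves it in the other.\<close>
  have mod: "(D \<sigma>)\<^sup>2 + (S \<sigma>)\<^sup>2 = D0\<^sup>2"
  proof -
    have "qnorm2 (vquat r k (r * u \<sigma>) (r * sin \<sigma>) (k * D \<sigma>) (- k * S \<sigma>)) = 1"
      unfolding mid[symmetric] by (simp add: qnorm2_mult qnorm2_arcq[OF rk] qnorm2_arcq[OF rk'])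
    moreover have "qnorm2 (vquat r k (r * u0) (r * sin \<beta>) (k * D0) 0) = 1"
      unfolding mid0[symmetric] by (simp add: qnorm2_mult qnorm2_arcq[OF rk] qnorm2_arcq[OF rk'])
    ultimately have "k\<^sup>2 * ((D \<sigma>)\<^sup>2 + (S \<sigma>)\<^sup>2) = k\<^sup>2 * D0\<^sup>2"
      unfolding qnorm2_vquat[OF rk] power_mult_distrib usq K_def by (simp add: algebra_simps)
    then show ?thesis using k0 by simp
  qed
  define \<phi>0 \<phi> where "\<phi>0 = arcsin (sin \<beta> / \<kappa>)" and "\<phi> = arcsin (sin \<sigma> / \<kappa>)"
  have le: "(sin t)\<^sup>2 \<le> \<kappa>\<^sup>2" for t using K s2[of t] zero_le_power2[of "cos t"] unfolding \<kappa>(2)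
      by linarith
  have \<phi>: "\<kappa> * sin \<phi> = sin \<sigma>" "\<kappa> * cos \<phi> = u \<sigma>" "\<kappa> * sin \<phi>0 = sin
      \<beta>" "\<kappa> * cos \<phi>0 = u0"
    using cos_arcsin_scaled[OF _ le[of \<sigma>]] cos_arcsin_scaled[OF _ le[of \<beta>]] \<kappa> ub
    by (auto simp: \<phi>_def \<phi>0_def u_def)
  have S2: "(S \<sigma>)\<^sup>2 \<le> D0\<^sup>2" using mod zero_le_power2[of "D \<sigma>"] by linarith
  have "D0\<^sup>2 - (S \<sigma>)\<^sup>2 = (D \<sigma>)\<^sup>2" using mod by simp
  then have \<psi>: "D0 * sin (B \<sigma>) = S \<sigma>" "D0 * cos (B \<sigma>) = D \<sigma>"
    using cos_arcsin_scaled[OF D0 S2] \<sigma>(3) by (auto simp: B_def)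
  have A\<phi>: "\<phi> + A \<sigma> = \<phi>0" by (simp add: A_def \<phi>_def \<phi>0_def)
  have 1: "r * u \<sigma> * cos (A \<sigma>) - r * sin \<sigma> * sin (A \<sigma>) = r * u0"
    unfolding \<phi>[symmetric] A\<phi>[symmetric] cos_add by (simp add: algebra_simps)
  have 2: "r * u \<sigma> * sin (A \<sigma>) + r * sin \<sigma> * cos (A \<sigma>) = r * sin \<beta>"
    unfolding \<phi>[symmetric] A\<phi>[symmetric] sin_add by (simp add: algebra_simps)
  have 3: "k * D \<sigma> * cos (B \<sigma>) - - k * S \<sigma> * sin (B \<sigma>) = k * D0"
  proof -
    have "k * (D0 * x) * x - - k * (D0 * y) * y = k * D0 * (x\<^sup>2 + y\<^sup>2)" for x y
      by (simp add: algebra_simps power2_eq_square)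
    from this[of "cos (B \<sigma>)" "sin (B \<sigma>)"] show ?thesis
      by (simp only: \<psi> sin_cos_squared_add2 mult_1_right)
  qed
  have 4: "k * D \<sigma> * sin (B \<sigma>) + - k * S \<sigma> * cos (B \<sigma>) = 0"
    unfolding \<psi>[symmetric] by (simp add: algebra_simps)
  show thesis
  proof (rule that)
    show "0 \<le> \<sigma> + d" "0 \<le> \<sigma> - d" using d \<sigma>(4) pi_gt_zero by linarith+
    show "\<bar>A \<sigma>\<bar> + \<bar>B \<sigma>\<bar> \<le> \<mu>" using \<sigma>(1) by simp
    \<comment> \<open>This is the gain: the total angle changes by
      \<open>2 * (A \<sigma> + \<sigma> - \<beta>)\<close>, since \<open>B \<sigma>\<close> and
      \<open>d\<close> cancel.\<close>
    show "A \<sigma> + \<sigma> < \<beta>" using arcsin_sin_div_contract[OF \<kappa>(1) \<sigma>(5)] by (simp add: A_def)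
    show "arcq r k (A \<sigma> + B \<sigma>) \<star> (arcq r (- k) (\<sigma> + d) \<star> arcq r k (\<sigma> - d)) \<star>
        arcq r (- k) (A \<sigma> - B \<sigma>)
      = arcq r (- k) \<beta> \<star> arcq r k \<beta>"
      unfolding mid mid0 arcq_vquat_arcq[OF rk] 1 2 3 4 ..
  qed
qed

text \<open>For half circles in the middle the previous family degenerates; here a short great circle
  arc between the two middle arcs helps.\<close>

lemma four_arcs_shorten_pi:
  assumes rk: "r\<^sup>2 + k\<^sup>2 = 1" and r: "0 < r" "r \<le> 1 / 2" and \<mu>: "\<mu> > 0"
  obtains \<xi> e h where "\<xi> \<le> \<mu>" "0 < e" "e \<le> 1" "0 \<le> h" "h < r * (\<xi> + e)"
    "arcq r k (- \<xi>) \<star> (arcq r (- k) (pi - e) \<star> (cos h, 0, 0, sin h) \<star> arcq r k (pi - e)) \<star> arcq r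
        (- k) (- \<xi>)
      = arcq r (- k) pi \<star> arcq r k pi"
proof -
  define q where "q = r\<^sup>2"
  have q: "0 < q" "q \<le> 1 / 4" using r power_mono[OF r(2), of 2] by (auto simp: q_def power2_eq_square)
  have rr: "r * (r * z) = q * z" for z by (simp add: q_def power2_eq_square)
  define m where "m = min \<mu> 1"
  have m: "0 < m" "m \<le> 1" "m \<le> \<mu>" using \<mu> by (auto simp: m_def)
  have pi3: "3 < pi" using pi_gt3 by simp
  \<comment> \<open>Later \<open>sin \<xi> \<le> e / 2\<close>, because
    \<open>\<rho> \<ge> 2 * r\<close>; this choice of \<open>e\<close> therefore forces
    \<open>\<xi> \<le> m \<le> \<mu>\<close>.\<close>
  define e where "e = sin m"
  have e: "0 < e" "e \<le> 1" using m pi3 by (auto simp: e_def intro!: sin_gt_zero)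
  define \<tau> where "\<tau> = tan (e / 2)"
  have ce: "cos (e / 2) > 1 / 2"
    using cos_monotone_0_pi[of "e / 2" "pi / 3"] e pi3 by (simp add: cos_60)
  have \<tau>: "0 < \<tau>" "\<tau> < e"
  proof -
    show "0 < \<tau>" unfolding \<tau>_def using e pi3 by (intro tan_gt_zero) auto
    have "sin (e / 2) \<le> e / 2" using sin_x_le_x[of "e / 2"] e by simp
    also have "e / 2 < e * cos (e / 2)" using ce e by simp
    finally show "\<tau> < e" using ce by (simp add: \<tau>_def tan_def field_simps)
  qed
  have \<tau>s: "\<tau> * sin e = 1 - cos e" "sin e - \<tau> * cos e = \<tau>"
  proof -
    define s t where "s = sin (e / 2)" and "t = cos (e / 2)"
    have st: "sin e = 2 * s * t" "cos e = 1 - 2 * s\<^sup>2" "s\<^sup>2 = 1 - t\<^sup>2" "\<tau> = s / t" "t > 0"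
      using sin_double[of "e / 2"] cos_double_sin[of "e / 2"] sin_squared_eq[of "e / 2"] ce
      by (simp_all add: s_def t_def \<tau>_def tan_def)
    show "\<tau> * sin e = 1 - cos e" using st(5) by (simp add: st(1,2,4) power2_eq_square)
    have "t * (sin e - \<tau> * cos e) = s * (2 * t\<^sup>2 - (1 - 2 * s\<^sup>2))"
      using st(5) by (simp add: st(1,2,4) power2_eq_square algebra_simps)
    also have "\<dots> = t * \<tau>" using st(5) by (simp add: st(3,4))
    finally show "sin e - \<tau> * cos e = \<tau>" using st(5) by simp
  qed
  \<comment> \<open>An upper bound for the great circle half-length \<open>h\<close>. At
    \<open>tan h = r * \<tau>\<close>, the identity \<open>\<tau> * sin e = 1 - cos e\<close>
    cancels all dependence of \<open>F\<close> on \<open>e\<close> except the factor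
    \<open>cos H\<close>.\<close>
  define H where "H = arctan (r * \<tau>)"
  have H: "0 \<le> H" "H < pi / 2" using r \<tau>(1) arctan_ubound by (auto simp: H_def)
  \<comment> \<open>The second plane's first coordinate divided by \<open>k\<close>; two half
    circles give it the value \<open>1 - 4 * q\<close>. Restoring that value fixes the second plane,
    and unit norm then fixes the modulus in the first.\<close>
  define F where "F = (\<lambda>h. cos h * (1 - 2 * q - 2 * q * cos e) - 2 * r * sin h * sin e)"
  have "F 0 \<ge> 1 - 4 * q" using q cos_le_one[of e] by (simp add: F_def)
  \<comment> \<open>The factor \<open>cos H\<close> lowers the value only because
    \<open>1 - 4 * q \<ge> 0\<close>, that is, \<open>r \<le> 1 / 2\<close>.\<close>
  moreover have "F H \<le> 1 - 4 * q"
  proof -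
    have "cos H > 0" using H by (intro cos_gt_zero_pi) auto
    moreover have "tan H = r * \<tau>" by (simp add: H_def tan_arctan)
    ultimately have sH: "sin H = cos H * (r * \<tau>)" by (simp add: tan_def field_simps)
    have "F H = cos H * ((1 - 2 * q - 2 * q * cos e) - 2 * q * (\<tau> * sin e))"
      by (simp add: F_def sH algebra_simps rr)
    also have "\<dots> = cos H * (1 - 4 * q)" unfolding \<tau>s(1) by (simp add: algebra_simps)
    also have "\<dots> \<le> 1 * (1 - 4 * q)" using q by (intro mult_right_mono) auto
    finally show ?thesis by simp
  qed
  moreover have "\<forall>x. 0 \<le> x \<and> x \<le> H \<longrightarrow> isCont F x"
    unfolding F_def by (auto intro!: continuous_intros)
  ultimately obtain h where h: "0 \<le> h" "h \<le> H" and Fh: "F h = 1 - 4 * q"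
    using IVT2[of F H "1 - 4 * q" 0] H(1) by blast
  have ch: "cos h > 0" using h H by (intro cos_gt_zero_pi) auto
  have sh: "0 \<le> sin h" using h H pi3 by (intro sin_ge_zero) auto
  have th: "tan h \<le> r * \<tau>"
  proof -
    have "tan h \<le> tan H" using h H by (cases "h = H") (auto intro!: less_imp_le tan_monotone)
    then show ?thesis by (simp add: H_def tan_arctan)
  qed
  have sh2: "sin h \<le> cos h * (r * \<tau>)"
    using th ch by (simp add: tan_def field_simps)
  have hr: "h < r * e"
  proof -
    have "h \<le> H" by (rule h)
    also have "H \<le> r * \<tau>" unfolding H_def using r \<tau>(1) by (intro arctan_le_self) auto
    also have "\<dots> < r * e" using r \<tau>(2) by simp
    finally show ?thesis .
  qed
  define p where "p = cos h * (r * ((2 - 2 * q) - (2 * q - 1) * cos e)) + sin h * sin e * (1 - 2 * q)"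
  define p' where "p' = cos h * (r * sin e) - sin h * cos e"
  define \<rho> where "\<rho> = r * (3 - 4 * q)"
  have \<rho>: "\<rho> > 0" using r q by (simp add: \<rho>_def)
  have mid: "arcq r (- k) (pi - e) \<star> (cos h, 0, 0, sin h) \<star> arcq r k (pi - e) = vquat r k p p' (k * (1 - 4 * q)) 0"
  proof -
    have "cos h * (2 * r\<^sup>2 * cos (pi - e) - (2 * r\<^sup>2 - 1)) - 2 * r * sin h * sin (pi - e) = F h"
      by (simp add: F_def q_def algebra_simps)
    then show ?thesis
      unfolding arcq_mid_straight[OF rk] Fh by (simp add: p_def p'_def q_def)
  qed
  have mid0: "arcq r (- k) pi \<star> arcq r k pi = vquat r k \<rho> 0 (k * (1 - 4 * q)) 0"
    using arcq_mid[OF rk, of pi 0] by (simp add: \<rho>_def q_def)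
  have rk': "r\<^sup>2 + (- k)\<^sup>2 = 1" using rk by simp
  have pp: "p\<^sup>2 + p'\<^sup>2 = \<rho>\<^sup>2"
  proof -
    have "qnorm2 (vquat r k p p' (k * (1 - 4 * q)) 0) = 1"
      unfolding mid[symmetric]
      by (simp add: qnorm2_mult qnorm2_arcq[OF rk] qnorm2_arcq[OF rk'])
    moreover have "qnorm2 (vquat r k \<rho> 0 (k * (1 - 4 * q)) 0) = 1"
      unfolding mid0[symmetric] by (simp add: qnorm2_mult qnorm2_arcq[OF rk] qnorm2_arcq[OF rk'])
    ultimately show ?thesis unfolding qnorm2_vquat[OF rk] by simp
  qed
  have se: "0 \<le> sin e" "0 \<le> cos e" using e pi3 by (auto intro!: sin_ge_zero cos_ge_zero)
  have p0: "0 \<le> p"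
  proof -
    have "(2 * q - 1) * cos e \<le> 0" using q se by (intro mult_nonpos_nonneg) auto
    then have "0 \<le> (2 - 2 * q) - (2 * q - 1) * cos e" using q by linarith
    then show ?thesis unfolding p_def using ch r q sh se
      by (intro add_nonneg_nonneg mult_nonneg_nonneg) auto
  qed
  \<comment> \<open>This sign gives \<open>\<xi> \<ge> 0\<close>: the outer arcs are not lengthened,
    and \<open>h < r * e\<close> already suffices for a gain.\<close>
  have p'0: "0 \<le> p'"
  proof -
    have "sin h * cos e \<le> cos h * (r * \<tau>) * cos e" using sh2 se by (intro mult_right_mono) auto
    then have "p' \<ge> cos h * (r * (sin e - \<tau> * cos e))" by (simp add: p'_def algebra_simps)
    moreover have "0 \<le> cos h * (r * (sin e - \<tau> * cos e))" unfolding \<tau>s(2) using ch r \<tau>(1) by simp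
    ultimately show ?thesis by linarith
  qed
  have p'e: "p' \<le> r * e"
  proof -
    have "p' \<le> cos h * (r * sin e)" using sh se by (simp add: p'_def)
    also have "\<dots> \<le> 1 * (r * e)" using r se e sin_x_le_x[of e] by (intro mult_mono) auto
    finally show ?thesis by simp
  qed
  define \<xi> where "\<xi> = arcsin (p' / \<rho>)"
  have le: "p'\<^sup>2 \<le> \<rho>\<^sup>2" using pp zero_le_power2[of p] by linarith
  have \<xi>: "\<rho> * sin \<xi> = p'" "\<rho> * cos \<xi> = p"
  proof -
    have "\<rho>\<^sup>2 - p'\<^sup>2 = p\<^sup>2" using pp by simp
    then show "\<rho> * sin \<xi> = p'" "\<rho> * cos \<xi> = p"
      using cos_arcsin_scaled[OF \<rho> le] p0 by (simp_all add: \<xi>_def)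
  qed
  have \<xi>0: "0 \<le> \<xi>"
  proof -
    have "p' \<le> \<rho>" by (rule power2_le_imp_le[OF le]) (use \<rho> in simp)
    then have "p' / \<rho> \<le> 1" "0 \<le> p' / \<rho>" using \<rho> p'0 by auto
    then show ?thesis unfolding \<xi>_def using arcsin_le_arcsin[of 0 "p' / \<rho>"] by simp
  qed
  have \<xi>m: "\<xi> \<le> m"
  proof -
    have "p' / \<rho> \<le> r * e / (r * 2)" unfolding \<rho>_def using p'e p'0 r q e by (intro frac_le) auto
    also have "\<dots> \<le> sin m" using e r by (simp add: e_def)
    finally have "p' / \<rho> \<le> sin m" .
    moreover have "- 1 \<le> p' / \<rho>"
      by (rule order_trans[of _ 0]) (use p'0 \<rho> in auto)
    ultimately have "arcsin (p' / \<rho>) \<le> arcsin (sin m)"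
      by (intro arcsin_le_arcsin) auto
    then show ?thesis using m pi3 by (simp add: \<xi>_def arcsin_sin)
  qed
  have 1: "p * cos (- \<xi>) - p' * sin (- \<xi>) = \<rho>"
  proof -
    have "(\<rho> * x) * x - (\<rho> * y) * (- y) = \<rho> * (x\<^sup>2 + y\<^sup>2)" for x y
      by (simp add: algebra_simps power2_eq_square)
    from this[of "cos \<xi>" "sin \<xi>"] show ?thesis
      by (simp only: \<xi> sin_cos_squared_add2 mult_1_right cos_minus sin_minus)
  qed
  have 2: "p * sin (- \<xi>) + p' * cos (- \<xi>) = 0"
    unfolding \<xi>[symmetric] by (simp add: algebra_simps)
  show thesis
  proof (rule that[of \<xi> e h])
    show "\<xi> \<le> \<mu>" using \<xi>m m by simp
    have "0 \<le> r * \<xi>" using r \<xi>0 by simp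
    then show "h < r * (\<xi> + e)" unfolding distrib_left using hr by linarith
    show "arcq r k (- \<xi>) \<star> (arcq r (- k) (pi - e) \<star> (cos h, 0, 0, sin h) \<star> arcq r k (pi - e)) \<star>
        arcq r (- k) (- \<xi>)
      = arcq r (- k) pi \<star> arcq r k pi"
      unfolding mid mid0 using arcq_vquat_arcq[OF rk, of "- \<xi>" 0 p p' "k * (1 - 4 * q)" 0] 1 2 by simp
  qed (use e h in auto)
qed

text \<open>The outer arcs absorb the rotations that restore the endpoint. Bounding the rotations by
  the smaller of \<open>\<alpha>\<close> and \<open>\<gamma>\<close> keeps all new arc lengths
  nonnegative.\<close>

lemma four_arcs_not_optimal:
  assumes U: "U > 0" and r: "r = 1 / sqrt (1 + U\<^sup>2)" "r \<le> 1 / 2" and v: "v = U \<or> v = - U"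
    and \<beta>: "pi \<le> \<beta>" "\<beta> < 2 * pi" and \<alpha>\<gamma>: "0 < \<alpha>" "0 < \<gamma>"
  shows "\<exists>l < r * (\<alpha> + 2 * \<beta> + \<gamma>).
    reach U (turn v (r * \<alpha>) ** turn (- v) (r * \<beta>) ** turn v (r * \<beta>) ** turn (- v) (r * \<gamma>)) l"
proof -
  have s: "sqrt (1 + U\<^sup>2) > 0" by (simp add: add_pos_nonneg)
  have r0: "r > 0" using s by (simp add: r(1))
  have v2: "v\<^sup>2 = U\<^sup>2" "(- v)\<^sup>2 = U\<^sup>2" and vU: "\<bar>v\<bar> \<le> U" "\<bar>- v\<bar> \<le> U"
      using v U by auto
  define k where "k = v * r"
  have rk: "r\<^sup>2 + k\<^sup>2 = 1"
  proof -
    have "r\<^sup>2 + k\<^sup>2 = (1 + U\<^sup>2) * r\<^sup>2" by (simp add: k_def power_mult_distrib v2 algebra_simps)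
    also have "\<dots> = 1" using s by (simp add: r(1) power_divide)
    finally show ?thesis .
  qed
  have rk': "r\<^sup>2 + (- k)\<^sup>2 = 1" using rk by simp
  have tv: "turn v (r * t) = qrot (arcq r k t)" "turn (- v) (r * t) = qrot (arcq r (- k) t)" for t
    using turn_eq_arcq[of r v t] turn_eq_arcq[of r "- v" t] r(1) v2 by (simp_all add: k_def)
  define W where "W = arcq r k \<alpha> \<star> (arcq r (- k) \<beta> \<star> arcq r k \<beta>) \<star> arcq r (- k) \<gamma>"
  have W: "turn v (r * \<alpha>) ** turn (- v) (r * \<beta>) ** turn v (r * \<beta>) ** turn (- v) (r * \<gamma>) = qrot W"
    unfolding W_def tv by (simp add: qrot_mult matrix_mul_assoc)
  define \<mu> where "\<mu> = min \<alpha> \<gamma>"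
  have \<mu>: "\<mu> > 0" "\<mu> \<le> \<alpha>" "\<mu> \<le> \<gamma>" using \<alpha>\<gamma> by (auto simp: \<mu>_def)
  have "\<exists>l < r * (\<alpha> + 2 * \<beta> + \<gamma>). reach U (qrot W) l"
  proof (cases "\<beta> = pi")
    case False
    then have "pi < \<beta>" using \<beta> by simp
    from four_arcs_shorten[OF rk r0 r(2) this \<beta>(2) \<mu>(1)]
    obtain \<sigma> d A B where 1: "0 \<le> \<sigma> + d" "0 \<le> \<sigma> - d" "\<bar>A\<bar> + \<bar>B\<bar> \<le> \<mu>"
        "A + \<sigma> < \<beta>"
      and 2: "arcq r k (A + B) \<star> (arcq r (- k) (\<sigma> + d) \<star> arcq r k (\<sigma> - d)) \<star> arcq r (- k) (A - B)
      = arcq r (- k) \<beta> \<star> arcq r k \<beta>" by metis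
    have "qrot W = turn v (r * (\<alpha> + (A + B))) ** turn (- v) (r * (\<sigma> + d)) ** turn v (r * (\<sigma> - d)) **
        turn (- v) (r * ((A - B) + \<gamma>))"
      unfolding W_def tv 2[symmetric] arcq_add[OF rk, of \<alpha>] arcq_add[OF rk', of _ \<gamma>]
      by (simp add: qrot_mult matrix_mul_assoc)
    moreover have "reach U \<dots> (r * (\<alpha> + (A + B)) + r * (\<sigma> + d) + r * (\<sigma> - d) + r * ((A - B) + \<gamma>))"
      using 1 \<mu> r0 by (intro reach_mult reach_turn vU mult_nonneg_nonneg) auto
    moreover have "r * (\<alpha> + (A + B)) + r * (\<sigma> + d) + r * (\<sigma> - d) + r * ((A - B) + \<gamma>)
       = r * (\<alpha> + 2 * (A + \<sigma>) + \<gamma>)" by (simp add: algebra_simps)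
    moreover have "r * (\<alpha> + 2 * (A + \<sigma>) + \<gamma>) < r * (\<alpha> + 2 * \<beta> + \<gamma>)"
      using 1(4) r0 by (intro mult_strict_left_mono) auto
    ultimately show ?thesis by metis
  next
    \<comment> \<open>The cosine is minimal at \<open>pi\<close>, so no half sum
      \<open>\<sigma>\<close> satisfies \<open>cos \<sigma> < cos \<beta>\<close>, on which the
      other construction rests.\<close>
    case True
    from four_arcs_shorten_pi[OF rk r0 r(2) \<mu>(1)]
    obtain \<xi> e h where 1: "\<xi> \<le> \<mu>" "0 < e" "e \<le> 1" "0 \<le> h" "h < r * (\<xi> + e)"
      and 2: "arcq r k (- \<xi>) \<star> (arcq r (- k) (pi - e) \<star> (cos h, 0, 0, sin h) \<star> arcq r k (pi - e))
          \<star> arcq r (- k) (- \<xi>)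
      = arcq r (- k) pi \<star> arcq r k pi" by metis
    have "qrot W = turn v (r * (\<alpha> + - \<xi>)) ** turn (- v) (r * (pi - e)) ** turn 0 (2 * h) ** turn v (r * (pi - e))
        ** turn (- v) (r * (- \<xi> + \<gamma>))"
      unfolding W_def tv True 2[symmetric] arcq_add[OF rk, of \<alpha>] arcq_add[OF rk', of _ \<gamma>] turn_0_eq
      by (simp only: qrot_mult matrix_mul_assoc)
    moreover have "reach U \<dots> (r * (\<alpha> + - \<xi>) + r * (pi - e) + 2 * h + r * (pi - e) + r * (- \<xi> + \<gamma>))"
      using 1 \<mu> r0 pi_gt3 U by (intro reach_mult reach_turn vU mult_nonneg_nonneg) auto
    moreover have "r * (\<alpha> + - \<xi>) + r * (pi - e) + 2 * h + r * (pi - e) + r * (- \<xi> + \<gamma>)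
       = r * (\<alpha> + 2 * pi + \<gamma>) - 2 * (r * (\<xi> + e) - h)" by (simp add: algebra_simps)
    moreover have "\<dots> < r * (\<alpha> + 2 * \<beta> + \<gamma>)" using 1(5) True by simp
    ultimately show ?thesis by metis
  qed
  then show ?thesis by (simp only: W)
qed

subsection \<open>Types of paths\<close>

definition arc_control :: "real \<Rightarrow> arc \<Rightarrow> real \<Rightarrow> bool" where
  "arc_control U x c \<longleftrightarrow> (x = C \<longrightarrow> c = U \<or> c = - U) \<and> (x = G \<longrightarrow> c = 0)"

lemma has_type_one:
  assumes "0 \<le> L" "arc_control U x c" "solves_on (\<lambda>_. c) 0 L R"
  shows "has_type U L R [x]"
  unfolding has_type_def
  by (intro exI[of _ "[0, L]"] exI[of _ "[c]"]) (use assms in \<open>simp add: arc_control_def\<close>)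

lemma has_type_two:
  assumes "0 < t" "t < L" "arc_control U x c" "arc_control U y d"
    and "solves_on (\<lambda>_. c) 0 t R" "solves_on (\<lambda>_. d) t L R" "x = C \<and> y = C \<longrightarrow> d = - c"
  shows "has_type U L R [x, y]"
proof -
  have 1: "[0, t, L] ! i \<le> [0, t, L] ! Suc i \<and>
           (1 < length [x, y] \<longrightarrow> [0, t, L] ! i < [0, t, L] ! Suc i) \<and>
           ([x, y] ! i = C \<longrightarrow> [c, d] ! i = U \<or> [c, d] ! i = - U) \<and>
           ([x, y] ! i = G \<longrightarrow> [c, d] ! i = 0) \<and>
           solves_on (\<lambda>_. [c, d] ! i) ([0, t, L] ! i) ([0, t, L] ! Suc i) R"
    if "i < length [x, y]" for i
  proof -
    have "i = 0 \<or> i = 1" using that by auto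
    then show ?thesis using assms by (elim disjE) (simp_all add: arc_control_def)
  qed
  have 2: "[c, d] ! Suc i = - ([c, d] ! i)"
    if "Suc i < length [x, y] \<and> [x, y] ! i = C \<and> [x, y] ! Suc i = C" for i
  proof -
    have "i = 0" using that by auto
    then show ?thesis using assms that by simp
  qed
  show ?thesis
    unfolding has_type_def
    by (intro exI[of _ "[0, t, L]"] exI[of _ "[c, d]"] conjI allI[OF impI] 1 2) simp_all
qed

lemma has_type_three:
  assumes "0 < t" "t < t'" "t' < L" "arc_control U x c" "arc_control U y d" "arc_control U z b"
    and "solves_on (\<lambda>_. c) 0 t R" "solves_on (\<lambda>_. d) t t' R" "solves_on (\<lambda>_. b) t' L R"
    and "x = C \<and> y = C \<longrightarrow> d = - c" "y = C \<and> z = C \<longrightarrow> b = - d"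
  shows "has_type U L R [x, y, z]"
proof -
  have 1: "[0, t, t', L] ! i \<le> [0, t, t', L] ! Suc i \<and>
           (1 < length [x, y, z] \<longrightarrow> [0, t, t', L] ! i < [0, t, t', L] ! Suc i) \<and>
           ([x, y, z] ! i = C \<longrightarrow> [c, d, b] ! i = U \<or> [c, d, b] ! i = - U) \<and>
           ([x, y, z] ! i = G \<longrightarrow> [c, d, b] ! i = 0) \<and>
           solves_on (\<lambda>_. [c, d, b] ! i) ([0, t, t', L] ! i) ([0, t, t', L] ! Suc i) R"
    if "i < length [x, y, z]" for i
  proof -
    have "i = 0 \<or> i = 1 \<or> i = 2" using that by auto
    then show ?thesis using assms by (elim disjE) (simp_all add: arc_control_def)
  qed
  have 2: "[c, d, b] ! Suc i = - ([c, d, b] ! i)"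
    if "Suc i < length [x, y, z] \<and> [x, y, z] ! i = C \<and> [x, y, z] ! Suc i = C" for i
  proof -
    have "i = 0 \<or> i = 1" using that by auto
    then show ?thesis using assms that by (elim disjE) simp_all
  qed
  show ?thesis
    unfolding has_type_def
    by (intro exI[of _ "[0, t, t', L]"] exI[of _ "[c, d, b]"] conjI allI[OF impI] 1 2) simp_all
qed

abbreviation (input) dubins_types :: "arc list set" where
  "dubins_types \<equiv> {[C, G, C], [C, C, C], [C, G], [G, C], [C, C], [G], [C]}"

subsection \<open>Structure of extremals\<close>

lemma first_zero:
  fixes f :: "real \<Rightarrow> real"
  assumes "p \<le> q" "continuous_on {p..q} f" "f p > 0" "f q \<le> 0"
  obtains c where "p < c" "c \<le> q" "f c = 0" "\<And>s. s \<in> {p..<c} \<Longrightarrow> f s > 0"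
proof -
  define Z where "Z = {s \<in> {p..q}. f s \<in> {..0}}"
  have "Z = {p..q} \<inter> f -` {..0}" by (auto simp: Z_def)
  then have "closed Z" using continuous_closed_preimage[OF assms(2), of "{..0}"] by simp
  then have Z: "compact Z" by (auto simp: compact_eq_bounded_closed Z_def intro: bounded_subset[of "{p..q}"])
  have "q \<in> Z" using assms by (auto simp: Z_def)
  then obtain c where c: "c \<in> Z" "\<And>s. s \<in> Z \<Longrightarrow> c \<le> s"
    using compact_attains_inf[OF Z] by blast
  have pos: "f s > 0" if "s \<in> {p..<c}" for s
    using c(1) c(2)[of s] that by (force simp: Z_def)
  have pc: "p < c" using c(1) assms(3) by (cases "p = c") (auto simp: Z_def)
  have "continuous_on {p..c} f" using assms(2) c(1) by (auto simp: Z_def elim: continuous_on_subset)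
  then obtain x where "p \<le> x" "x \<le> c" "f x = 0"
    using IVT2'[of f c 0 p] c(1) assms(3) pc by (auto simp: Z_def)
  then have "x = c" using pos[of x] by fastforce
  with \<open>f x = 0\<close> show thesis using that[of c] pos pc c(1) by (auto simp: Z_def)
qed

text \<open>\<open>P\<close> is the covector of the maximum principle; the arcs are read off from the sign of \<open>f = P
  \<bullet> X\<close>.\<close>

locale extremal =
  fixes U L r :: real and u :: "real \<Rightarrow> real" and R :: "real \<Rightarrow> real^3^3"
    and P :: "real^3" and \<mu> :: real and N :: "real set"
  assumes U: "U > 0" and r: "r = 1 / sqrt (1 + U\<^sup>2)" and L: "L > 0"
    and R: "solves_on u 0 L R" and bound: "\<And>s. s \<in> {0..L} \<Longrightarrow> \<bar>u s\<bar> \<le> U"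
    and P: "norm P = 1" and \<mu>: "0 \<le> \<mu>" and N: "negligible N"
    and ham: "\<And>s. s \<in> {0..L} \<Longrightarrow> P \<bullet> normal_vec (R s) = \<mu> - U * \<bar>P \<bullet> position
        (R s)\<bar>"
    and max: "\<And>s. s \<in> {0..L} - N \<Longrightarrow> u s * (P \<bullet> position (R s)) = U * \<bar>P \<bullet>
        position (R s)\<bar>"
begin

definition f :: "real \<Rightarrow> real" where "f s = P \<bullet> position (R s)"
definition e :: "real \<Rightarrow> real" where "e s = P \<bullet> heading (R s)"

lemma r_pos: "r > 0" and r_eq: "1 + U\<^sup>2 = 1 / r\<^sup>2"
  using add_pos_nonneg[of 1 "U\<^sup>2"] by (auto simp: r power_divide)

lemma continuous_f: "continuous_on {0..L} f" and continuous_e: "continuous_on {0..L} e"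
  unfolding f_def e_def by (intro continuous_intros solves_on_continuous_column[OF R])+

text \<open>The equation for the position does not involve the control, so \<open>f\<close> is
  continuously differentiable even though \<open>u\<close> is only measurable.\<close>

lemma f_derivative:
  assumes s: "s \<in> {0..L}"
  shows "(f has_real_derivative e s) (at s within {0..L})"
proof -
  have I: "(e has_integral (f t - f 0)) {0..t}" if "t \<in> {0..L}" for t
    using has_integral_linear[OF solves_on_has_integral(1)[OF R order_refl, of t] bounded_linear_inner_right[of P]] that
    by (simp add: o_def f_def[abs_def] e_def[abs_def] inner_diff_right)
  have "((\<lambda>x. f 0 + integral {0..x} e) has_vector_derivative 0 + e s) (at s within {0..L})"
    by (intro derivative_intros integral_has_vector_derivative[OF continuous_e s])
  moreover have "f 0 + integral {0..t} e = f t" if "t \<in> {0..L}" for t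
    using integral_unique[OF I[OF that]] by simp
  ultimately show ?thesis
    unfolding has_real_derivative_iff_has_vector_derivative
    using s by (auto elim!: has_vector_derivative_transform[rotated 2])
qed

text \<open>Parseval for the unit vector \<open>P\<close>. At a zero of \<open>f\<close> it yields
  \<open>(e s)\<^sup>2 = 1 - \<mu>\<^sup>2\<close>, which separates the transversal from the
  tangential case.\<close>

lemma energy: "s \<in> {0..L} \<Longrightarrow> (f s)\<^sup>2 + (e s)\<^sup>2 + (\<mu> - U * \<bar>f s\<bar>)\<^sup>2 = 1"
  using rotation_frame_parseval[OF solves_on_rotation[OF R], of s P] P ham[of s]
  by (simp add: f_def e_def norm_eq_1)

text \<open>The maximum condition gives \<open>u = v\<close> off a negligible set, and the
  integrated equations do not see such a set.\<close>

lemma sign_arc: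
  assumes ab: "0 \<le> a" "b \<le> L" and v: "\<bar>v\<bar> = U" and pos: "\<And>s. s \<in> {a<..<b} \<Longrightarrow> v * f s > 0"
  shows "solves_on (\<lambda>_. v) a b R"
  unfolding solves_on_def
proof
  fix s assume s: "s \<in> {a..b}"
  have u: "u t = v" if "t \<in> {a..s} - (N \<union> {a, b})" for t
  proof -
    have t: "t \<in> {a<..<b}" "t \<in> {0..L} - N" using that s ab by auto
    have "\<bar>v\<bar> * \<bar>f t\<bar> = v * f t" using pos[OF t(1)] by (simp flip: abs_mult)
    then have "u t * f t = v * f t" using max[OF t(2)] v by (simp add: f_def)
    then show ?thesis using pos[OF t(1)] by auto
  qed
  have neg: "negligible (N \<union> {a, b})" using N by (simp add: negligible_Un_eq)
  have le: "0 \<le> a" "a \<le> s" "s \<le> L" using s ab by auto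
  note h = solves_on_has_integral[OF R le]
  have "((\<lambda>t. - position (R t) + v *\<^sub>R normal_vec (R t)) has_integral (heading (R s) - heading (R a))) {a..s}"
    "((\<lambda>t. - (v *\<^sub>R heading (R t))) has_integral (normal_vec (R s) - normal_vec (R a))) {a..s}"
    by (rule has_integral_spike[OF neg _ h(2)], use u in simp, rule has_integral_spike[OF neg _ h(3)], use u in simp)
  then show "rotation_matrix (R s) \<and>
        ((\<lambda>t. heading (R t)) has_integral (position (R s) - position (R a))) {a..s} \<and>
        ((\<lambda>t. - position (R t) + v *\<^sub>R normal_vec (R t))
           has_integral (heading (R s) - heading (R a))) {a..s} \<and>
        ((\<lambda>t. - (v *\<^sub>R heading (R t)))
           has_integral (normal_vec (R s) - normal_vec (R a))) {a..s}"
    using h(1) solves_on_rotation[OF R, of s] le by auto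
qed

text \<open>Where \<open>f\<close> vanishes, \<open>P = \<mu> N\<close>, so the normal vector is constant and the path is a great
  circle.\<close>

lemma zero_arc:
  assumes ab: "0 \<le> a" "a < b" "b \<le> L" and zero: "\<And>s. s \<in> {a..b} \<Longrightarrow> f s = 0"
  shows "solves_on (\<lambda>_. 0) a b R"
proof -
  have rot: "rotation_matrix (R s)" if "s \<in> {a..b}" for s
    using that ab by (intro solves_on_rotation[OF R]) auto
  have e0: "e s = 0" if s: "s \<in> {a..b}" for s
  proof -
    have "(f has_vector_derivative e s) (at s within cbox a b)"
      using has_field_derivative_subset[OF f_derivative, of s "{a..b}"] s ab
      by (auto simp: has_real_derivative_iff_has_vector_derivative)
    moreover have "(f has_vector_derivative 0) (at s within cbox a b)"
      using s zero by (auto intro!: has_vector_derivative_transform[OF _ _ has_vector_derivative_const])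
    ultimately show ?thesis
      using vector_derivative_unique_within_closed_interval[of a b s f] ab(2) s by auto
  qed
  have Nv: "\<mu> *\<^sub>R normal_vec (R s) = P" if s: "s \<in> {a..b}" for s
  proof -
    have "(\<Sum>j\<in>UNIV. (column j (R s) \<bullet> P) *\<^sub>R column j (R s)) = P" by (rule rotation_frame_expand[OF
        rot[OF s]])
    then have "f s *\<^sub>R position (R s) + e s *\<^sub>R heading (R s) + (P \<bullet> normal_vec (R s)) *\<^sub>R
        normal_vec (R s) = P"
      by (simp add: sum_3 f_def e_def inner_commute)
    moreover have "P \<bullet> normal_vec (R s) = \<mu>" using ham[of s] s ab zero[OF s] by (simp add: f_def)
    ultimately show ?thesis by (simp add: zero[OF s] e0[OF s])
  qed
  \<comment> \<open>Comparing norms: \<open>f\<close> can vanish on an interval only if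
    \<open>\<mu> = 1\<close>.\<close>
  have \<mu>1: "\<mu> = 1"
    using arg_cong[OF Nv[of a], of norm] rotation_frame_norm[OF rot[of a], of 3] P \<mu> ab by simp
  have n: "normal_vec (R s) = P" if "s \<in> {a..b}" for s using Nv[OF that] \<mu>1 by simp
  show ?thesis
    unfolding solves_on_def
  proof (intro ballI conjI)
    fix s assume s: "s \<in> {a..b}"
    then have le: "0 \<le> a" "a \<le> s" "s \<le> L" and a: "a \<in> {a..b}" using ab by auto
    show "rotation_matrix (R s)" by (rule rot[OF s])
    show h1: "((\<lambda>t. heading (R t)) has_integral (position (R s) - position (R a))) {a..s}"
      by (rule solves_on_has_integral(1)[OF R le])
    have T: "heading (R t) = cross3 P (position (R t))" if "t \<in> {a..b}" for t
      using rotation_frame(9)[OF rot[OF that]] n[OF that] by simp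
    have X: "cross3 P (heading (R t)) = - position (R t)" if "t \<in> {a..b}" for t
      using rotation_frame(8)[OF rot[OF that]] n[OF that] cross_skew by metis
    have "((\<lambda>t. cross3 P (heading (R t))) has_integral cross3 P (position (R s) - position (R a))) {a..s}"
      using has_integral_linear[OF h1 bounded_linear_cross3_right[of P]] by (simp add: o_def)
    moreover have "cross3 P (position (R s) - position (R a)) = heading (R s) - heading (R a)"
      by (simp add: Cross3.right_diff_distrib T[OF s] T[OF a])
    ultimately have "((\<lambda>t. cross3 P (heading (R t))) has_integral heading (R s) - heading (R a)) {a..s}" by simp
    then show "((\<lambda>t. - position (R t) + 0 *\<^sub>R normal_vec (R t)) has_integral heading (R s) - heading (R a)) {a..s}"
      by (rule has_integral_eq[rotated]) (use X s in auto)
    show "((\<lambda>t. - (0 *\<^sub>R heading (R t))) has_integral normal_vec (R s) - normal_vec (R a)) {a..s}"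
      using n[OF s] n[OF a] by simp
  qed
qed

lemma arc_formula:
  assumes ab: "0 \<le> a" "b \<le> L" and s: "solves_on (\<lambda>_. v) a b R" and v: "\<bar>v\<bar> = U" and x: "0 \<le> x"
      "a + r * x \<le> b"
    and fa: "f a = 0"
  shows "f (a + r * x) = r * (e a * sin x + v * r * \<mu> * (1 - cos x))"
    and "e (a + r * x) = e a * cos x + v * r * \<mu> * sin x"
proof -
  have rx: "0 \<le> r * x" using r_pos x by simp
  then have m: "a + r * x \<in> {a..b}" using x by auto
  have aL: "a \<in> {0..L}" using ab x rx by auto
  have v2: "v\<^sup>2 = U\<^sup>2" using v by (metis power2_abs)
  have sq: "sqrt (1 + v\<^sup>2) = 1 / r" unfolding v2 r by simp
  have R: "R (a + r * x) = R a ** turn v (r * x)"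
    using solves_on_const_eq_turn[OF s m] by simp
  have g: "P \<bullet> normal_vec (R a) = \<mu>" using ham[OF aL] fa by (simp add: f_def)
  have "f (a + r * x) = P \<bullet> (R a *v position (turn v (r * x)))"
    unfolding f_def R column_matrix_mult ..
  also have "\<dots> = (1 - (1 - cos x) * r\<^sup>2) * f a + sin x * r * e a + v * (1 - cos x) * r\<^sup>2 * \<mu>"
    unfolding turn_columns sq matrix_vector_mult_columns using r_pos
    by (simp add: inner_add_right inner_diff_right f_def e_def g power_divide)
  finally show "f (a + r * x) = r * (e a * sin x + v * r * \<mu> * (1 - cos x))"
    by (simp add: fa algebra_simps power2_eq_square)
  have "e (a + r * x) = P \<bullet> (R a *v heading (turn v (r * x)))"
    unfolding e_def R column_matrix_mult ..
  also have "\<dots> = - sin x * r * f a + cos x * e a + v * sin x * r * \<mu>"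
    unfolding turn_columns sq matrix_vector_mult_columns using r_pos
    by (simp add: inner_add_right inner_diff_right f_def e_def g)
  finally show "e (a + r * x) = e a * cos x + v * r * \<mu> * sin x"
    by (simp add: fa algebra_simps)
qed

lemma nonzero_arc:
  assumes ab: "0 \<le> a" "a < b" "b \<le> L" and nz: "\<And>s. s \<in> {a<..<b} \<Longrightarrow> f s \<noteq> 0"
  obtains v where "v = U \<or> v = - U" "\<And>s. s \<in> {a<..<b} \<Longrightarrow> v * f s > 0" "solves_on (\<lambda>_. v) a b R"
proof -
  define m where "m = (a + b) / 2"
  define v where "v = U * sgn (f m)"
  have m: "m \<in> {a<..<b}" using ab by (auto simp: m_def)
  have fm: "f m \<noteq> 0" by (rule nz[OF m])
  have v: "v = U \<or> v = - U" using fm by (auto simp: v_def sgn_if)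
  have conn: "connected (f ` {a<..<b})"
    by (intro connected_continuous_image continuous_on_subset[OF continuous_f]) (use ab in auto)
  have pos: "v * f s > 0" if s: "s \<in> {a<..<b}" for s
  proof (rule ccontr)
    assume "\<not> v * f s > 0"
    then have "0 \<in> f ` {a<..<b}"
      using connectedD_interval[OF conn, of "f s" "f m" 0] connectedD_interval[OF conn, of "f m" "f s" 0] s m U fm
      by (auto simp: v_def sgn_if zero_less_mult_iff not_less split: if_splits)
    then show False using nz by auto
  qed
  have "\<bar>v\<bar> = U" using v U by auto
  then show thesis using that[OF v pos] sign_arc[OF ab(1,3) _ pos] by blast
qed

text \<open>In the transversal case \<open>\<mu> < 1\<close> all arcs between consecutive zeros of \<open>f\<close> have angle \<open>\<beta>\<close>.\<close>

definition w :: real where "w = sqrt (1 - \<mu>\<^sup>2)"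
definition \<beta> :: real where "\<beta> = 2 * (pi - arccos (U * r * \<mu> / sqrt (w\<^sup>2 + (U * r * \<mu>)\<^sup>2)))"

lemma w: assumes "\<mu> < 1" shows "w > 0" "w\<^sup>2 = 1 - \<mu>\<^sup>2"
proof -
  have "\<mu>\<^sup>2 < 1" using assms \<mu> by (simp add: power_less_one_iff abs_square_less_1)
  then show "w > 0" "w\<^sup>2 = 1 - \<mu>\<^sup>2" by (auto simp: w_def)
qed

lemma e_zero_sq: "s \<in> {0..L} \<Longrightarrow> f s = 0 \<Longrightarrow> (e s)\<^sup>2 = 1 - \<mu>\<^sup>2"
  using energy[of s] by simp

text \<open>Amplitude and phase of \<open>f\<close> on an arc that starts at a zero: there
  \<open>f\<close> is, up to sign, \<open>2 * r * k * sin (x / 2) * sin (\<psi> + x / 2)\<close>, so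
  the next zero is \<open>x = \<beta>\<close>. From \<open>\<mu> \<ge> 0\<close> comes
  \<open>\<psi> \<le> pi / 2\<close>, hence \<open>\<beta> \<ge> pi\<close>.\<close>

lemma phase:
  assumes "\<mu> < 1"
  obtains k \<psi> where "k > 0" "0 < \<psi>" "\<psi> \<le> pi / 2" "w = k * sin \<psi>" "U * r * \<mu> = k * cos \<psi>"
      "\<beta> = 2 * pi - 2 * \<psi>"
proof -
  define c where "c = U * r * \<mu>"
  define k where "k = sqrt (w\<^sup>2 + c\<^sup>2)"
  define \<psi> where "\<psi> = arccos (c / k)"
  have c: "0 \<le> c" using U r_pos \<mu> by (simp add: c_def)
  have k2: "k\<^sup>2 = w\<^sup>2 + c\<^sup>2" by (simp add: k_def)
  have k: "k > 0" using w(1)[OF assms] by (simp add: k_def add_pos_nonneg)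
  have "c < k"
    using k2 w(1)[OF assms] k by (intro power_less_imp_less_base[of c 2 k]) auto
  then have ck: "0 \<le> c / k" "c / k < 1" using c k by auto
  have cos: "c = k * cos \<psi>" using ck k by (simp add: \<psi>_def)
  have "k * sin \<psi> = k * sqrt (1 - (c / k)\<^sup>2)" using ck by (simp add: \<psi>_def sin_arccos)
  also have "\<dots> = sqrt (k\<^sup>2 * (1 - (c / k)\<^sup>2))" using k by (simp add: real_sqrt_mult)
  also have "k\<^sup>2 * (1 - (c / k)\<^sup>2) = w\<^sup>2"
  proof -
    have "k\<^sup>2 * (c / k)\<^sup>2 = c\<^sup>2" using k by (simp add: power_divide)
    then show ?thesis using k2 by (simp add: right_diff_distrib)
  qed
  finally have sin: "w = k * sin \<psi>" using w(1)[OF assms] by simp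
  have "0 < \<psi>" using arccos_less_arccos[of "c / k" 1] ck by (simp add: \<psi>_def)
  moreover have "\<psi> \<le> pi / 2" unfolding \<psi>_def using ck by (intro arccos_le_pi2) auto
  moreover have "\<beta> = 2 * pi - 2 * \<psi>" by (simp add: \<beta>_def \<psi>_def k_def c_def)
  ultimately show thesis using that[of k \<psi>] k sin cos by (simp add: c_def)
qed

lemma \<beta>_bounds: assumes "\<mu> < 1" shows "pi \<le> \<beta>" "\<beta> < 2 * pi"
proof -
  obtain k \<psi> where "0 < \<psi>" "\<psi> \<le> pi / 2" "\<beta> = 2 * pi - 2 * \<psi>" by (rule phase[OF assms])
  then show "pi \<le> \<beta>" "\<beta> < 2 * pi" by simp_all
qed

text \<open>The explicit formula needs a constant control, which in turn needs the sign of
  \<open>f\<close>. The derivative fixes the sign just after \<open>a\<close>; up to the first zero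
  \<open>c\<close> after that the formula is valid, and it excludes \<open>c\<close> before angle
  \<open>\<beta>\<close>.\<close>

lemma transversal_step:
  assumes \<mu>1: "\<mu> < 1" and a: "0 \<le> a" "a < L" and fa: "f a = 0" and ea: "e a = \<sigma> * w" and \<sigma>:
      "\<sigma> = 1 \<or> \<sigma> = - 1"
    and b: "b = min L (a + r * \<beta>)"
  shows "a < b" "solves_on (\<lambda>_. \<sigma> * U) a b R" "\<And>s. s \<in> {a<..<b} \<Longrightarrow> \<sigma> * f s > 0"
    "a + r * \<beta> \<le> L \<Longrightarrow> f (a + r * \<beta>) = 0 \<and> e (a + r * \<beta>) = - \<sigma> * w"
proof -
  obtain k \<psi> where k: "k > 0" "0 < \<psi>" "\<psi> \<le> pi / 2" "w = k * sin \<psi>" "U * r * \<mu> = k * cos \<psi>"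
      "\<beta> = 2 * pi - 2 * \<psi>"
    by (rule phase[OF \<mu>1])
  have \<beta>0: "\<beta> > 0" using k(3,6) pi_gt_zero by linarith
  show ab: "a < b" using a r_pos \<beta>0 by (simp add: b)
  have bL: "b \<le> L" by (simp add: b)
  have \<sigma>U: "\<bar>\<sigma> * U\<bar> = U" using \<sigma> U by auto
  have ss: "\<sigma> * \<sigma> = 1" using \<sigma> by auto
  have form: "f (a + r * x) = \<sigma> * (2 * r * k * sin (x / 2) * sin (\<psi> + x / 2))"
    "e (a + r * x) = \<sigma> * (k * sin (\<psi> + x))"
    if "solves_on (\<lambda>_. \<sigma> * U) a c R" "c \<le> L" "0 \<le> x" "a + r * x \<le> c" for c x
  proof -
    note A = arc_formula[OF a(1) that(2,1) \<sigma>U that(3,4) fa]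
    define s t where "s = sin (x / 2)" and "t = cos (x / 2)"
    have x: "sin x = 2 * s * t" "cos x = 1 - 2 * s\<^sup>2"
      using sin_double[of "x / 2"] cos_double_sin[of "x / 2"] by (simp_all add: s_def t_def)
    have K: "\<sigma> * U * r * \<mu> = \<sigma> * (k * cos \<psi>)" using k(5) by (simp add: mult.assoc)
    show "f (a + r * x) = \<sigma> * (2 * r * k * sin (x / 2) * sin (\<psi> + x / 2))"
      unfolding A(1) K ea k(4) sin_add[of \<psi>] s_def[symmetric] t_def[symmetric] x
      by (simp add: power2_eq_square algebra_simps)
    show "e (a + r * x) = \<sigma> * (k * sin (\<psi> + x))"
      unfolding A(2) K ea k(4) sin_add[of \<psi>] by (simp add: algebra_simps)
  qed
  have pos_form: "sin (x / 2) * sin (\<psi> + x / 2) > 0" if "0 < x" "x < \<beta>" for x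
  proof -
    have "0 < x / 2" "x / 2 < pi" "0 < \<psi> + x / 2" "\<psi> + x / 2 < pi"
      using that k(2,3,6) by linarith+
    then show ?thesis by (intro mult_pos_pos sin_gt_zero)
  qed
  have near: "\<exists>d>0. \<forall>h>0. a + h \<in> {0..L} \<longrightarrow> h < d \<longrightarrow> 0 < \<sigma> * f (a + h)"
  proof -
    have "((\<lambda>s. \<sigma> * f s) has_real_derivative \<sigma> * e a) (at a within {0..L})"
      using a by (intro DERIV_cmult f_derivative) auto
    moreover have "\<sigma> * e a > 0" using w(1)[OF \<mu>1] ss by (simp add: ea mult.assoc[symmetric])
    ultimately show ?thesis
      using has_real_derivative_pos_inc_right[of "\<lambda>s. \<sigma> * f s" "\<sigma> * e a" a "{0..L}"] fa by auto
  qed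
  then obtain d where d: "d > 0" "\<And>h. 0 < h \<Longrightarrow> a + h \<in> {0..L} \<Longrightarrow> h < d
      \<Longrightarrow> 0 < \<sigma> * f (a + h)" by blast
  show pos: "\<sigma> * f s > 0" if s: "s \<in> {a<..<b}" for s
  proof (rule ccontr)
    assume neg: "\<not> \<sigma> * f s > 0"
    \<comment> \<open>A start strictly after \<open>a\<close>, because \<open>first_zero\<close>
      requires a positive value and \<open>f a = 0\<close>.\<close>
    define p where "p = a + min (d / 2) ((s - a) / 2)"
    have p: "a < p" "p < s" "p - a < d" using d(1) s by (auto simp: p_def min_def field_simps)
    have "\<sigma> * f t > 0" if "t \<in> {a<..p}" for t
      using d(2)[of "t - a"] that p s a bL by auto
    note near = this
    obtain c where c: "p < c" "c \<le> s" "\<sigma> * f c = 0" "\<And>t. t \<in> {p..<c} \<Longrightarrow> \<sigma> * f t > 0"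
    proof (rule first_zero[of p s "\<lambda>t. \<sigma> * f t"])
      show "continuous_on {p..s} (\<lambda>t. \<sigma> * f t)"
        by (intro continuous_intros continuous_on_subset[OF continuous_f]) (use p s a bL in auto)
    qed (use p near[of p] neg in auto)
    have "\<sigma> * f t > 0" if "t \<in> {a<..<c}" for t
      using near[of t] c(4)[of t] that by (cases "t \<le> p") auto
    then have "solves_on (\<lambda>_. \<sigma> * U) a c R"
      using U c s bL a by (intro sign_arc \<sigma>U) (auto simp: mult_pos_pos mult.commute[of \<sigma>] mult.assoc)
    then have "f c = \<sigma> * (2 * r * k * sin ((c - a) / r / 2) * sin (\<psi> + (c - a) / r / 2))"
      using form(1)[of c "(c - a) / r"] c s bL r_pos p by auto
    moreover define X where "X = sin ((c - a) / r / 2) * sin (\<psi> + (c - a) / r / 2)"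
    have "X > 0"
      unfolding X_def using c p s r_pos by (intro pos_form) (auto simp: b field_simps)
    ultimately have "\<sigma> * f c = \<sigma> * \<sigma> * (2 * r * k * X)" "2 * r * k * X > 0"
      using r_pos k(1) by (simp_all add: X_def)
    then have "\<sigma> * f c > 0" by (simp only: ss mult_1)
    then show False using c(3) by simp
  qed
  show sol: "solves_on (\<lambda>_. \<sigma> * U) a b R"
    using U pos a bL by (intro sign_arc \<sigma>U) (auto simp: mult_pos_pos mult.commute[of \<sigma>] mult.assoc)
  assume le: "a + r * \<beta> \<le> L"
  then have "b = a + r * \<beta>" by (simp add: b)
  then have "f (a + r * \<beta>) = \<sigma> * (2 * r * k * sin (\<beta> / 2) * sin (\<psi> + \<beta> / 2))"
    "e (a + r * \<beta>) = \<sigma> * (k * sin (\<psi> + \<beta>))"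
    using form[OF sol bL, of \<beta>] \<beta>0 by auto
  moreover have "\<psi> + \<beta> / 2 = pi" "\<psi> + \<beta> = 2 * pi - \<psi>"
    unfolding k(6) by (simp_all add: field_simps)
  ultimately show "f (a + r * \<beta>) = 0 \<and> e (a + r * \<beta>) = - \<sigma> * w"
    by (simp add: k(4) sin_diff)
qed

text \<open>The energy leaves only the sign of \<open>e z\<close> open. A derivative of the sign of
  \<open>v\<close> would put values of the opposite sign just before \<open>z\<close>.\<close>

lemma zero_after_arc:
  assumes \<mu>1: "\<mu> < 1" and z: "0 < z" "z \<le> L" "f z = 0" and v: "v = U \<or> v = - U"
    and pos: "\<And>s. s \<in> {0<..<z} \<Longrightarrow> v * f s > 0"
  shows "e z = - (v / U) * w"
proof -
  define \<sigma> where "\<sigma> = v / U"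
  have \<sigma>: "\<sigma> = 1 \<or> \<sigma> = - 1" "v = \<sigma> * U" using v U by (auto simp: \<sigma>_def)
  have "(e z)\<^sup>2 = w\<^sup>2" using e_zero_sq[of z] z w(2)[OF \<mu>1] by simp
  then have ew: "e z = w \<or> e z = - w" by (simp add: power2_eq_iff)
  have "\<not> \<sigma> * e z > 0"
  proof
    assume "\<sigma> * e z > 0"
    moreover have "((\<lambda>s. \<sigma> * f s) has_real_derivative \<sigma> * e z) (at z within {0..L})"
      using z by (intro DERIV_cmult f_derivative) auto
    ultimately obtain d where d: "d > 0" "\<And>h. 0 < h \<Longrightarrow> z - h \<in> {0..L} \<Longrightarrow> h < d
        \<Longrightarrow> \<sigma> * f (z - h) < \<sigma> * f z"
      using has_real_derivative_pos_inc_left[of "\<lambda>s. \<sigma> * f s" "\<sigma> * e z" z "{0..L}"] by blast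
    define h where "h = min (d / 2) (z / 2)"
    have h: "0 < h" "h < d" "h < z" using d(1) z by (auto simp: h_def)
    have "\<sigma> * f (z - h) < 0" using d(2)[of h] h z by auto
    moreover have "\<sigma> * f (z - h) > 0"
      using pos[of "z - h"] h z U by (auto simp: \<sigma>(2) mult_ac zero_less_mult_iff)
    ultimately show False by simp
  qed
  then show ?thesis using ew \<sigma>(1) w(1)[OF \<mu>1] unfolding \<sigma>_def[symmetric] by auto
qed

text \<open>If \<open>f 0 = 0\<close>, zeros might accumulate at the start;
  \<open>transversal_step\<close> provides a zero-free interval after it.\<close>

lemma first_interior_zero:
  assumes \<mu>1: "\<mu> < 1" and z: "z \<in> {0<..<L}" "f z = 0"
  obtains c where "0 < c" "c \<le> z" "f c = 0" "\<And>s. s \<in> {0<..<c} \<Longrightarrow> f s \<noteq> 0"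
proof -
  have "\<exists>p. 0 \<le> p \<and> p < z \<and> (\<forall>s\<in>{0<..p}. f s \<noteq> 0) \<and> f p \<noteq> 0"
  proof (cases "f 0 = 0")
    case False
    then show ?thesis using z by (intro exI[of _ 0]) auto
  next
    case True
    have "(e 0)\<^sup>2 = w\<^sup>2" using e_zero_sq[of 0] True L w(2)[OF \<mu>1] by simp
    then obtain \<sigma> where \<sigma>: "\<sigma> = 1 \<or> \<sigma> = - 1" "e 0 = \<sigma> * w"
      by (metis mult_1 mult_minus1 power2_eq_iff)
    define b where "b = min L (0 + r * \<beta>)"
    note S = transversal_step[OF \<mu>1 order_refl L True \<sigma>(2,1) b_def]
    have "b \<le> z" using S(3)[of z] z by force
    moreover have "f s \<noteq> 0" if "s \<in> {0<..<b}" for s using S(3)[OF that] by auto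
    ultimately show ?thesis using S(1) by (intro exI[of _ "b / 2"]) auto
  qed
  then obtain p where p: "0 \<le> p" "p < z" "\<And>s. s \<in> {0<..p} \<Longrightarrow> f s \<noteq> 0" "f p \<noteq> 0" by blast
  obtain c where c: "p < c" "c \<le> z" "\<bar>f c\<bar> = 0" "\<And>t. t \<in> {p..<c} \<Longrightarrow> \<bar>f t\<bar> > 0"
  proof (rule first_zero[of p z "\<lambda>t. \<bar>f t\<bar>"])
    show "continuous_on {p..z} (\<lambda>t. \<bar>f t\<bar>)"
      by (intro continuous_intros continuous_on_subset[OF continuous_f]) (use p z in auto)
  qed (use p z in auto)
  show thesis
  proof (rule that[of c])
    show "f s \<noteq> 0" if "s \<in> {0<..<c}" for s
      using p(3)[of s] c(4)[of s] that by (cases "s \<le> p") auto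
  qed (use c p in auto)
qed

text \<open>Here \<open>e a = 0\<close>, so along the arc \<open>f\<close> is a nonzero multiple of
  \<open>1 - cos x\<close>, which returns to zero only after full turns.\<close>

lemma tangential_full_circle:
  assumes \<mu>1: "\<mu> = 1" and ab: "0 \<le> a" "a < b" "b \<le> L" and z: "f a = 0" "f b = 0"
    and v: "v = U \<or> v = - U" and s: "solves_on (\<lambda>_. v) a b R"
  shows "a + r * (2 * pi) \<le> b" "R (a + r * (2 * pi)) = R a"
proof -
  have ea: "e a = 0" using e_zero_sq[of a] z ab \<mu>1 by simp
  define x where "x = (b - a) / r"
  have x: "0 < x" "a + r * x = b" using ab r_pos by (auto simp: x_def)
  have "\<bar>v\<bar> = U" using v U by auto
  from arc_formula(1)[OF ab(1,3) s this, of x] x z ea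
  have "r * (v * r * (1 - cos x)) = 0" by (simp add: \<mu>1)
  then have "cos x = 1" using r_pos v U by auto
  then have "2 * pi \<le> x"
  proof -
    obtain n :: int where n: "x = of_int n * 2 * pi" using \<open>cos x = 1\<close> cos_one_2pi_int by blast
    then have "n > 0" using x(1) by (simp add: zero_less_mult_iff)
    then have "1 * (2 * pi) \<le> of_int n * (2 * pi)" by (intro mult_right_mono) auto
    then show ?thesis using n by simp
  qed
  then show le: "a + r * (2 * pi) \<le> b" using x(2) r_pos by (metis add_left_mono mult_left_mono less_imp_le)
  have "a + r * (2 * pi) \<in> {a..b}" using le r_pos by auto
  moreover have "r = 1 / sqrt (1 + v\<^sup>2)" using v r by auto
  ultimately show "R (a + r * (2 * pi)) = R a"
    using solves_on_const_eq_turn[OF s] turn_full_circle[of r v] by auto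
qed

text \<open>The first interior zero determines all later ones. Two of them at most are possible: a
  third would leave two full middle arcs of angle \<open>\<beta>\<close> between nontrivial outer
  arcs.\<close>

lemma transversal_type:
  assumes r2: "r \<le> 1 / 2" and R0: "R 0 = mat 1"
    and opt: "\<And>b l. 0 \<le> b \<Longrightarrow> b \<le> L \<Longrightarrow> reach U (R b) l \<Longrightarrow> b \<le> l"
    and \<mu>1: "\<mu> < 1" and z: "z \<in> {0<..<L}" "f z = 0"
  shows "\<exists>t\<in>dubins_types. has_type U L R t"
proof -
  obtain z1 where z1: "0 < z1" "z1 \<le> z" "f z1 = 0" "\<And>s. s \<in> {0<..<z1} \<Longrightarrow> f s \<noteq> 0"
    using first_interior_zero[OF \<mu>1 z] by blast
  have z1L: "z1 < L" using z1(2) z by auto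
  obtain v where v: "v = U \<or> v = - U" "\<And>s. s \<in> {0<..<z1} \<Longrightarrow> v * f s > 0" "solves_on (\<lambda>_.
      v) 0 z1 R"
    using nonzero_arc[OF order_refl z1(1) less_imp_le[OF z1L] z1(4)] by blast
  define \<sigma> where "\<sigma> = - (v / U)"
  have \<sigma>: "\<sigma> = 1 \<or> \<sigma> = - 1" "- \<sigma> = 1 \<or> - \<sigma> = - 1" and \<sigma>U: "\<sigma> * U = -
      v" "- \<sigma> * U = v"
    using v(1) U by (auto simp: \<sigma>_def)
  have C: "arc_control U C v" "arc_control U C (- v)" using v(1) by (auto simp: arc_control_def)
  have e1: "e z1 = \<sigma> * w"
    unfolding \<sigma>_def by (rule zero_after_arc[OF \<mu>1 z1(1) less_imp_le[OF z1L] z1(3) v(1,2)])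
  note S1 = transversal_step[OF \<mu>1 less_imp_le[OF z1(1)] z1L z1(3) e1 \<sigma>(1) refl, unfolded \<sigma>U]
  define z2 where "z2 = z1 + r * \<beta>"
  have r\<beta>: "r * \<beta> > 0" using r_pos \<beta>_bounds[OF \<mu>1] pi_gt_zero by simp
  show ?thesis
  proof (cases "z2 < L")
    case False
    then have "solves_on (\<lambda>_. - v) z1 L R" using S1(2) by (simp add: z2_def min_def split: if_splits)
    then have "has_type U L R [C, C]"
      by (intro has_type_two[OF z1(1) z1L C v(3)]) auto
    then show ?thesis by blast
  next
    case z2L: True
    have z2: "0 < z2" "z1 < z2" using z1(1) r\<beta> by (auto simp: z2_def)
    have s2: "solves_on (\<lambda>_. - v) z1 z2 R" using S1(2) z2L by (simp add: z2_def min_def split: if_splits)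
    have f2: "f z2 = 0" "e z2 = - \<sigma> * w" using S1(4) z2L by (auto simp: z2_def)
    note S2 = transversal_step[OF \<mu>1 less_imp_le[OF z2(1)] z2L f2 \<sigma>(2) refl, unfolded \<sigma>U]
    define z3 where "z3 = z2 + r * \<beta>"
    show ?thesis
    proof (cases "z3 < L")
      case False
      then have "solves_on (\<lambda>_. v) z2 L R" using S2(2) by (simp add: z3_def min_def split: if_splits)
      then have "has_type U L R [C, C, C]"
        by (intro has_type_three[OF z1(1) z2(2) z2L C(1,2,1) v(3) s2]) auto
      then show ?thesis by blast
    next
      case z3L: True
      have z3: "0 < z3" "z2 < z3" using z2(1) r\<beta> by (auto simp: z3_def)
      have s3: "solves_on (\<lambda>_. v) z2 z3 R" using S2(2) z3L by (simp add: z3_def min_def split: if_splits)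
      have f3: "f z3 = 0" "e z3 = \<sigma> * w" using S2(4) z3L by (auto simp: z3_def)
      note S3 = transversal_step[OF \<mu>1 less_imp_le[OF z3(1)] z3L f3 \<sigma>(1) refl, unfolded \<sigma>U]
      \<comment> \<open>The comparison concerns only the part of the path up to the end of the
        fourth arc, so further zeros need no discussion.\<close>
      define b where "b = min L (z3 + r * \<beta>)"
      have b: "z3 < b" "b \<le> L" and s4: "solves_on (\<lambda>_. - v) z3 b R"
        using S3(1,2) by (auto simp: b_def)
      have "R z1 = turn v (r * (z1 / r))"
        using solves_on_const_eq_turn[OF v(3), of z1] z1(1) R0 r_pos by simp
      moreover have "R z2 = R z1 ** turn (- v) (r * \<beta>)"
        using solves_on_const_eq_turn[OF s2, of z2] z2 by (simp add: z2_def)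
      moreover have "R z3 = R z2 ** turn v (r * \<beta>)"
        using solves_on_const_eq_turn[OF s3, of z3] z3 by (simp add: z3_def)
      moreover have "R b = R z3 ** turn (- v) (r * ((b - z3) / r))"
        using solves_on_const_eq_turn[OF s4, of b] b r_pos by simp
      ultimately have Rb: "R b = turn v (r * (z1 / r)) ** turn (- v) (r * \<beta>) ** turn v (r * \<beta>) ** turn (- v) (r *
          ((b - z3) / r))"
        by simp
      have "r * (z1 / r + 2 * \<beta> + (b - z3) / r) = b"
        using r_pos by (simp add: z3_def z2_def distrib_left)
      moreover have "\<exists>l < r * (z1 / r + 2 * \<beta> + (b - z3) / r). reach U (R b) l"
        unfolding Rb using z1(1) b(1) r_pos by (intro four_arcs_not_optimal[OF U r r2 v(1) \<beta>_bounds[OF \<mu>1]]) auto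
      ultimately obtain l where "l < b" "reach U (R b) l" by auto
      then show ?thesis using opt[of b l] b z3 by auto
    qed
  qed
qed

lemma tangential_zero_interval:
  assumes \<mu>1: "\<mu> = 1"
    and cut: "\<And>a b. 0 \<le> a \<Longrightarrow> a < b \<Longrightarrow> b \<le> L \<Longrightarrow> R a \<noteq> R b"
    and pq: "0 \<le> p" "q \<le> L" "f p = 0" "f q = 0" and s: "s \<in> {p..q}"
  shows "f s = 0"
proof (rule ccontr)
  assume fs: "f s \<noteq> 0"
  have ps: "p < s" "s < q" using s pq fs by (auto simp: order_le_less)
  obtain b where b: "s < b" "b \<le> q" "\<bar>f b\<bar> = 0" "\<And>t. t \<in> {s..<b} \<Longrightarrow> \<bar>f t\<bar> > 0"
  proof (rule first_zero[of s q "\<lambda>t. \<bar>f t\<bar>"])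
    show "continuous_on {s..q} (\<lambda>t. \<bar>f t\<bar>)"
      by (intro continuous_intros continuous_on_subset[OF continuous_f]) (use pq ps in auto)
  qed (use pq ps fs in auto)
  \<comment> \<open>The last zero before \<open>s\<close>, found as a first zero after the
    reflection of time; \<open>a\<close> is its negative.\<close>
  obtain a where a: "- s < a" "a \<le> - p" "\<bar>f (- a)\<bar> = 0" "\<And>t. t \<in> {- s..<a} \<Longrightarrow> \<bar>f
      (- t)\<bar> > 0"
  proof (rule first_zero[of "- s" "- p" "\<lambda>t. \<bar>f (- t)\<bar>"])
    show "continuous_on {- s..- p} (\<lambda>t. \<bar>f (- t)\<bar>)"
      by (intro continuous_intros continuous_on_compose2[OF continuous_f]) (use pq ps in auto)
  qed (use pq ps fs in auto)
  have nz: "f t \<noteq> 0" if "t \<in> {- a<..<b}" for t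
    using a(4)[of "- t"] b(4)[of t] that by (cases "t \<le> s") auto
  have ab: "0 \<le> - a" "- a < b" "b \<le> L" using a b pq by auto
  obtain v where v: "v = U \<or> v = - U" "solves_on (\<lambda>_. v) (- a) b R"
    using nonzero_arc[OF ab nz] by blast
  have z: "f (- a) = 0" "f b = 0" using a(3) b(3) by auto
  note T = tangential_full_circle[OF \<mu>1 ab z v]
  have "R (- a) \<noteq> R (- a + r * (2 * pi))"
    using T(1) ab r_pos by (intro cut) auto
  then show False using T(2) by simp
qed

lemma tangential_type:
  assumes \<mu>1: "\<mu> = 1"
    and cut: "\<And>a b. 0 \<le> a \<Longrightarrow> a < b \<Longrightarrow> b \<le> L \<Longrightarrow> R a \<noteq> R b"
    and z: "z \<in> {0<..<L}" "f z = 0"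
  shows "\<exists>t\<in>dubins_types. has_type U L R t"
proof -
  define Z where "Z = {s \<in> {0..L}. f s = 0}"
  have "closed Z" unfolding Z_def by (intro continuous_closed_preimage_constant continuous_f) auto
  then have Z: "compact Z" by (auto simp: compact_eq_bounded_closed Z_def intro: bounded_subset[of "{0..L}"])
  have zZ: "z \<in> Z" using z by (auto simp: Z_def)
  obtain p where p: "p \<in> Z" "\<And>s. s \<in> Z \<Longrightarrow> p \<le> s" using compact_attains_inf[OF Z] zZ by blast
  obtain q where q: "q \<in> Z" "\<And>s. s \<in> Z \<Longrightarrow> s \<le> q" using compact_attains_sup[OF Z] zZ by blast
  have pq: "0 \<le> p" "p \<le> z" "z \<le> q" "q \<le> L" "f p = 0" "f q = 0"
    using p q zZ by (auto simp: Z_def)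
  have G: "solves_on (\<lambda>_. 0) p q R" if "p < q"
    by (rule zero_arc[OF pq(1) that pq(4)]) (rule tangential_zero_interval[OF \<mu>1 cut pq(1,4-6)])
  have cG: "arc_control U G 0" by (simp add: arc_control_def)
  have nl: "f s \<noteq> 0" if "s \<in> {0<..<p}" for s using p(2)[of s] pq that z by (force simp: Z_def)
  have nr: "f s \<noteq> 0" if "s \<in> {q<..<L}" for s using q(2)[of s] pq that z by (force simp: Z_def)
  have left: "\<exists>v. (v = U \<or> v = - U) \<and> arc_control U C v \<and> solves_on (\<lambda>_. v) 0 p R" if "0 < p"
    using nonzero_arc[OF order_refl that _ nl] pq z by (auto simp: arc_control_def)
  have right: "\<exists>v. (v = U \<or> v = - U) \<and> arc_control U C v \<and> solves_on (\<lambda>_. v) q L R" if "q < L"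
    using nonzero_arc[OF _ that order_refl nr] pq z by (auto simp: arc_control_def)
  show ?thesis
  proof (cases "p < q")
    case True
    note G = G[OF True]
    consider "0 < p" "q < L" | "0 < p" "q = L" | "p = 0" "q < L" | "p = 0" "q = L"
      using pq by fastforce
    then show ?thesis
    proof cases
      case 1
      obtain v v' where "arc_control U C v" "solves_on (\<lambda>_. v) 0 p R" "arc_control U C v'" "solves_on (\<lambda>_.
          v') q L R"
        using left[OF 1(1)] right[OF 1(2)] by blast
      then have "has_type U L R [C, G, C]"
        by (intro has_type_three[OF 1(1) True 1(2) _ cG _ _ G, of C v C v']) auto
      then show ?thesis by blast
    next
      case 2
      obtain v where "arc_control U C v" "solves_on (\<lambda>_. v) 0 p R" using left[OF 2(1)] by blast
      then have "has_type U L R [C, G]"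
        using True G 2 by (intro has_type_two[OF 2(1) _ _ cG, of L C v]) auto
      then show ?thesis by blast
    next
      case 3
      obtain v where "arc_control U C v" "solves_on (\<lambda>_. v) q L R" using right[OF 3(2)] by blast
      then have "has_type U L R [G, C]"
        using True G 3 by (intro has_type_two[OF _ 3(2) cG, of C v]) auto
      then show ?thesis by blast
    next
      case 4
      then have "has_type U L R [G]" using L G by (intro has_type_one[OF _ cG]) auto
      then show ?thesis by blast
    qed
  next
    \<comment> \<open>A single tangential zero. The controls on its two sides may agree, and then
      the two pieces form one arc.\<close>
    case False
    then have pz: "p = z" "q = z" using pq by auto
    have p0: "0 < p" "q < L" using z pz by auto
    obtain v v' where v: "v = U \<or> v = - U" "arc_control U C v" "solves_on (\<lambda>_. v) 0 z R"
      "v' = U \<or> v' = - U" "arc_control U C v'" "solves_on (\<lambda>_. v') z L R"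
      using left[OF p0(1)] right[OF p0(2)] unfolding pz by blast
    show ?thesis
    proof (cases "v' = v")
      case True
      then have "solves_on (\<lambda>_. v) 0 L R" using v(3,6) z by (intro solves_on_combine[of _ 0 z R L]) auto
      then have "has_type U L R [C]" using L v(2) by (intro has_type_one[of L U C v]) auto
      then show ?thesis by blast
    next
      case False
      then have "v' = - v" using v(1,4) by auto
      then have "has_type U L R [C, C]" using z v by (intro has_type_two[of z L U C v C v']) auto
      then show ?thesis by blast
    qed
  qed
qed

end

theorem theorem3p1:
  fixes U r L :: real and Rf :: "real^3^3" and R :: "real \<Rightarrow> real^3^3"
  assumes "U > 0"
    and "r = 1 / sqrt (1 + U\<^sup>2)"
    and "0 < r" and "r \<le> 1 / 2"
    and "rotation_matrix Rf"
    and "optimal_path U Rf L R"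
  shows "\<exists>w \<in> {[C, G, C], [C, C, C], [C, G], [G, C], [C, C], [G], [C]}. has_type U L R w"
proof -
  have RL: "R 0 = mat 1" "R L = Rf" and path: "is_path U L R"
    using assms(6) by (auto simp: optimal_path_def connects_def)
  obtain u where L0: "0 \<le> L" and u: "u \<in> borel_measurable (lebesgue_on {0..L})"
    and bound: "\<And>s. s \<in> {0..L} \<Longrightarrow> \<bar>u s\<bar> \<le> U" and R: "solves_on u 0 L R"
    using path by (auto simp: is_path_def)
  have opt: "L \<le> l" if "reach U (R L) l" for l
    using optimal_path_le_reach[OF assms(6)] that RL(2) by simp
  show ?thesis
  proof (cases "L = 0")
    case True
    have "solves_on (\<lambda>_. 0) 0 0 R"
    proof -
      have "(g has_integral 0) {0}" for g :: "real \<Rightarrow> real^3" by (rule has_integral_refl)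
      then show ?thesis using solves_on_rotation[OF R, of 0] True by (simp add: solves_on_def)
    qed
    then have "has_type U L R [G]"
      using True by (intro has_type_one[of L U G 0]) (auto simp: arc_control_def)
    then show ?thesis by blast
  next
    case False
    then have L: "L > 0" using L0 by simp
    obtain P \<mu> N where "norm P = 1" "0 \<le> \<mu>" "negligible N"
      "\<And>s. s \<in> {0..L} \<Longrightarrow> P \<bullet> normal_vec (R s) = \<mu> - U * \<bar>P \<bullet> position (R s)\<bar>"
      "\<And>s. s \<in> {0..L} - N \<Longrightarrow> u s * (P \<bullet> position (R s)) = U * \<bar>P \<bullet> position (R
          s)\<bar>"
      using maximum_principle[OF R u bound RL(1) L opt] by blast
    then interpret extremal U L r u R P \<mu> N
      using assms(1,2) L R bound by unfold_locales
    have rot: "rotation_matrix (R s)" if "s \<in> {0..L}" for s by (rule solves_on_rotation[OF R that])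
    have seg: "reach U (transpose (R a) ** R b) (b - a)" if "0 \<le> a" "a \<le> b" "b \<le> L" for a b
      by (rule reach_segment[OF R u bound that])
    \<comment> \<open>Every initial part of an optimal path is optimal: a shorter way to
      \<open>R b\<close> could be continued by the rest of the path.\<close>
    have opt': "b \<le> l" if "0 \<le> b" "b \<le> L" "reach U (R b) l" for b l
    proof -
      have "reach U (R b ** (transpose (R b) ** R L)) (l + (L - b))"
        using that by (intro reach_mult seg) auto
      then have "reach U (R L) (l + (L - b))"
        using that by (simp add: matrix_mul_assoc rotation_transpose_mult[OF rot])
      from opt[OF this] show ?thesis by simp
    qed
    \<comment> \<open>A repeated configuration would allow the loop between the two times to be cut
      out.\<close>
    have cut: "R a \<noteq> R b" if "0 \<le> a" "a < b" "b \<le> L" for a b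
    proof
      assume "R a = R b"
      moreover have "reach U (R a) a" using seg[of 0 a] that RL(1) by (simp add: transpose_mat)
      ultimately show False using opt'[of b a] that by simp
    qed
    show ?thesis
    proof (cases "\<exists>z\<in>{0<..<L}. f z = 0")
      \<comment> \<open>Without interior zeros the control never switches; this includes the case
        \<open>\<mu> > 1\<close>.\<close>
      case False
      then obtain v where "v = U \<or> v = - U" "solves_on (\<lambda>_. v) 0 L R"
        using nonzero_arc[OF order_refl L order_refl] by blast
      then have "has_type U L R [C]"
        using L by (intro has_type_one[of L U C v]) (auto simp: arc_control_def)
      then show ?thesis by blast
    next
      case True
      then obtain z where z: "z \<in> {0<..<L}" "f z = 0" by blast
      have "\<mu>\<^sup>2 \<le> 1" using e_zero_sq[of z] z zero_le_power2[of "e z"] by auto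
      then have "\<mu> \<le> 1" by (intro power2_le_imp_le[of \<mu> 1]) auto
      then consider "\<mu> < 1" | "\<mu> = 1" by linarith
      then show ?thesis
      proof cases
        case 1
        show ?thesis by (rule transversal_type[OF assms(4) RL(1) opt' 1 z])
      next
        case 2
        show ?thesis by (rule tangential_type[OF 2 cut z])
      qed
    qed
  qed
qed

end
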